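(* Let $p\in\mathbb{Z}^2\setminus\{0\}$, let $\Gamma\in\mathbb{C}$ be a constant, let $\hat k\in\mathbb{Z}^2\setminus\{0\}$, and let $s\ge 0$ be an integer. Let $\mathcal{L}_{\hat k}$ be the linear operator on $H^s$ associated with the class $\Sigma_{\hat k}$, let $\bar D_{|p|}$ be the disk of radius $|p|$, and put $$b=-\frac12|\Gamma|\,|p|^{-2}\begin{vmatrix}p_1&\hat k_1\\ p_2&\hat k_2\end{vmatrix}$$ (all as defined in the context). Then: 1. If $\Sigma_{\hat k}\cap\bar D_{|p|}=\emptyset$, then the entire $H^s$ spectrum of $\mathcal{L}_{\hat k}$ is its continuous spectrum, and it is the segment $\{i\tau:\tau\in\mathbb{R},\ |\tau|\le 2|b|\}$ of the imaginary axis. That is, both the residual and the point spectra of $\mathcal{L}_{\hat k}$ are empty. 2. If $\Sigma_{\hat k}\cap\bar D_{|p|}\neq\emptyset$, then the entire essential $H^s$ spectrum of $\mathcal{L}_{\hat k}$ is its continuous spectrum, and it is the segment $\{i\tau:\tau\in\mathbb{R},\ |\tau|\le 2|b|\}$ of the imaginary axis. That is, the residual spectrum of $\mathcal{L}_{\hat k}$ is empty. The point spectrum of $\mathcal{L}_{\hat k}$ is symmetric with respect to both the real and the imaginary axes.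
   Context: For $k=(k_1,k_2)^T\in\mathbb{Z}^2$ write $|k|^2=k_1^2+k_2^2$. For $p,q\in\mathbb{Z}^2\setminus\{0\}$ set $$A(p,q)=\tfrac12\left[|q|^{-2}-|p|^{-2}\right](p_1q_2-p_2q_1).$$ The 2D Euler equation in vorticity form with periodic boundary conditions, written for the Fourier coefficients $\omega_k$ ($k\in\mathbb{Z}^2\setminus\{0\}$) of the vorticity, is $\dot\omega_k=\sum_{k=p'+q'}A(p',q')\omega_{p'}\omega_{q'}$. The fixed mode $p\in\mathbb{Z}^2\setminus\{0\}$ and the constant $\Gamma\in\mathbb{C}$ determine the fixed point $\omega^*_p=\Gamma$, $\omega^*_k=0$ for $k\ne p,-p$ (with $\omega^*_{-p}=\bar\Gamma$). The equation linearized at this fixed point is $$\dot\omega_k=A(p,k-p)\,\Gamma\,\omega_{k-p}+A(-p,k+p)\,\bar\Gamma\,\omega_{k+p}.$$ For $\hat k\in\mathbb{Z}^2\setminus\{0\}$ the class of $\hat k$ is $\Sigma_{\hat k}=\{\hat k+np\in\mathbb{Z}^2\setminus\{0\}: n\in\mathbb{Z}\}$. The linearized equation decouples into invariant subsystems, one for each class. The operator $\mathcal{L}_{\hat k}$ acts on complex sequences $\omega=(\omega_{\hat k+np})$ indexed by $\Sigma_{\hat k}$ by $$(\mathcal{L}_{\hat k}\omega)_{\hat k+np}=A(p,\hat k+(n-1)p)\,\Gamma\,\omega_{\hat k+(n-1)p}+A(-p,\hat k+(n+1)p)\,\bar\Gamma\,\omega_{\hat k+(n+1)p},$$ where terms with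 index $0\in\mathbb{Z}^2$ are omitted. For an integer $s\ge0$, $H^s$ is the Sobolev space of complex sequences on $\Sigma_{\hat k}$ with $\sum_{k\in\Sigma_{\hat k}}|k|^{2s}|\omega_k|^2<\infty$, so $H^0=\ell_2$. The disk of radius $|p|$ is $\bar D_{|p|}=\{k\in\mathbb{Z}^2\setminus\{0\}:|k|\le|p|\}$.
   Formalization: Continuous spectrum = segment and empty point spectrum are claimed only for b≠0 (if b=0 then L=0 and 0 is an eigenvalue). Continuous spectrum means non-closed range; residual is the rest of the spectrum outside point and continuous; the non-dense-range residual is shown empty only for s=0. *)

theory Defs
  imports "HOL-Analysis.Analysis" "HOL-Library.Function_Algebras"
begin

section \<open>Spectra of an operator on a space of complex sequences\<close>

text \<open>
  Below, \<open>X\<close> is a linear subspace of the functions from an index type to the complex numbers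
  that is complete for the norm \<open>N\<close>, and \<open>T\<close> maps \<open>X\<close> linearly to itself.  (A carrier set is
  used, and not a type, because the Sobolev spaces depend on \<open>s\<close> and on the class.)
\<close>

definition cscale :: "complex \<Rightarrow> ('i \<Rightarrow> complex) \<Rightarrow> 'i \<Rightarrow> complex" where
  "cscale c u = (\<lambda>k. c * u k)"

interpretation cseq: vector_space "cscale :: complex \<Rightarrow> ('i \<Rightarrow> complex) \<Rightarrow> 'i \<Rightarrow> complex"
  by unfold_locales (auto simp: cscale_def fun_eq_iff algebra_simps)

definition shifted ::
  "(('i \<Rightarrow> complex) \<Rightarrow> 'i \<Rightarrow> complex) \<Rightarrow> complex \<Rightarrow> ('i \<Rightarrow> complex) \<Rightarrow> 'i \<Rightarrow> complex" where
  "shifted T z u = T u - cscale z u"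

definition norm_topology ::
  "('i \<Rightarrow> complex) set \<Rightarrow> (('i \<Rightarrow> complex) \<Rightarrow> real) \<Rightarrow> ('i \<Rightarrow> complex) topology" where
  "norm_topology X N = Metric_space.mtopology X (\<lambda>u v. N (u - v))"

definition resolvent_set ::
  "('i \<Rightarrow> complex) set \<Rightarrow> (('i \<Rightarrow> complex) \<Rightarrow> real) \<Rightarrow> (('i \<Rightarrow> complex) \<Rightarrow> 'i \<Rightarrow> complex) \<Rightarrow> complex set"
  where
  "resolvent_set X N T =
    {z. bij_betw (shifted T z) X X \<and> (\<exists>C. \<forall>u\<in>X. N u \<le> C * N (shifted T z u))}"

definition spectrum ::
  "('i \<Rightarrow> complex) set \<Rightarrow> (('i \<Rightarrow> complex) \<Rightarrow> real) \<Rightarrow> (('i \<Rightarrow> complex) \<Rightarrow> 'i \<Rightarrow> complex) \<Rightarrow> complex set"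
  where
  "spectrum X N T = - resolvent_set X N T"

definition point_spectrum ::
  "('i \<Rightarrow> complex) set \<Rightarrow> (('i \<Rightarrow> complex) \<Rightarrow> 'i \<Rightarrow> complex) \<Rightarrow> complex set" where
  "point_spectrum X T = {z. \<exists>u\<in>X. u \<noteq> 0 \<and> T u = cscale z u}"

text \<open>
  Continuous and residual spectrum follow the convention of Akhiezer--Glazman and
  Birman--Solomyak: \<open>z\<close> belongs to the continuous spectrum iff the range of \<open>T - z\<close> is not closed,
  and the residual spectrum is the part of the spectrum that is neither point nor continuous, so
  that it consists of those \<open>z\<close> for which \<open>T - z\<close> is injective with closed, proper range.  Point
  and continuous spectrum may overlap.  The convention matters here:

  \<^item> If \<open>\<bar>k\<bar> = \<bar>p\<bar>\<close> for some \<open>k\<close> in the class, then the unit sequence at \<open>k\<close> is in the kernel of the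
    linearized Euler operator, so 0 is an eigenvalue lying inside the segment that is to be the
    continuous spectrum.  A definition making the two parts disjoint cannot be used.

  \<^item> For \<open>s \<ge> 1\<close>, elements of \<open>H\<^sup>s\<close> are absolutely summable.  For the constant-coefficient
    operator that sends \<open>u\<close> to the sequence with entries \<open>u(n - 1) - u(n + 1)\<close>, and \<open>z\<close> its symbol
    at the angle \<open>\<theta>\<close>, the bounded functional sending \<open>u\<close> to \<open>\<Sum>\<^sub>n u(n) e\<^sup>-\<^sup>i\<^sup>n\<^sup>\<theta>\<close> vanishes on the
    range of the operator minus \<open>z\<close>, which is therefore not dense although \<open>z\<close> is no eigenvalue;
    its range is not closed either.  The linearized Euler operator behaves in the same way at
    every interior point of the segment, with at most finitely many exceptions.  So the
    definition of the residual spectrum by density of the range agrees with the one used here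
    only for \<open>s = 0\<close>; it is given separately as \<open>nondense_residual_spectrum\<close>.
\<close>

definition continuous_spectrum ::
  "('i \<Rightarrow> complex) set \<Rightarrow> (('i \<Rightarrow> complex) \<Rightarrow> real) \<Rightarrow> (('i \<Rightarrow> complex) \<Rightarrow> 'i \<Rightarrow> complex) \<Rightarrow> complex set"
  where
  "continuous_spectrum X N T = {z. \<not> closedin (norm_topology X N) (shifted T z ` X)}"

definition residual_spectrum ::
  "('i \<Rightarrow> complex) set \<Rightarrow> (('i \<Rightarrow> complex) \<Rightarrow> real) \<Rightarrow> (('i \<Rightarrow> complex) \<Rightarrow> 'i \<Rightarrow> complex) \<Rightarrow> complex set"
  where
  "residual_spectrum X N T =
    spectrum X N T - (point_spectrum X T \<union> continuous_spectrum X N T)"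

definition nondense_residual_spectrum ::
  "('i \<Rightarrow> complex) set \<Rightarrow> (('i \<Rightarrow> complex) \<Rightarrow> real) \<Rightarrow> (('i \<Rightarrow> complex) \<Rightarrow> 'i \<Rightarrow> complex) \<Rightarrow> complex set"
  where
  "nondense_residual_spectrum X N T =
    {z. z \<notin> point_spectrum X T \<and> norm_topology X N closure_of (shifted T z ` X) \<noteq> X}"

definition fredholm ::
  "('i \<Rightarrow> complex) set \<Rightarrow> (('i \<Rightarrow> complex) \<Rightarrow> real) \<Rightarrow> (('i \<Rightarrow> complex) \<Rightarrow> 'i \<Rightarrow> complex) \<Rightarrow> bool"
  where
  "fredholm X N T \<longleftrightarrow>
    (\<exists>B. finite B \<and> {u \<in> X. T u = 0} \<subseteq> cseq.span B) \<and>
    closedin (norm_topology X N) (T ` X) \<and>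
    (\<exists>C. finite C \<and> (\<forall>u\<in>X. \<exists>v\<in>X. u - T v \<in> cseq.span C))"

definition essential_spectrum ::
  "('i \<Rightarrow> complex) set \<Rightarrow> (('i \<Rightarrow> complex) \<Rightarrow> real) \<Rightarrow> (('i \<Rightarrow> complex) \<Rightarrow> 'i \<Rightarrow> complex) \<Rightarrow> complex set"
  where
  "essential_spectrum X N T = {z. \<not> fredholm X N (shifted T z)}"


section \<open>The linearized 2D Euler equation\<close>

definition knorm :: "int \<times> int \<Rightarrow> real" where
  "knorm k = sqrt ((of_int (fst k))\<^sup>2 + (of_int (snd k))\<^sup>2)"

definition kdet :: "int \<times> int \<Rightarrow> int \<times> int \<Rightarrow> real" where
  "kdet p q = of_int (fst p * snd q - snd p * fst q)"

definition euler_A :: "int \<times> int \<Rightarrow> int \<times> int \<Rightarrow> real" where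
  "euler_A p q = 1 / 2 * (1 / (knorm q)\<^sup>2 - 1 / (knorm p)\<^sup>2) * kdet p q"

definition mode_class :: "int \<times> int \<Rightarrow> int \<times> int \<Rightarrow> (int \<times> int) set" where
  "mode_class p kh = {kh + (n * fst p, n * snd p) | n :: int. True} - {0}"

definition mode_disk :: "int \<times> int \<Rightarrow> (int \<times> int) set" where
  "mode_disk p = {k. k \<noteq> 0 \<and> knorm k \<le> knorm p}"

text \<open>Sequences on the class are functions on the whole lattice that vanish off the class.\<close>

definition sobolev :: "int \<times> int \<Rightarrow> int \<times> int \<Rightarrow> nat \<Rightarrow> (int \<times> int \<Rightarrow> complex) set" where
  "sobolev p kh s =
    {w. (\<forall>k. k \<notin> mode_class p kh \<longrightarrow> w k = 0) \<and>
        (\<lambda>k. knorm k ^ (2 * s) * (cmod (w k))\<^sup>2) summable_on mode_class p kh}"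

definition sobolev_norm ::
  "int \<times> int \<Rightarrow> int \<times> int \<Rightarrow> nat \<Rightarrow> (int \<times> int \<Rightarrow> complex) \<Rightarrow> real" where
  "sobolev_norm p kh s w =
    sqrt (\<Sum>\<^sub>\<infinity>k\<in>mode_class p kh. knorm k ^ (2 * s) * (cmod (w k))\<^sup>2)"

definition euler_L ::
  "int \<times> int \<Rightarrow> complex \<Rightarrow> int \<times> int \<Rightarrow> (int \<times> int \<Rightarrow> complex) \<Rightarrow> int \<times> int \<Rightarrow> complex" where
  "euler_L p \<Gamma> kh w =
    (\<lambda>k. if k \<in> mode_class p kh
         then (if k - p = 0 then 0 else of_real (euler_A p (k - p)) * \<Gamma> * w (k - p)) +
              (if k + p = 0 then 0 else of_real (euler_A (- p) (k + p)) * cnj \<Gamma> * w (k + p))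
         else 0)"

definition euler_b :: "int \<times> int \<Rightarrow> complex \<Rightarrow> int \<times> int \<Rightarrow> real" where
  "euler_b p \<Gamma> kh = - (1 / 2) * cmod \<Gamma> * (1 / (knorm p)\<^sup>2) * kdet p kh"

definition imag_segment :: "real \<Rightarrow> complex set" where
  "imag_segment r = {\<i> * of_real \<tau> | \<tau>. \<bar>\<tau>\<bar> \<le> r}"

end

theory Submission
  imports Defs
begin

text \<open>
  Write \<open>k\<^sub>n = kh + n p\<close>, and let \<open>S\<close> be the right shift of two-sided sequences.  All \<open>k\<^sub>n\<close> have the same
  determinant with \<open>p\<close>.  If it or \<open>\<Gamma>\<close> vanishes, then \<open>b = 0\<close>, the operator is zero, and everything
  can be read off.  Otherwise no \<open>k\<^sub>n\<close> is 0, and after removal of the phase of \<open>\<Gamma>\<^sup>n\<close> and of the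
  Sobolev weight \<open>\<bar>k\<^sub>n\<bar>\<^sup>s\<close> the operator becomes \<open>M = b (S \<alpha> - S\<^sup>-\<^sup>1 \<beta>)\<close> on the Hilbert space of square
  summable sequences, with real coefficients \<open>\<alpha>\<^sub>n, \<beta>\<^sub>n\<close> tending to 1 in both directions.  For \<open>s = 0\<close> both
  are equal to \<open>\<rho>\<^sub>n = 1 - \<bar>p\<bar>\<^sup>2 / \<bar>k\<^sub>n\<bar>\<^sup>2\<close>.

  Off the segment, \<open>M - z\<close> is a finite rank perturbation of an operator of the same form whose
  coefficients are uniformly close to 1.  A rotation of the latter is coercive, since \<open>S - S\<^sup>-\<^sup>1\<close> is
  antisymmetric with norm at most 2, so it is invertible by a contraction argument.  Hence \<open>M - z\<close> is
  Fredholm of index 0 (\<open>off_segment\<close>): its range is closed, and it is boundedly invertible unless \<open>z\<close>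
  is an eigenvalue.  No compact operator theory is needed.

  On the segment, truncated plane waves are approximate eigenvectors \<open>v\<^sub>j\<close> that can be placed
  arbitrarily far to the right, with disjoint supports and \<open>(M - z) v\<^sub>j\<close> summable in norm.  If the range
  were closed, it would contain \<open>\<Sum>\<^sub>j c\<^sub>j (M - z) v\<^sub>j\<close> for every bounded \<open>c\<close>; a preimage would differ
  from the formal sum \<open>\<Sum>\<^sub>j c\<^sub>j v\<^sub>j\<close> by a solution of a three-term recurrence.  As these form a space of
  dimension at most 2 far to the right, three suitable choices of \<open>c\<close> lead to a nonzero combination
  that is square summable, which is absurd (\<open>on_segment_range_not_closed\<close>).  This covers the end points
  of the segment as well, and replaces the open mapping theorem.

  If the class avoids the disk, then \<open>0 < \<rho>\<^sub>n < 1\<close>.  Pairing the eigenvalue equation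
  \<open>b (S - S\<^sup>-\<^sup>1) \<rho> x = z x\<close> with \<open>\<rho> x\<close> gives \<open>Re z = 0\<close>, and for imaginary \<open>z\<close> a convexity or an energy
  argument for a real symmetric recurrence excludes nonzero null sequences as solutions (\<open>eigenvector_zero\<close>).
  In general, complex conjugation and alternation of signs act on the eigenvectors.  Finally, for
  \<open>s = 0\<close> a vector orthogonal to the range of \<open>M - z\<close> at an imaginary \<open>z\<close> would produce an eigenvector
  for \<open>z\<close> (\<open>dense_range\<close>).
\<close>

section \<open>The Hilbert space of square summable families\<close>

text \<open>Square summable complex families over an arbitrary index type, as a real Hilbert space; the
  inner product is the real part of the usual sesquilinear one.\<close>

typedef 'i ell2 = "{f :: 'i \<Rightarrow> complex. (\<lambda>i. (cmod (f i))\<^sup>2) summable_on UNIV}"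
  morphisms coord Abs_ell2
  by (rule exI[of _ "\<lambda>_. 0"]) simp

setup_lifting type_definition_ell2

lemma coord_summable: "(\<lambda>i. (cmod (coord v i))\<^sup>2) summable_on UNIV"
  using coord[of v] by simp

lemma ell2_eqI: "(\<And>i. coord u i = coord v i) \<Longrightarrow> u = v"
  by (metis coord_inject ext)

lemma coord_Abs_ell2:
  "(\<lambda>i. (cmod (f i))\<^sup>2) summable_on UNIV \<Longrightarrow> coord (Abs_ell2 f) = f"
  by (simp add: Abs_ell2_inverse)

lemma cmod_add_square_le: "(cmod (x + y))\<^sup>2 \<le> 2 * (cmod x)\<^sup>2 + 2 * (cmod y)\<^sup>2"
proof -
  have "(cmod (x + y))\<^sup>2 \<le> (cmod x + cmod y)\<^sup>2"
    by (simp add: norm_triangle_ineq power_mono)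
  also have "\<dots> \<le> 2 * (cmod x)\<^sup>2 + 2 * (cmod y)\<^sup>2"
    using sum_squares_bound[of "cmod x" "cmod y"] by (simp add: power2_sum)
  finally show ?thesis .
qed

lemma square_summable_add:
  assumes "(\<lambda>i. (cmod (f i))\<^sup>2) summable_on A" "(\<lambda>i. (cmod (g i))\<^sup>2) summable_on A"
  shows "(\<lambda>i. (cmod (f i + g i))\<^sup>2) summable_on A"
proof (rule summable_on_comparison_test)
  show "(\<lambda>i. 2 * (cmod (f i))\<^sup>2 + 2 * (cmod (g i))\<^sup>2) summable_on A"
    by (intro summable_on_add summable_on_cmult_right assms)
qed (auto intro: cmod_add_square_le)

lemma square_summable_bounded_mult:
  assumes "(\<lambda>i. (cmod (f i))\<^sup>2) summable_on A" "\<And>i. cmod (a i) \<le> C"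
  shows "(\<lambda>i. (cmod (a i * f i))\<^sup>2) summable_on A"
proof (rule summable_on_comparison_test)
  show "(\<lambda>i. C\<^sup>2 * (cmod (f i))\<^sup>2) summable_on A"
    by (intro summable_on_cmult_right assms)
  show "(cmod (a i * f i))\<^sup>2 \<le> C\<^sup>2 * (cmod (f i))\<^sup>2" for i
    using assms(2)[of i] by (simp add: norm_mult power_mult_distrib mult_right_mono power_mono)
qed auto

lemma summable_on_inner_coord: "(\<lambda>i. inner (coord u i) (coord v i)) summable_on UNIV"
proof (rule abs_summable_summable, rule summable_on_comparison_test)
  show "(\<lambda>i. (cmod (coord u i))\<^sup>2 + (cmod (coord v i))\<^sup>2) summable_on UNIV"
    by (intro summable_on_add coord_summable)
  show "norm (inner (coord u i) (coord v i)) \<le> (cmod (coord u i))\<^sup>2 + (cmod (coord v i))\<^sup>2" for i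
  proof -
    have "norm (inner (coord u i) (coord v i)) \<le> cmod (coord u i) * cmod (coord v i)"
      using Cauchy_Schwarz_ineq2 by auto
    also have "\<dots> \<le> (cmod (coord u i))\<^sup>2 + (cmod (coord v i))\<^sup>2"
      using sum_squares_bound[of "cmod (coord u i)" "cmod (coord v i)"]
        mult_nonneg_nonneg[OF norm_ge_zero[of "coord u i"] norm_ge_zero[of "coord v i"]]
      by linarith
    finally show ?thesis .
  qed
qed auto

instantiation ell2 :: (type) real_inner
begin

lift_definition zero_ell2 :: "'a ell2" is "\<lambda>_. 0" by simp

lift_definition plus_ell2 :: "'a ell2 \<Rightarrow> 'a ell2 \<Rightarrow> 'a ell2" is "\<lambda>f g i. f i + g i"
  by (rule square_summable_add)

lift_definition uminus_ell2 :: "'a ell2 \<Rightarrow> 'a ell2" is "\<lambda>f i. - f i" by simp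

lift_definition minus_ell2 :: "'a ell2 \<Rightarrow> 'a ell2 \<Rightarrow> 'a ell2" is "\<lambda>f g i. f i - g i"
  by (subst diff_conv_add_uminus, rule square_summable_add) auto

lift_definition scaleR_ell2 :: "real \<Rightarrow> 'a ell2 \<Rightarrow> 'a ell2" is "\<lambda>r f i. r *\<^sub>R f i"
  by (simp add: power_mult_distrib summable_on_cmult_right)

definition inner_ell2 :: "'a ell2 \<Rightarrow> 'a ell2 \<Rightarrow> real" where
  "inner_ell2 u v = (\<Sum>\<^sub>\<infinity>i. inner (coord u i) (coord v i))"

definition norm_ell2 :: "'a ell2 \<Rightarrow> real" where "norm_ell2 u = sqrt (inner u u)"

definition dist_ell2 :: "'a ell2 \<Rightarrow> 'a ell2 \<Rightarrow> real" where "dist_ell2 u v = norm (u - v)"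

definition sgn_ell2 :: "'a ell2 \<Rightarrow> 'a ell2" where "sgn_ell2 u = scaleR (inverse (norm u)) u"

definition uniformity_ell2 :: "('a ell2 \<times> 'a ell2) filter" where
  "uniformity_ell2 = (INF e\<in>{0<..}. principal {(x, y). dist x y < e})"

definition open_ell2 :: "'a ell2 set \<Rightarrow> bool" where
  "open_ell2 U \<longleftrightarrow> (\<forall>x\<in>U. eventually (\<lambda>(x', y). x' = x \<longrightarrow> y \<in> U) uniformity)"

instance
proof
  fix x y z :: "'a ell2" and r s :: real
  show "x + y + z = x + (y + z)" by transfer (simp add: algebra_simps)
  show "x + y = y + x" by transfer (simp add: algebra_simps)
  show "0 + x = x" by transfer simp
  show "- x + x = 0" by transfer simp
  show "x - y = x + - y" by transfer simp
  show "r *\<^sub>R (x + y) = r *\<^sub>R x + r *\<^sub>R y" by transfer (simp add: algebra_simps)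
  show "(r + s) *\<^sub>R x = r *\<^sub>R x + s *\<^sub>R x" by transfer (simp add: algebra_simps)
  show "r *\<^sub>R s *\<^sub>R x = (r * s) *\<^sub>R x" by transfer simp
  show "1 *\<^sub>R x = x" by transfer simp
  show "dist x y = norm (x - y)" by (simp add: dist_ell2_def)
  show "sgn x = scaleR (inverse (norm x)) x" by (simp add: sgn_ell2_def)
  show "uniformity = (INF e\<in>{0<..}. principal {(x :: 'a ell2, y). dist x y < e})"
    by (simp add: uniformity_ell2_def)
  show "open U \<longleftrightarrow> (\<forall>x\<in>U. eventually (\<lambda>(x', y). x' = x \<longrightarrow> y \<in> U) uniformity)"
    for U :: "'a ell2 set" by (simp add: open_ell2_def)
  show "inner x y = inner y x" by (simp add: inner_ell2_def inner_commute)
  show "inner (x + y) z = inner x z + inner y z"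
    unfolding inner_ell2_def
    by (subst infsum_add[symmetric])
      (auto intro: summable_on_inner_coord simp: plus_ell2.rep_eq inner_add_left)
  show "inner (r *\<^sub>R x) y = r * inner x y"
    unfolding inner_ell2_def
    by (subst infsum_cmult_right[symmetric])
      (auto intro: summable_on_inner_coord simp: scaleR_ell2.rep_eq)
  show "0 \<le> inner x x" by (simp add: inner_ell2_def infsum_nonneg)
  show "inner x x = 0 \<longleftrightarrow> x = 0"
  proof
    assume "inner x x = 0"
    then have "(\<Sum>\<^sub>\<infinity>i. inner (coord x i) (coord x i)) \<le> 0"
      by (simp add: inner_ell2_def)
    then have "inner (coord x i) (coord x i) = 0" for i
      by (rule nonneg_infsum_le_0D[OF _ summable_on_inner_coord]) auto
    then show "x = 0" by (intro ell2_eqI) (simp add: zero_ell2.rep_eq)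
  qed (simp add: inner_ell2_def zero_ell2.rep_eq)
  show "norm x = sqrt (inner x x)" by (simp add: norm_ell2_def)
qed

end

lemmas coord_simps [simp] =
  zero_ell2.rep_eq plus_ell2.rep_eq minus_ell2.rep_eq uminus_ell2.rep_eq scaleR_ell2.rep_eq

lemma coord_sum [simp]: "coord (sum f A) i = (\<Sum>a\<in>A. coord (f a) i)"
  by (induction A rule: infinite_finite_induct) auto

lemma norm_ell2_square: "(norm v)\<^sup>2 = (\<Sum>\<^sub>\<infinity>i. (cmod (coord v i))\<^sup>2)"
  unfolding power2_norm_eq_inner inner_ell2_def ..

lemma sum_coord_le_norm: "finite F \<Longrightarrow> (\<Sum>i\<in>F. (cmod (coord v i))\<^sup>2) \<le> (norm v)\<^sup>2"
  unfolding norm_ell2_square by (rule finite_sum_le_infsum) (auto intro: coord_summable)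

lemma norm_coord_le: "cmod (coord v i) \<le> norm v"
  by (rule power2_le_imp_le) (use sum_coord_le_norm[of "{i}" v] in auto)

lemma bounded_linear_coord: "bounded_linear (\<lambda>v. coord v i)"
  by (rule bounded_linear_intro[where K = 1]) (auto simp: norm_coord_le)

lemma ell2_boundI:
  assumes "\<And>F. finite F \<Longrightarrow> (\<Sum>i\<in>F. (cmod (f i))\<^sup>2) \<le> C\<^sup>2" "0 \<le> C"
  shows "(\<lambda>i. (cmod (f i))\<^sup>2) summable_on UNIV" "norm (Abs_ell2 f) \<le> C"
proof -
  show s: "(\<lambda>i. (cmod (f i))\<^sup>2) summable_on UNIV"
  proof (rule nonneg_bdd_above_summable_on)
    show "bdd_above (sum (\<lambda>i. (cmod (f i))\<^sup>2) ` {F. F \<subseteq> UNIV \<and> finite F})"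
      using assms(1) by (intro bdd_aboveI2[where M = "C\<^sup>2"]) blast
  qed simp
  have "(norm (Abs_ell2 f))\<^sup>2 \<le> C\<^sup>2"
    unfolding norm_ell2_square coord_Abs_ell2[OF s]
    by (rule infsum_le_finite_sums[OF s]) (rule assms(1))
  then show "norm (Abs_ell2 f) \<le> C" using assms(2) by (rule power2_le_imp_le)
qed

instance ell2 :: (type) complete_space
proof
  fix X :: "nat \<Rightarrow> 'a ell2"
  assume C: "Cauchy X"
  define f where "f i = lim (\<lambda>n. coord (X n) i)" for i
  have f: "(\<lambda>n. coord (X n) i) \<longlonglongrightarrow> f i" for i
    unfolding f_def
    by (rule convergent_LIMSEQ_iff[THEN iffD1], rule Cauchy_convergent,
        rule bounded_linear.Cauchy[OF bounded_linear_coord C])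
  have tail: "(\<Sum>i\<in>F. (cmod (f i - coord (X n) i))\<^sup>2) \<le> e\<^sup>2"
    if "finite F" and e: "\<forall>m\<ge>N. \<forall>n\<ge>N. dist (X m) (X n) < e" and "n \<ge> N" for F e N n
  proof (rule tendsto_upperbound)
    show "(\<lambda>m. \<Sum>i\<in>F. (cmod (coord (X m) i - coord (X n) i))\<^sup>2)
        \<longlonglongrightarrow> (\<Sum>i\<in>F. (cmod (f i - coord (X n) i))\<^sup>2)"
      by (intro tendsto_intros f)
    have "(\<Sum>i\<in>F. (cmod (coord (X m) i - coord (X n) i))\<^sup>2) \<le> e\<^sup>2" if "m \<ge> N" for m
    proof -
      have "(\<Sum>i\<in>F. (cmod (coord (X m) i - coord (X n) i))\<^sup>2) \<le> (norm (X m - X n))\<^sup>2"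
        using sum_coord_le_norm[OF \<open>finite F\<close>, of "X m - X n"] by simp
      also have "\<dots> \<le> e\<^sup>2"
        using e \<open>m \<ge> N\<close> \<open>n \<ge> N\<close> by (intro power_mono) (auto simp: dist_norm less_imp_le)
      finally show ?thesis .
    qed
    then show "\<forall>\<^sub>F m in sequentially.
        (\<Sum>i\<in>F. (cmod (coord (X m) i - coord (X n) i))\<^sup>2) \<le> e\<^sup>2"
      by (auto simp: eventually_sequentially)
  qed simp
  have s: "(\<lambda>i. (cmod (f i))\<^sup>2) summable_on UNIV"
  proof -
    obtain N where N: "\<forall>m\<ge>N. \<forall>n\<ge>N. dist (X m) (X n) < 1"
      using metric_CauchyD[OF C, of 1] by auto
    have "(\<lambda>i. (cmod (f i - coord (X N) i))\<^sup>2) summable_on UNIV"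
      by (rule ell2_boundI[where C = 1]) (use tail[OF _ N] in auto)
    from square_summable_add[OF this coord_summable[of "X N"]] show ?thesis by simp
  qed
  have "X \<longlonglongrightarrow> Abs_ell2 f"
  proof (rule metric_LIMSEQ_I)
    fix r :: real assume "r > 0"
    obtain N where N: "\<forall>m\<ge>N. \<forall>n\<ge>N. dist (X m) (X n) < r / 2"
      using metric_CauchyD[OF C, of "r / 2"] \<open>r > 0\<close> by auto
    have "dist (X n) (Abs_ell2 f) < r" if "n \<ge> N" for n
    proof -
      have d: "(\<lambda>i. (cmod (f i - coord (X n) i))\<^sup>2) summable_on UNIV"
        "norm (Abs_ell2 (\<lambda>i. f i - coord (X n) i)) \<le> r / 2"
        using ell2_boundI[OF tail[OF _ N \<open>n \<ge> N\<close>]] \<open>r > 0\<close> by auto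
      have "Abs_ell2 f - X n = Abs_ell2 (\<lambda>i. f i - coord (X n) i)"
        by (rule ell2_eqI) (simp add: coord_Abs_ell2[OF s] coord_Abs_ell2[OF d(1)])
      then show ?thesis using d(2) \<open>r > 0\<close> by (simp add: dist_norm norm_minus_commute)
    qed
    then show "\<exists>N. \<forall>n\<ge>N. dist (X n) (Abs_ell2 f) < r" by blast
  qed
  then show "convergent X" by (auto simp: convergent_def)
qed

instance ell2 :: (type) banach ..

text \<open>Multiplication by complex scalars.\<close>

lift_definition scaleC :: "complex \<Rightarrow> 'i ell2 \<Rightarrow> 'i ell2" is "\<lambda>c f i. c * f i"
  by (simp add: norm_mult power_mult_distrib summable_on_cmult_right)

declare scaleC.rep_eq [simp]

lemma norm_scaleC [simp]: "norm (scaleC c v) = cmod c * norm v"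
proof -
  have "(norm (scaleC c v))\<^sup>2 = (cmod c * norm v)\<^sup>2"
    by (simp add: norm_ell2_square power_mult_distrib norm_mult
        infsum_cmult_right coord_summable)
  then show ?thesis by (simp add: power2_eq_imp_eq)
qed

lemma bounded_linear_scaleC: "bounded_linear (scaleC c)"
  by (rule bounded_linear_intro[where K = "cmod c"])
    (auto intro!: ell2_eqI simp: algebra_simps)

text \<open>The translation operator on two-sided sequences.\<close>

lift_definition shift :: "int \<Rightarrow> int ell2 \<Rightarrow> int ell2" is "\<lambda>j f n. f (n - j)"
proof -
  fix j :: int and f :: "int \<Rightarrow> complex" assume "(\<lambda>i. (cmod (f i))\<^sup>2) summable_on UNIV"
  moreover have "bij_betw (\<lambda>n. n - j) UNIV UNIV"
    by (rule bij_betw_byWitness[where f' = "\<lambda>n. n + j"]) auto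
  ultimately show "(\<lambda>n. (cmod (f (n - j)))\<^sup>2) summable_on UNIV"
    using summable_on_reindex_bij_betw[of "\<lambda>n. n - j" UNIV UNIV "\<lambda>i. (cmod (f i))\<^sup>2"] by simp
qed

declare shift.rep_eq [simp]

lemma inner_shift: "inner (shift j u) v = inner u (shift (- j) v)"
proof -
  have "bij_betw (\<lambda>n. n + j) UNIV UNIV"
    by (rule bij_betw_byWitness[where f' = "\<lambda>n. n - j"]) auto
  from infsum_reindex_bij_betw[OF this, of "\<lambda>n. inner (coord u (n - j)) (coord v n)"]
  show ?thesis by (simp add: inner_ell2_def)
qed

lemma shift_shift [simp]: "shift i (shift j v) = shift (i + j) v"
  by (rule ell2_eqI) (simp add: algebra_simps)

lemma shift_0 [simp]: "shift 0 v = v"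
  by (rule ell2_eqI) simp

lemma norm_shift [simp]: "norm (shift j v) = norm v"
  using inner_shift[of j v "shift j v"] by (simp add: norm_eq_sqrt_inner)

lemma bounded_linear_shift: "bounded_linear (shift j)"
  by (rule bounded_linear_intro[where K = 1]) (auto intro!: ell2_eqI)

text \<open>The diagonal operator with bounded real entries \<open>a\<close>; for an unbounded \<open>a\<close> its value is
  irrelevant.\<close>

definition diag :: "('i \<Rightarrow> real) \<Rightarrow> 'i ell2 \<Rightarrow> 'i ell2" where
  "diag a v = Abs_ell2 (\<lambda>i. of_real (a i) * coord v i)"

lemma coord_diag:
  assumes "\<And>i. \<bar>a i\<bar> \<le> C"
  shows "coord (diag a v) i = of_real (a i) * coord v i"
  unfolding diag_def
  by (subst coord_Abs_ell2)
    (rule square_summable_bounded_mult[OF coord_summable, where C = C], use assms in auto)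

lemma norm_diag_le:
  assumes "\<And>i. \<bar>a i\<bar> \<le> C"
  shows "norm (diag a v) \<le> C * norm v"
proof -
  have C: "0 \<le> C" using assms[of undefined] by linarith
  show ?thesis unfolding diag_def
  proof (rule ell2_boundI(2))
    fix F :: "'a set" assume F: "finite F"
    have "(\<Sum>i\<in>F. (cmod (of_real (a i) * coord v i))\<^sup>2) \<le> (\<Sum>i\<in>F. C\<^sup>2 * (cmod (coord v i))\<^sup>2)"
      using assms power_mono[OF assms abs_ge_zero, of _ 2]
      by (intro sum_mono) (simp add: norm_mult power_mult_distrib mult_right_mono)
    also have "\<dots> \<le> C\<^sup>2 * (norm v)\<^sup>2"
      using sum_coord_le_norm[OF F, of v] by (simp add: sum_distrib_left[symmetric] mult_left_mono)
    finally show "(\<Sum>i\<in>F. (cmod (of_real (a i) * coord v i))\<^sup>2) \<le> (C * norm v)\<^sup>2"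
      by (simp add: power_mult_distrib)
  qed (use C in simp)
qed

lemma bounded_linear_diag:
  assumes "\<And>i. \<bar>a i\<bar> \<le> C"
  shows "bounded_linear (diag a)"
  by (rule bounded_linear_intro[where K = C])
    (use norm_diag_le[OF assms] in \<open>auto intro!: ell2_eqI simp: coord_diag[OF assms] algebra_simps\<close>)

text \<open>The family with entry \<open>c\<close> at \<open>i\<close> and zeros elsewhere.\<close>

lift_definition unit :: "'i \<Rightarrow> complex \<Rightarrow> 'i ell2" is "\<lambda>i c j. if j = i then c else 0"
proof -
  fix i :: 'i and c
  show "(\<lambda>j. (cmod (if j = i then c else 0))\<^sup>2) summable_on UNIV"
    by (rule finite_nonzero_values_imp_summable_on) (auto intro: finite_subset[of _ "{i}"])
qed

declare unit.rep_eq [simp]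

lemma inner_unit: "inner (unit i c) v = inner c (coord v i)"
proof -
  have "inner (unit i c) v = (\<Sum>\<^sub>\<infinity>j\<in>{i}. inner (coord (unit i c) j) (coord v j))"
    unfolding inner_ell2_def by (rule infsum_cong_neutral) auto
  then show ?thesis by simp
qed

lemma coord_tail_small:
  assumes "e > 0"
  shows "\<exists>F. finite F \<and> (\<forall>G. finite G \<and> G \<inter> F = {} \<longrightarrow> (\<Sum>i\<in>G. (cmod (coord v i))\<^sup>2) < e)"
proof -
  define h where "h i = (cmod (coord v i))\<^sup>2" for i
  have "(h has_sum (norm v)\<^sup>2) UNIV"
    unfolding norm_ell2_square h_def by (rule has_sum_infsum[OF coord_summable])
  then have "eventually (\<lambda>F. dist (sum h F) ((norm v)\<^sup>2) < e) (finite_subsets_at_top UNIV)"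
    using assms by (auto simp: has_sum_def tendsto_iff)
  then obtain F where F: "finite F"
    "\<And>G. finite G \<Longrightarrow> F \<subseteq> G \<Longrightarrow> dist (sum h G) ((norm v)\<^sup>2) < e"
    unfolding eventually_finite_subsets_at_top by auto
  have "sum h G < e" if "finite G" "G \<inter> F = {}" for G
  proof -
    have "sum h F + sum h G = sum h (F \<union> G)"
      using that F(1) by (subst sum.union_disjoint) auto
    moreover have "sum h (F \<union> G) \<le> (norm v)\<^sup>2"
      unfolding h_def by (rule sum_coord_le_norm) (use that F in auto)
    moreover have "dist (sum h F) ((norm v)\<^sup>2) < e" using F by auto
    ultimately show ?thesis by (simp add: dist_real_def)
  qed
  then show ?thesis using F(1) unfolding h_def by blast
qed

section \<open>Closed subspaces, coercive operators and finite rank perturbations\<close>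

lemma closed_subspace_plus_line:
  fixes x :: "'a :: real_normed_vector"
  assumes "subspace Y" "closed Y"
  shows "closed {z. \<exists>c. z - c *\<^sub>R x \<in> Y}"
proof (cases "x \<in> Y")
  case True
  have "z - c *\<^sub>R x \<in> Y \<longleftrightarrow> z \<in> Y" for z c
    using subspace_diff[OF assms(1), of z "c *\<^sub>R x"] subspace_add[OF assms(1), of "z - c *\<^sub>R x" "c *\<^sub>R x"]
      subspace_scale[OF assms(1) True, of c] by auto
  then show ?thesis using assms(2) by simp
next
  case False
  define d where "d = infdist x Y"
  have "Y \<noteq> {}" using subspace_0[OF assms(1)] by auto
  have d: "d > 0"
    using False assms(2) \<open>Y \<noteq> {}\<close> unfolding d_def
    by (metis in_closed_iff_infdist_zero infdist_nonneg less_eq_real_def)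
  have lower: "\<bar>c\<bar> * d \<le> norm (y + c *\<^sub>R x)" if "y \<in> Y" for y c
  proof (cases "c = 0")
    case False
    have "- (1 / c) *\<^sub>R y \<in> Y" using that assms(1) by (simp add: subspace_scale subspace_neg)
    then have "d \<le> dist x (- (1 / c) *\<^sub>R y)" unfolding d_def by (rule infdist_le)
    also have "\<dots> = norm ((1 / c) *\<^sub>R (y + c *\<^sub>R x))"
      using False by (simp add: dist_norm scaleR_add_right add.commute)
    also have "\<dots> = norm (y + c *\<^sub>R x) / \<bar>c\<bar>"
      by (simp only: norm_scaleR) simp
    finally show ?thesis using False by (simp add: pos_le_divide_eq mult.commute)
  qed simp
  show ?thesis
    unfolding closed_sequential_limits
  proof (intro allI impI, elim conjE)
    fix z l
    assume "\<forall>n. z n \<in> {z. \<exists>c. z - c *\<^sub>R x \<in> Y}" and l: "z \<longlonglongrightarrow> l"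
    then obtain c where c: "z n - c n *\<^sub>R x \<in> Y" for n by (simp, metis)
    have diff: "\<bar>c m - c n\<bar> * d \<le> norm (z m - z n)" for m n
      using lower[OF subspace_diff[OF assms(1) c[of m] c[of n]], of "c m - c n"]
      by (simp add: algebra_simps)
    have "Cauchy c"
    proof (rule metric_CauchyI)
      fix e :: real assume "e > 0"
      then obtain M where M: "\<forall>m\<ge>M. \<forall>n\<ge>M. dist (z m) (z n) < e * d"
        using metric_CauchyD[OF LIMSEQ_imp_Cauchy[OF l], of "e * d"] d by auto
      have "dist (c m) (c n) < e" if "m \<ge> M" "n \<ge> M" for m n
      proof -
        have "\<bar>c m - c n\<bar> * d < e * d"
          using diff[of m n] M that by (simp add: dist_norm) (meson le_less_trans)
        then show ?thesis using d by (simp add: dist_real_def)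
      qed
      then show "\<exists>M. \<forall>m\<ge>M. \<forall>n\<ge>M. dist (c m) (c n) < e" by blast
    qed
    then obtain c0 where c0: "c \<longlonglongrightarrow> c0" using Cauchy_convergent convergent_def by blast
    have "(\<lambda>n. z n - c n *\<^sub>R x) \<longlonglongrightarrow> l - c0 *\<^sub>R x" by (intro tendsto_intros l c0)
    then have "l - c0 *\<^sub>R x \<in> Y" using closed_sequentially[OF assms(2), of "\<lambda>n. z n - c n *\<^sub>R x"] c by simp
    then show "l \<in> {z. \<exists>c. z - c *\<^sub>R x \<in> Y}" by blast
  qed
qed

lemma closed_span_finite:
  fixes S :: "'a :: real_normed_vector set"
  assumes "finite S"
  shows "closed (span S)"
  using assms
proof (induction S)
  case (insert x S)
  have "span (insert x S) = {z. \<exists>c. z - c *\<^sub>R x \<in> span S}"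
    by (auto simp: span_breakdown_eq)
  then show ?case using closed_subspace_plus_line[OF subspace_span insert.IH] by simp
qed simp

text \<open>A coercive bounded operator is bijective: for small \<open>t\<close> the map
  \<open>x \<mapsto> x - t (B x - y)\<close> is a contraction.\<close>

lemma coercive_imp_bij:
  fixes B :: "'a :: {real_inner, complete_space} \<Rightarrow> 'a"
  assumes B: "bounded_linear B" and c: "c > 0"
    and co: "\<And>x. c * (norm x)\<^sup>2 \<le> inner (B x) x"
  shows "bij B" and "c * norm x \<le> norm (B x)"
proof -
  interpret B: bounded_linear B by fact
  show lower: "c * norm x \<le> norm (B x)" for x
  proof (cases "x = 0")
    case False
    have "c * norm x * norm x \<le> norm (B x) * norm x"
      using co[of x] norm_cauchy_schwarz[of "B x" x] by (simp add: power2_eq_square)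
    then show ?thesis using False by simp
  qed (simp add: B.zero)
  have "inj B"
  proof (rule injI)
    fix x y assume "B x = B y"
    then have "c * norm (x - y) \<le> 0" using lower[of "x - y"] by (simp add: B.diff)
    then show "x = y" using c by (simp add: mult_le_0_iff)
  qed
  moreover have "\<exists>x. B x = y" for y
  proof -
    obtain K where K: "K > 0" "\<And>x. norm (B x) \<le> norm x * K"
      using B.pos_bounded by blast
    define t where "t = c / K\<^sup>2"
    define q where "q = sqrt (1 - c\<^sup>2 / K\<^sup>2)"
    have contr: "norm (x - t *\<^sub>R B x) \<le> q * norm x" for x
    proof -
      have "(norm (x - t *\<^sub>R B x))\<^sup>2 = (norm x)\<^sup>2 - 2 * t * inner (B x) x + t\<^sup>2 * (norm (B x))\<^sup>2"
        unfolding power2_norm_eq_inner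
        by (simp add: inner_diff_left inner_diff_right inner_commute power2_eq_square)
      also have "\<dots> \<le> (norm x)\<^sup>2 - 2 * t * (c * (norm x)\<^sup>2) + t\<^sup>2 * (norm x * K)\<^sup>2"
        using co[of x] K c by (intro add_mono diff_mono mult_left_mono power_mono) (auto simp: t_def)
      also have "\<dots> = (1 - c\<^sup>2 / K\<^sup>2) * (norm x)\<^sup>2"
        using K(1) by (simp add: t_def field_simps power2_eq_square)
      finally have *: "(norm (x - t *\<^sub>R B x))\<^sup>2 \<le> (1 - c\<^sup>2 / K\<^sup>2) * (norm x)\<^sup>2" .
      then have "norm (x - t *\<^sub>R B x) \<le> sqrt ((1 - c\<^sup>2 / K\<^sup>2) * (norm x)\<^sup>2)"
        by (rule real_le_rsqrt)
      then show ?thesis by (simp add: real_sqrt_mult q_def)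
    qed
    show ?thesis
    proof (cases "\<exists>x :: 'a. x \<noteq> 0")
      case True
      then obtain x0 :: 'a where x0: "x0 \<noteq> 0" by blast
      have "c \<le> K"
        using lower[of x0] K(2)[of x0] x0 by (metis mult.commute mult_right_le_imp_le order_trans zero_less_norm_iff)
      then have q: "0 \<le> q" "q < 1" using c K(1) by (auto simp: q_def power_mono)
      have "\<exists>!x. x - t *\<^sub>R (B x - y) = x"
      proof (rule banach_fix_type[OF q])
        show "\<forall>x z. dist (x - t *\<^sub>R (B x - y)) (z - t *\<^sub>R (B z - y)) \<le> q * dist x z"
        proof (intro allI)
          fix x z
          have "x - t *\<^sub>R (B x - y) - (z - t *\<^sub>R (B z - y)) = (x - z) - t *\<^sub>R B (x - z)"
            by (simp add: B.diff algebra_simps)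
          then show "dist (x - t *\<^sub>R (B x - y)) (z - t *\<^sub>R (B z - y)) \<le> q * dist x z"
            using contr[of "x - z"] by (simp only: dist_norm)
        qed
      qed
      then obtain x where "x - t *\<^sub>R (B x - y) = x" by blast
      then have "B x = y" using c K(1) by (simp add: t_def)
      then show ?thesis ..
    next
      case False
      then show ?thesis by metis
    qed
  qed
  then have "surj B" by (metis surjI surj_def)
  ultimately show "bij B" by (simp add: bij_def)
qed

text \<open>The witness is the vector from the nearest point of the subspace to a point outside it.\<close>

lemma exists_orthogonal_to_closed_subspace:
  fixes Y :: "'a :: {real_inner, complete_space} set"
  assumes Y: "subspace Y" "closed Y" "Y \<noteq> UNIV"
  shows "\<exists>g. g \<noteq> 0 \<and> (\<forall>y\<in>Y. inner y g = 0)"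
proof -
  obtain f where f: "f \<notin> Y" using Y(3) by blast
  have ne: "Y \<noteq> {}" using subspace_0[OF Y(1)] by auto
  define d where "d = infdist f Y"
  have d: "d > 0"
    using f Y(2) ne unfolding d_def
    by (metis in_closed_iff_infdist_zero infdist_nonneg less_eq_real_def)
  have dle: "d \<le> norm (f - y)" if "y \<in> Y" for y
    using infdist_le[OF that, of f] by (simp add: d_def dist_norm)
  have "\<exists>y\<in>Y. (norm (f - y))\<^sup>2 < d\<^sup>2 + inverse (of_nat (Suc n))" for n
  proof -
    have "d < sqrt (d\<^sup>2 + inverse (of_nat (Suc n)))" by (rule real_less_rsqrt) simp
    then obtain y where "y \<in> Y" "dist f y < sqrt (d\<^sup>2 + inverse (of_nat (Suc n)))"
      unfolding d_def infdist_notempty[OF ne]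
      by (metis (no_types, lifting) ne cINF_less_iff bdd_below_image_dist)
    then have "norm (f - y) < sqrt (d\<^sup>2 + inverse (of_nat (Suc n)))" by (simp add: dist_norm)
    then have "(norm (f - y))\<^sup>2 < (sqrt (d\<^sup>2 + inverse (of_nat (Suc n))))\<^sup>2"
      by (intro power_strict_mono) auto
    with \<open>y \<in> Y\<close> show ?thesis by (intro bexI[of _ y]) (auto simp: add_nonneg_nonneg)
  qed
  then obtain y where y: "y n \<in> Y" "(norm (f - y n))\<^sup>2 < d\<^sup>2 + inverse (of_nat (Suc n))" for n
    by metis
  \<comment> \<open>The parallelogram law makes the minimizing sequence a Cauchy sequence.\<close>
  have close: "(norm (y m - y n))\<^sup>2 \<le> 2 * inverse (of_nat (Suc m)) + 2 * inverse (of_nat (Suc n))" for m n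
  proof -
    have "(1 / 2) *\<^sub>R (y m + y n) \<in> Y" using y(1) Y(1) by (simp add: subspace_add subspace_scale)
    from dle[OF this] have "d\<^sup>2 \<le> (norm (f - (1 / 2) *\<^sub>R (y m + y n)))\<^sup>2"
      using d by (intro power_mono) auto
    moreover have "4 * (norm (f - (1 / 2) *\<^sub>R (y m + y n)))\<^sup>2 + (norm (y m - y n))\<^sup>2
        = 2 * (norm (f - y m))\<^sup>2 + 2 * (norm (f - y n))\<^sup>2"
      unfolding power2_norm_eq_inner
      by (simp add: inner_diff_left inner_diff_right inner_add_left inner_add_right
          inner_commute algebra_simps)
    ultimately show ?thesis using y(2)[of m] y(2)[of n] by linarith
  qed
  have "Cauchy y"
  proof (rule metric_CauchyI)
    fix e :: real assume "e > 0"
    then obtain N where N: "inverse (of_nat (Suc N)) < e\<^sup>2 / 4"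
      using reals_Archimedean[of "e\<^sup>2 / 4"] by auto
    have "dist (y m) (y n) < e" if "m \<ge> N" "n \<ge> N" for m n
    proof -
      have "inverse (of_nat (Suc m)) \<le> (inverse (of_nat (Suc N)) :: real)"
        "inverse (of_nat (Suc n)) \<le> (inverse (of_nat (Suc N)) :: real)"
        using that by (auto intro: le_imp_inverse_le)
      then have "(norm (y m - y n))\<^sup>2 < e\<^sup>2" using close[of m n] N by linarith
      then show ?thesis using \<open>e > 0\<close> by (simp add: dist_norm power_less_imp_less_base)
    qed
    then show "\<exists>N. \<forall>m\<ge>N. \<forall>n\<ge>N. dist (y m) (y n) < e" by blast
  qed
  then obtain y0 where y0: "y \<longlonglongrightarrow> y0" using Cauchy_convergent convergent_def by blast
  have y0Y: "y0 \<in> Y" using closed_sequentially[OF Y(2), of y y0] y0 y(1) by simp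
  define g where "g = f - y0"
  have "(\<lambda>n. (norm (f - y n))\<^sup>2) \<longlonglongrightarrow> (norm g)\<^sup>2" unfolding g_def by (intro tendsto_intros y0)
  moreover have "(\<lambda>n. d\<^sup>2 + inverse (of_nat (Suc n))) \<longlonglongrightarrow> d\<^sup>2 + 0"
    by (intro tendsto_intros LIMSEQ_inverse_real_of_nat)
  ultimately have "(norm g)\<^sup>2 \<le> d\<^sup>2 + 0"
    by (rule LIMSEQ_le) (use y(2) in \<open>auto intro: less_imp_le\<close>)
  have "inner u g = 0" if "u \<in> Y" for u
  proof (cases "u = 0")
    case False
    define t where "t = inner u g / (norm u)\<^sup>2"
    have "y0 + t *\<^sub>R u \<in> Y" using y0Y that Y(1) by (simp add: subspace_add subspace_scale)
    from dle[OF this] have "d \<le> norm (g - t *\<^sub>R u)" by (simp add: g_def algebra_simps)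
    then have "d\<^sup>2 \<le> (norm (g - t *\<^sub>R u))\<^sup>2" using d by (intro power_mono) auto
    also have "\<dots> = (norm g)\<^sup>2 - 2 * t * inner u g + t\<^sup>2 * (norm u)\<^sup>2"
      unfolding power2_norm_eq_inner
      by (simp add: inner_diff_left inner_diff_right inner_commute power2_eq_square)
    also have "\<dots> = (norm g)\<^sup>2 - (inner u g)\<^sup>2 / (norm u)\<^sup>2"
      using False by (simp add: t_def field_simps power2_eq_square)
    finally have "(inner u g)\<^sup>2 / (norm u)\<^sup>2 \<le> 0" using \<open>(norm g)\<^sup>2 \<le> d\<^sup>2 + 0\<close> by linarith
    then show ?thesis using False by (simp add: divide_le_0_iff)
  qed simp
  moreover have "g \<noteq> 0" using f y0Y by (auto simp: g_def)
  ultimately show ?thesis by blast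
qed

lemma span_eq_of_card_le:
  fixes S T :: "'a :: real_vector set"
  assumes "independent S" "finite T" "S \<subseteq> span T" "card T \<le> card S" "finite S"
  shows "span T \<subseteq> span S"
proof (rule ccontr)
  assume "\<not> span T \<subseteq> span S"
  then obtain y where y: "y \<in> span T" "y \<notin> span S" by blast
  then have "y \<notin> S" using span_superset by blast
  have "independent (insert y S)" using y assms(1) by (simp add: independent_insert)
  moreover have "insert y S \<subseteq> span T" using y assms(3) by simp
  ultimately have "card (insert y S) \<le> card T"
    using real_vector.independent_span_bound[OF assms(2)] by blast
  then show False using \<open>y \<notin> S\<close> assms(4,5) by simp
qed

lemma injective_on_finite_span_imp_onto:
  fixes f :: "'a :: real_vector \<Rightarrow> 'a"
  assumes f: "linear f" "inj f" and C: "finite C" and sub: "f ` span C \<subseteq> span C"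
  shows "span C \<subseteq> f ` span C"
proof -
  obtain B where B: "B \<subseteq> C" "independent B" "C \<subseteq> span B"
    using maximal_independent_subset[of C] by blast
  have fin: "finite B" using B(1) C finite_subset by blast
  have span: "span B = span C"
    using B(1,3) by (metis span_mono span_span subset_antisym)
  have ind: "independent (f ` B)"
    using B(2) f by (meson linear_independent_injective_image inj_on_subset subset_UNIV)
  have "f ` B \<subseteq> span B"
    using sub span span_superset[of B] by (metis image_mono subset_trans)
  then have "span B \<subseteq> span (f ` B)"
    using ind fin inj_on_subset[OF f(2)]
    by (intro span_eq_of_card_le) (auto simp: card_image)
  then show ?thesis using span linear_span_image[OF f(1), of B] by simp
qed

text \<open>A finite rank perturbation \<open>T = T1 + F\<close> of an operator \<open>T1\<close> with bounded inverse \<open>G\<close> is Fredholm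
  of index zero.  As \<open>T = T1 (1 + K)\<close> with \<open>K = G F\<close>, everything reduces to \<open>1 + K\<close>, which maps the
  finite-dimensional space \<open>V\<close> to itself, where \<open>V\<close> contains the range of \<open>K\<close>.\<close>

locale finite_rank_perturbation =
  fixes T1 G :: "'a :: real_normed_vector \<Rightarrow> 'a"
    and \<phi> :: "'i \<Rightarrow> 'a \<Rightarrow> real" and f :: "'i \<Rightarrow> 'a" and I :: "'i set"
  assumes T1: "bounded_linear T1" and G: "bounded_linear G"
    and GT1: "\<And>x. G (T1 x) = x" and T1G: "\<And>x. T1 (G x) = x"
    and \<phi>: "\<And>i. bounded_linear (\<phi> i)" and I: "finite I"
begin

sublocale T1: bounded_linear T1 by (rule T1)
sublocale G: bounded_linear G by (rule G)

definition F :: "'a \<Rightarrow> 'a" where "F x = (\<Sum>i\<in>I. \<phi> i x *\<^sub>R f i)"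

definition T :: "'a \<Rightarrow> 'a" where "T x = T1 x + F x"

definition V :: "'a set" where "V = span ((\<lambda>i. G (f i)) ` I)"

definition K :: "'a \<Rightarrow> 'a" where "K x = G (F x)"

lemma F_bounded_linear: "bounded_linear F"
  unfolding F_def by (intro bounded_linear_sum bounded_linear_scaleR_const \<phi>)

sublocale F: bounded_linear F by (rule F_bounded_linear)

lemma K_bounded_linear: "bounded_linear K"
  unfolding K_def by (rule bounded_linear_compose[OF G F_bounded_linear])

sublocale K: bounded_linear K by (rule K_bounded_linear)

lemma F_in_span: "F x \<in> span (f ` I)"
  unfolding F_def by (intro span_sum span_scale span_base) auto

lemma K_in_V: "K x \<in> V"
  unfolding K_def F_def V_def G.sum G.scaleR by (intro span_sum span_scale span_base) auto

lemma V_subspace: "subspace V" unfolding V_def by simp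

lemma T_eq: "T x = T1 (x + K x)" by (simp add: T_def K_def T1.add T1G)

lemma linear_1K: "linear (\<lambda>x. x + K x)"
  by (intro linear_compose_add linear_id[unfolded id_def] K.linear_axioms)

lemma range_T: "range T = G -` range (\<lambda>x. x + K x)"
proof
  show "range T \<subseteq> G -` range (\<lambda>x. x + K x)" by (auto simp: T_eq GT1)
  show "G -` range (\<lambda>x. x + K x) \<subseteq> range T"
  proof
    fix y assume "y \<in> G -` range (\<lambda>x. x + K x)"
    then obtain x where "G y = x + K x" by auto
    then have "y = T x" by (metis T1G T_eq)
    then show "y \<in> range T" by simp
  qed
qed

text \<open>As \<open>y = (1 + K) y - K y\<close>, membership of \<open>y\<close> in the range depends only on \<open>K y\<close>.\<close>

lemma range_1K: "range (\<lambda>x. x + K x) = K -` ((\<lambda>x. x + K x) ` V)"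
proof (intro equalityI subsetI)
  fix y assume "y \<in> range (\<lambda>x. x + K x)"
  then obtain x where x: "y = x + K x" by auto
  have "K y = K x + K (K x)" by (simp add: x K.add)
  then show "y \<in> K -` ((\<lambda>x. x + K x) ` V)" using K_in_V[of x] by auto
next
  fix y assume "y \<in> K -` ((\<lambda>x. x + K x) ` V)"
  then obtain x where "K y = x + K x" by auto
  then have "y = (y - x) + K (y - x)" by (simp add: K.diff)
  then show "y \<in> range (\<lambda>x. x + K x)" by (rule range_eqI)
qed

lemma closed_range: "closed (range T)"
proof -
  have "closed ((\<lambda>x. x + K x) ` V)"
    unfolding V_def linear_span_image[OF linear_1K, symmetric]
    by (rule closed_span_finite) (simp add: I)
  then have "closed (range (\<lambda>x. x + K x))"
    unfolding range_1K by (intro continuous_closed_vimage K.isCont) auto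
  then show ?thesis unfolding range_T by (intro continuous_closed_vimage G.isCont) auto
qed

lemma kernel_subset: "T x = 0 \<Longrightarrow> x \<in> V"
proof -
  assume "T x = 0"
  then have "x + K x = G 0" by (metis GT1 T_eq)
  then have "x = - K x" by (simp add: G.zero eq_neg_iff_add_eq_0)
  then show "x \<in> V" using K_in_V[of x] V_subspace by (metis subspace_neg)
qed

lemma cokernel: "\<exists>v. u - T v \<in> span (f ` I)"
proof
  show "u - T (G u) \<in> span (f ` I)"
    using F_in_span[of "G u"] by (simp add: T_def T1G span_neg)
qed

lemma injective_imp_bij:
  assumes inj: "inj T"
  shows "bij T" and "\<exists>C. \<forall>x. norm x \<le> C * norm (T x)"
proof -
  have "inj (\<lambda>x. x + K x)"
    by (rule injI, rule injD[OF inj]) (simp only: T_eq)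
  then have V: "V \<subseteq> (\<lambda>x. x + K x) ` V"
    unfolding V_def
    by (rule injective_on_finite_span_imp_onto[OF linear_1K])
      (use I K_in_V V_subspace in \<open>auto simp: V_def intro: span_add\<close>)
  have "range (\<lambda>x. x + K x) = UNIV" unfolding range_1K using subsetD[OF V K_in_V] by (intro equalityI subsetI vimageI2 UNIV_I)
  then have "range T = UNIV" by (simp add: range_T)
  then show "bij T" using inj by (simp add: bij_def)
  have "\<exists>h. h + K h = G (f i)" if "i \<in> I" for i
  proof -
    have "G (f i) \<in> V" unfolding V_def using that by (intro span_base) auto
    then show ?thesis using V by (metis (no_types, lifting) imageE subsetD)
  qed
  then obtain h where h: "\<And>i. i \<in> I \<Longrightarrow> h i + K (h i) = G (f i)" by metis
  \<comment> \<open>The inverse is \<open>G\<close> minus a finite rank operator whose range is spanned by the \<open>h i\<close>.\<close>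
  have formula: "x = G (T x) - (\<Sum>i\<in>I. \<phi> i (G (T x)) *\<^sub>R h i)" for x
  proof -
    define w where "w = (\<Sum>i\<in>I. \<phi> i (G (T x)) *\<^sub>R h i)"
    have "w + K w = (\<Sum>i\<in>I. \<phi> i (G (T x)) *\<^sub>R (h i + K (h i)))"
      by (simp add: w_def K.sum K.scaleR sum.distrib scaleR_add_right)
    also have "\<dots> = (\<Sum>i\<in>I. \<phi> i (G (T x)) *\<^sub>R G (f i))"
      by (intro sum.cong refl) (simp only: h)
    also have "\<dots> = K (G (T x))" by (simp add: K_def F_def G.sum G.scaleR)
    finally have w: "w + K w = K (G (T x))" .
    have "(G (T x) - w) + K (G (T x) - w) = G (T x) + K (G (T x)) - (w + K w)"
      by (simp add: K.diff)
    also have "\<dots> = x + K x" unfolding w by (simp add: T_eq GT1)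
    finally have "(G (T x) - w) + K (G (T x) - w) = x + K x" .
    then have "T (G (T x) - w) = T x" by (simp add: T_eq)
    then show ?thesis using inj by (simp add: inj_eq w_def)
  qed
  have "bounded_linear (\<lambda>y. G y - (\<Sum>i\<in>I. \<phi> i (G y) *\<^sub>R h i))"
    by (intro bounded_linear_sub bounded_linear_sum bounded_linear_scaleR_const G
        bounded_linear_compose[OF \<phi> G])
  then obtain C where "\<And>y. norm (G y - (\<Sum>i\<in>I. \<phi> i (G y) *\<^sub>R h i)) \<le> norm y * C"
    using bounded_linear.bounded by blast
  then have "norm x \<le> C * norm (T x)" for x
    by (metis formula mult.commute)
  then show "\<exists>C. \<forall>x. norm x \<le> C * norm (T x)" by blast
qed

end

section \<open>A shift operator with asymptotically constant coefficients\<close>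

lemma imag_segment_iff: "z \<in> imag_segment r \<longleftrightarrow> Re z = 0 \<and> \<bar>Im z\<bar> \<le> r"
  unfolding imag_segment_def
  by (auto simp: complex_eq_iff)

lemma bounded_linear_inv:
  fixes T :: "'a :: real_normed_vector \<Rightarrow> 'b :: real_normed_vector"
  assumes T: "bounded_linear T" "bij T" and c: "c > 0" "\<And>x. c * norm x \<le> norm (T x)"
  shows "bounded_linear (inv T)"
proof -
  interpret T: bounded_linear T by fact
  have TT: "T (inv T y) = y" for y using T(2) by (simp add: bij_is_surj surj_f_inv_f)
  have inj: "T x = T y \<Longrightarrow> x = y" for x y using T(2) by (simp add: bij_def inj_eq)
  show ?thesis
  proof (rule bounded_linear_intro[where K = "1 / c"])
    show "inv T (x + y) = inv T x + inv T y" for x y by (rule inj) (simp add: TT T.add)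
    show "inv T (r *\<^sub>R x) = r *\<^sub>R inv T x" for r x by (rule inj) (simp add: TT T.scaleR)
    show "norm (inv T x) \<le> norm x * (1 / c)" for x
      using c(2)[of "inv T x"] c(1) by (simp add: TT field_simps)
  qed
qed

lemma norm_finite_support:
  assumes "finite G" "\<And>n. n \<notin> G \<Longrightarrow> coord v n = 0"
  shows "(norm v)\<^sup>2 = (\<Sum>n\<in>G. (cmod (coord v n))\<^sup>2)"
proof -
  have "(norm v)\<^sup>2 = (\<Sum>\<^sub>\<infinity>n\<in>G. (cmod (coord v n))\<^sup>2)"
    unfolding norm_ell2_square by (rule infsum_cong_neutral) (use assms in auto)
  then show ?thesis using assms(1) by simp
qed

lemma inner_scaleC_self: "inner (scaleC z v) v = Re z * (norm v)\<^sup>2"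
proof -
  have "inner (z * x) x = Re z * (cmod x)\<^sup>2" for x :: complex
    unfolding inner_complex_def cmod_power2 by (simp add: power2_eq_square algebra_simps)
  then show ?thesis
    by (simp add: inner_ell2_def norm_ell2_square infsum_cmult_right coord_summable)
qed

text \<open>\<open>hop \<alpha> \<beta>\<close> is \<open>S \<alpha> - S\<^sup>-\<^sup>1 \<beta>\<close>, where \<open>S\<close> is the shift to the right.\<close>

definition hop :: "(int \<Rightarrow> real) \<Rightarrow> (int \<Rightarrow> real) \<Rightarrow> int ell2 \<Rightarrow> int ell2" where
  "hop \<alpha> \<beta> v = shift 1 (diag \<alpha> v) - shift (- 1) (diag \<beta> v)"

text \<open>Boundedness of a coefficient sequence.\<close>

definition bdd :: "(int \<Rightarrow> real) \<Rightarrow> bool" where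
  "bdd a \<longleftrightarrow> (\<exists>C. \<forall>n. \<bar>a n\<bar> \<le> C)"

lemma bddI: "(\<And>n. \<bar>a n\<bar> \<le> C) \<Longrightarrow> bdd a" by (auto simp: bdd_def)

lemma bdd_of_close: "(\<And>n. \<bar>a n - 1\<bar> \<le> e) \<Longrightarrow> bdd a"
proof (rule bddI[of _ "1 + e"])
  show "\<bar>a n\<bar> \<le> 1 + e" if "\<And>n. \<bar>a n - 1\<bar> \<le> e" for n using that[of n] by linarith
qed

lemma bdd_diff: "bdd a \<Longrightarrow> bdd c \<Longrightarrow> bdd (\<lambda>n. a n - c n)"
  unfolding bdd_def by (meson abs_triangle_ineq4 add_mono order_trans)

lemma coord_hop:
  assumes "bdd \<alpha>" "bdd \<beta>"
  shows "coord (hop \<alpha> \<beta> v) n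
    = of_real (\<alpha> (n - 1)) * coord v (n - 1) - of_real (\<beta> (n + 1)) * coord v (n + 1)"
proof -
  obtain C D where "\<And>i. \<bar>\<alpha> i\<bar> \<le> C" "\<And>i. \<bar>\<beta> i\<bar> \<le> D" using assms by (auto simp: bdd_def)
  then show ?thesis by (simp add: hop_def coord_diag[of \<alpha> C] coord_diag[of \<beta> D])
qed

lemma bounded_linear_hop: "bdd \<alpha> \<Longrightarrow> bdd \<beta> \<Longrightarrow> bounded_linear (hop \<alpha> \<beta>)"
  unfolding hop_def bdd_def
  by (auto intro!: bounded_linear_sub bounded_linear_compose[OF bounded_linear_shift]
      bounded_linear_diag)

lemma norm_hop_le:
  assumes "\<And>n. \<bar>\<alpha> n\<bar> \<le> C" "\<And>n. \<bar>\<beta> n\<bar> \<le> C"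
  shows "norm (hop \<alpha> \<beta> v) \<le> 2 * C * norm v"
proof -
  have "norm (hop \<alpha> \<beta> v) \<le> norm (diag \<alpha> v) + norm (diag \<beta> v)"
    unfolding hop_def by (metis norm_shift norm_triangle_ineq4)
  then show ?thesis using norm_diag_le[of \<alpha> C v, OF assms(1)] norm_diag_le[of \<beta> C v, OF assms(2)] by linarith
qed

lemma hop_diff:
  assumes "bdd \<alpha>" "bdd \<beta>" "bdd \<alpha>'" "bdd \<beta>'"
  shows "hop \<alpha> \<beta> v - hop \<alpha>' \<beta>' v = hop (\<lambda>n. \<alpha> n - \<alpha>' n) (\<lambda>n. \<beta> n - \<beta>' n) v"
  by (rule ell2_eqI) (simp add: coord_hop bdd_diff assms algebra_simps)

abbreviation "ones \<equiv> \<lambda>_ :: int. 1 :: real"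

lemma bdd_ones: "bdd ones" by (rule bddI[of _ 1]) simp

text \<open>The constant coefficient operator is antisymmetric.\<close>

lemma inner_hop_ones: "inner (hop ones ones v) v = 0"
proof -
  have "diag ones v = v" by (rule ell2_eqI) (simp add: coord_diag[where C = 1])
  then have "hop ones ones v = shift 1 v - shift (- 1) v" by (simp add: hop_def)
  then show ?thesis
    using inner_shift[of 1 v v] inner_commute[of v "shift (- 1) v"] by (simp add: inner_diff_left)
qed

text \<open>For coefficients uniformly close to 1, the distance of \<open>z\<close> to the segment makes a rotation of
  the operator coercive: by antisymmetry when \<open>z\<close> is not imaginary, and by the norm bound
  \<open>2 \<bar>b\<bar>\<close> when it is.\<close>

lemma hop_minus_coercive:
  assumes z: "z \<notin> imag_segment (2 * \<bar>b\<bar>)"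
  obtains \<epsilon> \<eta> c where "\<epsilon> > 0" "c > 0" "\<eta> \<noteq> 0"
    "\<And>\<alpha> \<beta> v. (\<And>n. \<bar>\<alpha> n - 1\<bar> \<le> \<epsilon>) \<Longrightarrow> (\<And>n. \<bar>\<beta> n - 1\<bar> \<le> \<epsilon>) \<Longrightarrow>
      c * (norm v)\<^sup>2 \<le> inner (scaleC \<eta> (b *\<^sub>R hop \<alpha> \<beta> v - scaleC z v)) v"
proof (cases "Re z = 0")
  case False
  define \<epsilon> where "\<epsilon> = \<bar>Re z\<bar> / (4 * \<bar>b\<bar> + 1)"
  define c where "c = \<bar>Re z\<bar> / 2"
  define \<eta> :: complex where "\<eta> = of_real (- sgn (Re z))"
  have pos: "\<epsilon> > 0" "c > 0" "\<eta> \<noteq> 0" using False by (auto simp: \<epsilon>_def c_def \<eta>_def sgn_if intro!: divide_pos_pos)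
  have e: "2 * \<bar>b\<bar> * \<epsilon> \<le> c"
    unfolding \<epsilon>_def c_def by (simp add: field_simps) 
  have "c * (norm v)\<^sup>2 \<le> inner (scaleC \<eta> (b *\<^sub>R hop \<alpha> \<beta> v - scaleC z v)) v"
    if h: "\<And>n. \<bar>\<alpha> n - 1\<bar> \<le> \<epsilon>" "\<And>n. \<bar>\<beta> n - 1\<bar> \<le> \<epsilon>" for \<alpha> \<beta> v
  proof -
    have bd: "bdd \<alpha>" "bdd \<beta>" by (rule bdd_of_close[OF h(1)], rule bdd_of_close[OF h(2)])
    define s where "s = - sgn (Re z)"
    have s: "\<bar>s\<bar> = 1" "s * Re z = - \<bar>Re z\<bar>" using False by (auto simp: s_def sgn_if)
    have eq: "scaleC \<eta> u = s *\<^sub>R u" for u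
      by (rule ell2_eqI) (simp add: \<eta>_def s_def scaleR_conv_of_real)
    have "inner (hop \<alpha> \<beta> v) v = inner (hop (\<lambda>n. \<alpha> n - 1) (\<lambda>n. \<beta> n - 1) v) v"
      using arg_cong[OF hop_diff[OF bd bdd_ones bdd_ones, of v], of "\<lambda>u. inner u v"]
      by (simp add: inner_diff_left inner_hop_ones)
    then have "\<bar>inner (hop \<alpha> \<beta> v) v\<bar> \<le> norm (hop (\<lambda>n. \<alpha> n - 1) (\<lambda>n. \<beta> n - 1) v) * norm v"
      by (simp add: Cauchy_Schwarz_ineq2)
    also have "\<dots> \<le> 2 * \<epsilon> * norm v * norm v"
      by (intro mult_right_mono norm_hop_le h) simp
    finally have "\<bar>s * b * inner (hop \<alpha> \<beta> v) v\<bar> \<le> \<bar>b\<bar> * (2 * \<epsilon> * norm v * norm v)"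
      by (simp add: abs_mult s mult_left_mono)
    also have "\<dots> = (2 * \<bar>b\<bar> * \<epsilon>) * (norm v)\<^sup>2" by (simp add: power2_eq_square)
    also have "\<dots> \<le> c * (norm v)\<^sup>2" by (intro mult_right_mono e) simp
    finally have "- (c * (norm v)\<^sup>2) \<le> s * b * inner (hop \<alpha> \<beta> v) v" by linarith
    moreover have "inner (scaleC \<eta> (b *\<^sub>R hop \<alpha> \<beta> v - scaleC z v)) v
        = s * b * inner (hop \<alpha> \<beta> v) v - (s * Re z) * (norm v)\<^sup>2"
      unfolding eq by (simp add: inner_diff_left inner_scaleC_self algebra_simps)
    moreover have "\<bar>Re z\<bar> * (norm v)\<^sup>2 = c * (norm v)\<^sup>2 + c * (norm v)\<^sup>2" by (simp add: c_def)
    ultimately show ?thesis using s(2) by simp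
  qed
  with pos show ?thesis using that by blast
next
  case True
  define \<epsilon> where "\<epsilon> = (cmod z - 2 * \<bar>b\<bar>) / (4 * \<bar>b\<bar> + 1)"
  define c where "c = (cmod z - 2 * \<bar>b\<bar>) / 2"
  define \<eta> where "\<eta> = - cnj z / of_real (cmod z)"
  have z0: "2 * \<bar>b\<bar> < cmod z" using z True by (simp add: imag_segment_iff cmod_eq_Im)
  then have z1: "cmod z > 0" by linarith
  have pos: "\<epsilon> > 0" "c > 0" "\<eta> \<noteq> 0"
    using z0 z1 by (auto simp: \<epsilon>_def c_def \<eta>_def intro!: divide_pos_pos)
  have e: "2 * \<bar>b\<bar> * \<epsilon> \<le> c"
  proof -
    have "4 * \<bar>b\<bar> * \<epsilon> = (4 * \<bar>b\<bar> / (4 * \<bar>b\<bar> + 1)) * (cmod z - 2 * \<bar>b\<bar>)" by (simp add: \<epsilon>_def)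
    also have "\<dots> \<le> 1 * (cmod z - 2 * \<bar>b\<bar>)"
      by (intro mult_right_mono) (use z0 in \<open>auto simp: divide_le_eq\<close>)
    finally show ?thesis by (simp add: c_def)
  qed
  have \<eta>: "cmod \<eta> = 1" "\<eta> * z = - of_real (cmod z)"
    using z1 by (auto simp: \<eta>_def norm_divide field_simps complex_norm_square[symmetric] power2_eq_square)
  have "c * (norm v)\<^sup>2 \<le> inner (scaleC \<eta> (b *\<^sub>R hop \<alpha> \<beta> v - scaleC z v)) v"
    if h: "\<And>n. \<bar>\<alpha> n - 1\<bar> \<le> \<epsilon>" "\<And>n. \<bar>\<beta> n - 1\<bar> \<le> \<epsilon>" for \<alpha> \<beta> v
  proof -
    have h': "\<bar>\<alpha> n\<bar> \<le> 1 + \<epsilon>" "\<bar>\<beta> n\<bar> \<le> 1 + \<epsilon>" for n using h[of n] by linarith+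
    have "\<bar>inner (scaleC \<eta> (b *\<^sub>R hop \<alpha> \<beta> v)) v\<bar> \<le> norm (scaleC \<eta> (b *\<^sub>R hop \<alpha> \<beta> v)) * norm v"
      by (rule Cauchy_Schwarz_ineq2)
    also have "\<dots> \<le> \<bar>b\<bar> * (2 * (1 + \<epsilon>) * norm v) * norm v"
      using norm_hop_le[of \<alpha> "1 + \<epsilon>" \<beta> v, OF h'] by (simp add: \<eta> mult_left_mono mult_right_mono)
    also have "\<dots> = (2 * \<bar>b\<bar> + 2 * \<bar>b\<bar> * \<epsilon>) * (norm v)\<^sup>2"
      by (simp add: power2_eq_square algebra_simps)
    also have "\<dots> \<le> (2 * \<bar>b\<bar> + c) * (norm v)\<^sup>2" by (intro mult_right_mono add_left_mono e) simp
    finally have 1: "- ((2 * \<bar>b\<bar> + c) * (norm v)\<^sup>2) \<le> inner (scaleC \<eta> (b *\<^sub>R hop \<alpha> \<beta> v)) v"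
      by linarith
    have "scaleC \<eta> (b *\<^sub>R hop \<alpha> \<beta> v - scaleC z v)
        = scaleC \<eta> (b *\<^sub>R hop \<alpha> \<beta> v) + scaleC (of_real (cmod z)) v"
      by (rule ell2_eqI) (use \<eta>(2) in \<open>simp add: right_diff_distrib mult.assoc[symmetric]\<close>)
    then have "inner (scaleC \<eta> (b *\<^sub>R hop \<alpha> \<beta> v - scaleC z v)) v
        = inner (scaleC \<eta> (b *\<^sub>R hop \<alpha> \<beta> v)) v + cmod z * (norm v)\<^sup>2"
      by (simp add: inner_add_left inner_scaleC_self)
    moreover have "c * (norm v)\<^sup>2 = - ((2 * \<bar>b\<bar> + c) * (norm v)\<^sup>2) + cmod z * (norm v)\<^sup>2"
      by (simp add: c_def algebra_simps)
    ultimately show ?thesis using 1 by linarith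
  qed
  with pos show ?thesis using that by blast
qed

lemma bdd_of_finite:
  fixes a :: "int \<Rightarrow> real"
  assumes "finite {n. 1 < \<bar>a n - 1\<bar>}"
  shows "bdd a"
proof -
  define J where "J = {n. 1 < \<bar>a n - 1\<bar>}"
  have fin: "finite J" using assms by (simp add: J_def)
  show ?thesis
  proof (rule bddI)
    fix n show "\<bar>a n\<bar> \<le> 2 + (\<Sum>m\<in>J. \<bar>a m\<bar>)"
    proof (cases "n \<in> J")
      case True
      then have "\<bar>a n\<bar> \<le> (\<Sum>m\<in>J. \<bar>a m\<bar>)" by (intro member_le_sum fin) auto
      then show ?thesis by linarith
    next
      case False
      then have "\<bar>a n\<bar> \<le> 2" by (auto simp: J_def)
      moreover have "0 \<le> (\<Sum>m\<in>J. \<bar>a m\<bar>)" by (simp add: sum_nonneg)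
      ultimately show ?thesis by linarith
    qed
  qed
qed

text \<open>The operator \<open>M = b (S \<alpha> - S\<^sup>-\<^sup>1 \<beta>)\<close> with real coefficients that tend to 1 in both directions;
  \<open>A z\<close> stands for \<open>M - z\<close>.\<close>

locale limit_shift =
  fixes b :: real and \<alpha> \<beta> :: "int \<Rightarrow> real"
  assumes b: "b \<noteq> 0" and \<alpha>: "(\<alpha> \<longlongrightarrow> 1) cofinite" and \<beta>: "(\<beta> \<longlongrightarrow> 1) cofinite"
begin

definition M :: "int ell2 \<Rightarrow> int ell2" where "M v = b *\<^sub>R hop \<alpha> \<beta> v"

definition A :: "complex \<Rightarrow> int ell2 \<Rightarrow> int ell2" where "A z v = M v - scaleC z v"

lemma far:
  assumes "e > 0"
  shows "finite {n. e < \<bar>\<alpha> n - 1\<bar> \<or> e < \<bar>\<beta> n - 1\<bar>}"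
proof -
  have "eventually (\<lambda>n. dist (\<alpha> n) 1 < e \<and> dist (\<beta> n) 1 < e) cofinite"
    using \<alpha> \<beta> assms by (auto simp: tendsto_iff eventually_conj_iff)
  then have "finite {n. \<not> (dist (\<alpha> n) 1 < e \<and> dist (\<beta> n) 1 < e)}"
    by (simp add: eventually_cofinite)
  then show ?thesis by (rule rev_finite_subset) (auto simp: dist_real_def)
qed

lemma bdd\<alpha>: "bdd \<alpha>" by (rule bdd_of_finite) (use far[of 1] in \<open>auto elim: rev_finite_subset\<close>)
lemma bdd\<beta>: "bdd \<beta>" by (rule bdd_of_finite) (use far[of 1] in \<open>auto elim: rev_finite_subset\<close>)

lemma bounded_linear_M: "bounded_linear M"
  unfolding M_def
  by (intro bounded_linear_scaleR_right[THEN bounded_linear_compose] bounded_linear_hop bdd\<alpha> bdd\<beta>)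

lemma bounded_linear_A: "bounded_linear (A z)"
  unfolding A_def by (intro bounded_linear_sub bounded_linear_M bounded_linear_scaleC)

lemma coord_M: "coord (M v) n =
    of_real b * (of_real (\<alpha> (n - 1)) * coord v (n - 1) - of_real (\<beta> (n + 1)) * coord v (n + 1))"
  by (simp add: M_def coord_hop bdd\<alpha> bdd\<beta> scaleR_conv_of_real)

lemma off_segment:
  assumes z: "z \<notin> imag_segment (2 * \<bar>b\<bar>)"
  shows "closed (range (A z))"
    and "\<exists>B. finite B \<and> {v. A z v = 0} \<subseteq> span B"
    and "\<exists>B. finite B \<and> (\<forall>u. \<exists>v. u - A z v \<in> span B)"
    and "inj (A z) \<Longrightarrow> bij (A z) \<and> (\<exists>C. \<forall>v. norm v \<le> C * norm (A z v))"
proof -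
  obtain \<epsilon> \<eta> c where e: "\<epsilon> > 0" "c > 0" "\<eta> \<noteq> 0" and
    co: "\<And>\<alpha> \<beta> v. (\<And>n. \<bar>\<alpha> n - 1\<bar> \<le> \<epsilon>) \<Longrightarrow> (\<And>n. \<bar>\<beta> n - 1\<bar> \<le> \<epsilon>) \<Longrightarrow>
      c * (norm v)\<^sup>2 \<le> inner (scaleC \<eta> (b *\<^sub>R hop \<alpha> \<beta> v - scaleC z v)) v"
    using hop_minus_coercive[OF z] by metis
  define J where "J = {n. \<epsilon> < \<bar>\<alpha> n - 1\<bar> \<or> \<epsilon> < \<bar>\<beta> n - 1\<bar>}"
  have J: "finite J" unfolding J_def by (rule far[OF e(1)])
  \<comment> \<open>The coefficients are replaced by 1 at the finitely many places where they are far from it.\<close>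
  define \<alpha>' where "\<alpha>' n = (if n \<in> J then 1 else \<alpha> n)" for n
  define \<beta>' where "\<beta>' n = (if n \<in> J then 1 else \<beta> n)" for n
  have close: "\<bar>\<alpha>' n - 1\<bar> \<le> \<epsilon>" "\<bar>\<beta>' n - 1\<bar> \<le> \<epsilon>" for n
    using e(1) by (auto simp: \<alpha>'_def \<beta>'_def J_def)
  have bd: "bdd \<alpha>'" "bdd \<beta>'"
    by (rule bdd_of_close[OF close(1)], rule bdd_of_close[OF close(2)])
  define T1 where "T1 v = b *\<^sub>R hop \<alpha>' \<beta>' v - scaleC z v" for v
  have T1: "bounded_linear T1"
    unfolding T1_def
    by (intro bounded_linear_sub bounded_linear_scaleC bounded_linear_hop bd
        bounded_linear_scaleR_right[THEN bounded_linear_compose])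
  have coT: "c * (norm v)\<^sup>2 \<le> inner (scaleC \<eta> (T1 v)) v" for v
    unfolding T1_def by (rule co[OF close])
  note * = coercive_imp_bij[OF bounded_linear_compose[OF bounded_linear_scaleC T1] e(2) coT]
  have bijT: "bij T1"
  proof (rule bijI)
    show "inj T1" using bij_is_inj[OF *(1)] by (auto simp: inj_def)
    show "surj T1"
    proof (rule surjI[of _ "\<lambda>y. inv (\<lambda>v. scaleC \<eta> (T1 v)) (scaleC \<eta> y)"])
      fix y
      have "scaleC \<eta> (T1 (inv (\<lambda>v. scaleC \<eta> (T1 v)) (scaleC \<eta> y))) = scaleC \<eta> y"
        using surj_f_inv_f[OF bij_is_surj[OF *(1)]] by simp
      from arg_cong[OF this, of coord]
      show "T1 (inv (\<lambda>v. scaleC \<eta> (T1 v)) (scaleC \<eta> y)) = y"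
        using e(3) by (intro ell2_eqI) (simp add: fun_eq_iff)
    qed
  qed
  have lower: "c / cmod \<eta> * norm v \<le> norm (T1 v)" for v
    using *(2)[of v] e(3) by (simp add: field_simps)
  have G: "bounded_linear (inv T1)"
    by (rule bounded_linear_inv[OF T1 bijT _ lower]) (use e in simp)
  define D where "D v = b *\<^sub>R hop (\<lambda>n. \<alpha> n - \<alpha>' n) (\<lambda>n. \<beta> n - \<beta>' n) v" for v
  have D: "bounded_linear D"
    unfolding D_def
    by (intro bounded_linear_scaleR_right[THEN bounded_linear_compose] bounded_linear_hop
        bdd_diff bdd\<alpha> bdd\<beta> bd)
  interpret finite_rank_perturbation T1 "inv T1" "\<lambda>(n, w). inner (unit n w)" "\<lambda>(n, w). D (unit n w)"
    "J \<times> {1, \<i>}"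
  proof (rule finite_rank_perturbation.intro)
    show "bounded_linear T1" by (fact T1)
    show "bounded_linear (inv T1)" by (fact G)
    show "inv T1 (T1 x) = x" "T1 (inv T1 x) = x" for x
      using bijT by (simp_all add: bij_is_inj bij_is_surj surj_f_inv_f)
    show "bounded_linear ((\<lambda>(n, w). inner (unit n w)) i)" for i :: "int \<times> complex"
      by (cases i) (simp add: bounded_linear_inner_right)
    show "finite (J \<times> {1, \<i>})" using J by simp
  qed
  have F: "F v = D v" for v
  proof -
    interpret D: bounded_linear D by fact
    define w where "w = (\<Sum>(n, c)\<in>J \<times> {1, \<i>}. inner (unit n c) v *\<^sub>R unit n c)"
    have w: "coord w n = coord v n" if "n \<in> J" for n
    proof -
      have "coord w n = (\<Sum>(m, c)\<in>J \<times> {1, \<i>}. coord (inner (unit m c) v *\<^sub>R unit m c) n)"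
        by (simp add: w_def case_prod_unfold)
      also have "\<dots> = (\<Sum>m\<in>J. \<Sum>c\<in>{1, \<i>}. coord (inner (unit m c) v *\<^sub>R unit m c) n)"
        by (rule sum.cartesian_product[symmetric])
      also have "\<dots> = (\<Sum>m\<in>J. if m = n then coord v n else 0)"
        by (intro sum.cong refl) (auto simp: inner_unit complex_eq_iff)
      finally show ?thesis using that J by simp
    qed
    have "F v = D w"
      unfolding F_def w_def D.sum by (intro sum.cong refl) (auto simp: D.scaleR)
    also have "\<dots> = D v"
      unfolding D_def
    proof (rule ell2_eqI)
      fix n
      have "(of_real (\<alpha> m - \<alpha>' m) :: complex) * coord w m = of_real (\<alpha> m - \<alpha>' m) * coord v m"
        "(of_real (\<beta> m - \<beta>' m) :: complex) * coord w m = of_real (\<beta> m - \<beta>' m) * coord v m" for m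
        using w[of m] by (auto simp: \<alpha>'_def \<beta>'_def)
      then show "coord (b *\<^sub>R hop (\<lambda>n. \<alpha> n - \<alpha>' n) (\<lambda>n. \<beta> n - \<beta>' n) w) n
          = coord (b *\<^sub>R hop (\<lambda>n. \<alpha> n - \<alpha>' n) (\<lambda>n. \<beta> n - \<beta>' n) v) n"
        by (simp only: coord_hop[OF bdd_diff[OF bdd\<alpha> bd(1)] bdd_diff[OF bdd\<beta> bd(2)]]
            scaleR_ell2.rep_eq)
    qed
    finally show ?thesis .
  qed
  have "T v = A z v" for v
  proof -
    have "T v = T1 v + D v" by (simp only: T_def F)
    also have "\<dots> = A z v"
      unfolding D_def hop_diff[OF bdd\<alpha> bdd\<beta> bd, symmetric] T1_def A_def M_def
      by (simp add: algebra_simps)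
    finally show ?thesis .
  qed
  then have TA: "T = A z" by auto
  show "closed (range (A z))" using closed_range by (simp add: TA)
  show "\<exists>B. finite B \<and> {v. A z v = 0} \<subseteq> span B"
    using kernel_subset J unfolding TA V_def
    by (intro exI[of _ "(\<lambda>i. inv T1 ((\<lambda>(n, w). D (unit n w)) i)) ` (J \<times> {1, \<i>})"]) auto
  show "\<exists>B. finite B \<and> (\<forall>u. \<exists>v. u - A z v \<in> span B)"
    using cokernel J unfolding TA
    by (intro exI[of _ "(\<lambda>(n, w). D (unit n w)) ` (J \<times> {1, \<i>})"]) auto
  show "bij (A z) \<and> (\<exists>C. \<forall>v. norm v \<le> C * norm (A z v))" if "inj (A z)"
    using injective_imp_bij that unfolding TA by blast
qed

end

section \<open>The range on the segment is not closed\<close>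

lemma exists_orthogonal_triple:
  fixes x y :: "nat \<Rightarrow> complex"
  shows "\<exists>a. (\<exists>i<3. a i \<noteq> 0) \<and> (\<Sum>i<3. a i * x i) = 0 \<and> (\<Sum>i<3. a i * y i) = 0"
proof -
  have three: "(\<Sum>i<3. f i) = f 0 + f 1 + f 2" for f :: "nat \<Rightarrow> complex"
    by (simp add: eval_nat_numeral)
  define t :: "complex \<Rightarrow> complex \<Rightarrow> complex \<Rightarrow> nat \<Rightarrow> complex"
    where "t p q r i = (if i = 0 then p else if i = 1 then q else r)" for p q r i
  have tex: "\<exists>i<3. t p q r i \<noteq> 0" if "p \<noteq> 0 \<or> q \<noteq> 0 \<or> r \<noteq> 0" for p q r
    using that
  proof (elim disjE)
    show "p \<noteq> 0 \<Longrightarrow> ?thesis" by (intro exI[of _ 0]) (simp add: t_def)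
    show "q \<noteq> 0 \<Longrightarrow> ?thesis" by (intro exI[of _ 1]) (simp add: t_def)
    show "r \<noteq> 0 \<Longrightarrow> ?thesis" by (intro exI[of _ 2]) (simp add: t_def)
  qed
  have gen: ?thesis
    if "p \<noteq> 0 \<or> q \<noteq> 0 \<or> r \<noteq> 0"
      "p * x 0 + q * x 1 + r * x 2 = 0" "p * y 0 + q * y 1 + r * y 2 = 0" for p q r
    using tex[OF that(1)] that(2,3)
    by (intro exI[of _ "t p q r"]) (simp add: three, simp add: t_def)
  define c0 c1 c2 where "c0 = x 1 * y 2 - x 2 * y 1" and "c1 = x 2 * y 0 - x 0 * y 2"
    and "c2 = x 0 * y 1 - x 1 * y 0"
  show ?thesis
  proof (cases "c0 = 0 \<and> c1 = 0 \<and> c2 = 0")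
    case False
    then show ?thesis
      by (intro gen[of c0 c1 c2]) (auto simp: c0_def c1_def c2_def algebra_simps)
  next
    case True
    \<comment> \<open>The two vectors are parallel.\<close>
    consider "x 0 = 0" "y 0 = 0" | "x 0 \<noteq> 0" | "y 0 \<noteq> 0" by blast
    then show ?thesis
    proof cases
      case 1
      then show ?thesis by (intro gen[of 1 0 0]) auto
    next
      case 2
      then show ?thesis using True
        by (intro gen[of "x 1" "- x 0" 0]) (auto simp: c2_def algebra_simps)
    next
      case 3
      then show ?thesis using True
        by (intro gen[of "y 1" "- y 0" 0]) (auto simp: c2_def algebra_simps)
    qed
  qed
qed

context limit_shift
begin

lemma far_right:
  assumes "e > 0"
  obtains m where "m > m0" "\<And>n. n > m \<Longrightarrow> \<bar>\<alpha> n - 1\<bar> \<le> e \<and> \<bar>\<beta> n - 1\<bar> \<le> e"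
proof -
  define J where "J = insert m0 {n. e < \<bar>\<alpha> n - 1\<bar> \<or> e < \<bar>\<beta> n - 1\<bar>}"
  have J: "finite J" using far[OF assms] by (simp add: J_def)
  show ?thesis
  proof (rule that[of "Max J + 1"])
    show "m0 < Max J + 1" using Max_ge[OF J, of m0] by (simp add: J_def)
    fix n assume "n > Max J + 1"
    then have "n \<notin> J" using Max_ge[OF J, of n] by auto
    then show "\<bar>\<alpha> n - 1\<bar> \<le> e \<and> \<bar>\<beta> n - 1\<bar> \<le> e" by (auto simp: J_def)
  qed
qed

text \<open>Truncated plane waves far to the right are approximate eigenvectors.\<close>

lemma quasimode:
  assumes z: "z \<in> imag_segment (2 * \<bar>b\<bar>)" and e: "e > 0"
  shows "\<exists>v m'. norm v = 1 \<and> m0 < m' \<and> (\<forall>n. coord v n \<noteq> 0 \<longrightarrow> m0 < n \<and> n \<le> m') \<and> norm (A z v) < e"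
proof -
  obtain m where m: "m > m0"
    and close: "\<And>n. n > m \<Longrightarrow> \<bar>\<alpha> n - 1\<bar> \<le> e / (4 * \<bar>b\<bar> + 1) / 2 \<and> \<bar>\<beta> n - 1\<bar> \<le> e / (4 * \<bar>b\<bar> + 1) / 2"
    using far_right[of "e / (4 * \<bar>b\<bar> + 1) / 2" m0] e by (auto simp: field_simps)
  define d where "d = e / (4 * \<bar>b\<bar> + 1) / 2"
  have d: "d > 0" using e by (auto simp: d_def intro!: divide_pos_pos)
  define \<theta> where "\<theta> = arcsin (- Im z / (2 * b))"
  define \<omega> where "\<omega> = cis \<theta>"
  have "\<bar>- Im z / (2 * b)\<bar> \<le> 1"
    using z b by (simp add: imag_segment_iff abs_divide abs_mult)
  then have sin: "sin \<theta> = - Im z / (2 * b)"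
    unfolding \<theta>_def by (intro sin_arcsin) linarith+
  have zw: "z = of_real b * (cnj \<omega> - \<omega>)"
    using z b by (simp add: complex_eq_iff \<omega>_def sin imag_segment_iff)
  have ww: "cmod \<omega> = 1" "\<omega> * cnj \<omega> = 1" "cnj \<omega> * \<omega> = 1"
    by (auto simp: \<omega>_def cis_cnj cis_mult)
  obtain N :: nat where N: "N > 0" "4 * \<bar>b\<bar> / sqrt N < e / 2"
  proof -
    obtain N :: nat where "(4 * \<bar>b\<bar> / (e / 2))\<^sup>2 < N" using reals_Archimedean2 by blast
    then have "4 * \<bar>b\<bar> / (e / 2) < sqrt N" by (intro real_less_rsqrt)
    moreover have "0 \<le> 4 * \<bar>b\<bar> / (e / 2)" using e by simp
    ultimately have "sqrt N > 0" by linarith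
    then have "N > 0" "4 * \<bar>b\<bar> / sqrt N < e / 2"
      using \<open>4 * \<bar>b\<bar> / (e / 2) < sqrt N\<close> e by (auto simp: field_simps)
    then show ?thesis by (rule that)
  qed
  define v0 where "v0 = (\<Sum>j<N. unit (m + 1 + int j) (\<omega> ^ j))"
  define v where "v = (1 / sqrt N) *\<^sub>R v0"
  have in1: "inner (\<omega> ^ j) (\<omega> ^ j) = 1" for j
    using ww(1) by (simp add: power2_norm_eq_inner[symmetric] norm_power)
  have "(norm v0)\<^sup>2 = (\<Sum>i<N. \<Sum>j<N. inner (unit (m + 1 + int i) (\<omega> ^ i)) (unit (m + 1 + int j) (\<omega> ^ j)))"
    unfolding power2_norm_eq_inner v0_def inner_sum_left inner_sum_right by (rule sum.swap)
  also have "\<dots> = (\<Sum>i<N. \<Sum>j<N. if j = i then 1 else 0)"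
    by (intro sum.cong refl) (auto simp: inner_unit in1)
  also have "\<dots> = N" by simp
  finally have norm0: "norm v0 = sqrt N" by (simp add: real_sqrt_unique)
  then have "norm v = 1" using N(1) by (simp add: v_def)
  have supp0: "m < n \<and> n \<le> m + int N" if "coord v0 n \<noteq> 0" for n
  proof -
    have "\<exists>j<N. n = m + 1 + int j"
    proof (rule ccontr)
      assume "\<not> (\<exists>j<N. n = m + 1 + int j)"
      then have "coord v0 n = 0" unfolding v0_def coord_sum by (intro sum.neutral) auto
      with that show False by simp
    qed
    then show ?thesis by auto
  qed
  then have supp: "m < n \<and> n \<le> m + int N" if "coord v n \<noteq> 0" for n
    using that by (auto simp: v_def)
  interpret H: bounded_linear "hop ones ones" by (rule bounded_linear_hop[OF bdd_ones bdd_ones])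
  interpret Z: bounded_linear "scaleC z" by (rule bounded_linear_scaleC)
  \<comment> \<open>As \<open>z = b (cnj \<omega> - \<omega>)\<close>, the sum telescopes: only four unit vectors at the ends remain.\<close>
  have "b *\<^sub>R hop ones ones v0 - scaleC z v0
      = b *\<^sub>R (\<Sum>j<N. (unit (m + 1 + int (Suc j)) (\<omega> ^ j) - unit (m + 1 + int j) (cnj \<omega> * \<omega> ^ j))
          - (unit (m + 1 + int j - 1) (\<omega> ^ j) - unit (m + 1 + int j) (\<omega> ^ Suc j)))"
    unfolding v0_def H.sum Z.sum scaleR_sum_right sum_subtractf[symmetric]
    by (intro sum.cong refl ell2_eqI)
      (auto simp: coord_hop[OF bdd_ones bdd_ones] zw scaleR_conv_of_real algebra_simps)
  also have "(\<Sum>j<N. (unit (m + 1 + int (Suc j)) (\<omega> ^ j) - unit (m + 1 + int j) (cnj \<omega> * \<omega> ^ j))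
          - (unit (m + 1 + int j - 1) (\<omega> ^ j) - unit (m + 1 + int j) (\<omega> ^ Suc j)))
      = (\<Sum>j<N. unit (m + 1 + int (Suc j)) (cnj \<omega> * \<omega> ^ Suc j) - unit (m + 1 + int j) (cnj \<omega> * \<omega> ^ j))
        + (\<Sum>j<N. unit (m + int (Suc j)) (\<omega> ^ Suc j) - unit (m + int j) (\<omega> ^ j))"
    unfolding sum.distrib[symmetric]
    by (intro sum.cong refl) (simp add: mult.assoc[symmetric] ww algebra_simps)
  also have "\<dots> = (unit (m + 1 + int N) (cnj \<omega> * \<omega> ^ N) - unit (m + 1) (cnj \<omega>))
        + (unit (m + int N) (\<omega> ^ N) - unit m 1)"
    by (simp only: sum_lessThan_telescope[where f = "\<lambda>j. unit (m + 1 + int j) (cnj \<omega> * \<omega> ^ j)"]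
        sum_lessThan_telescope[where f = "\<lambda>j. unit (m + int j) (\<omega> ^ j)"]) simp
  finally have "norm (b *\<^sub>R hop ones ones v0 - scaleC z v0)
      = \<bar>b\<bar> * norm ((unit (m + 1 + int N) (cnj \<omega> * \<omega> ^ N) - unit (m + 1) (cnj \<omega>))
        + (unit (m + int N) (\<omega> ^ N) - unit m 1))" by simp
  also have "\<dots> \<le> \<bar>b\<bar> * ((1 + 1) + (1 + 1))"
  proof (intro mult_left_mono norm_triangle_le add_mono norm_triangle_le_diff)
    have nu: "norm (unit n c) = cmod c" for n :: int and c
      using norm_finite_support[of "{n}" "unit n c"] by simp
    show "norm (unit (m + 1 + int N) (cnj \<omega> * \<omega> ^ N)) \<le> 1" "norm (unit (m + 1) (cnj \<omega>)) \<le> 1"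
      "norm (unit (m + int N) (\<omega> ^ N)) \<le> 1" "norm (unit m 1) \<le> 1"
      by (simp_all add: nu norm_mult norm_power ww)
  qed simp
  finally have n1: "norm (b *\<^sub>R hop ones ones v0 - scaleC z v0) \<le> 4 * \<bar>b\<bar>" by simp
  have "b *\<^sub>R hop ones ones v - scaleC z v = (1 / sqrt N) *\<^sub>R (b *\<^sub>R hop ones ones v0 - scaleC z v0)"
    by (simp add: v_def H.scaleR Z.scaleR algebra_simps)
  then have "norm (b *\<^sub>R hop ones ones v - scaleC z v) \<le> 4 * \<bar>b\<bar> / sqrt N"
    using n1 N(1) by (simp add: divide_right_mono)
  then have part1: "norm (b *\<^sub>R hop ones ones v - scaleC z v) < e / 2" using N(2) by linarith
  define \<gamma> where "\<gamma> n = (if n > m then \<alpha> n - 1 else 0)" for n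
  define \<delta> where "\<delta> n = (if n > m then \<beta> n - 1 else 0)" for n
  have \<gamma>: "\<bar>\<gamma> n\<bar> \<le> d" "\<bar>\<delta> n\<bar> \<le> d" for n
    using close[of n] d by (auto simp: \<gamma>_def \<delta>_def d_def)
  have bd: "bdd \<gamma>" "bdd \<delta>" by (rule bddI[OF \<gamma>(1)], rule bddI[OF \<gamma>(2)])
  have v0: "coord v n = 0" if "n \<le> m" for n using supp[of n] that by auto
  have "A z v = (b *\<^sub>R hop ones ones v - scaleC z v) + b *\<^sub>R hop \<gamma> \<delta> v"
  proof (rule ell2_eqI)
    fix n
    have "(of_real (\<alpha> k) :: complex) * coord v k = coord v k + of_real (\<gamma> k) * coord v k"
      "(of_real (\<beta> k) :: complex) * coord v k = coord v k + of_real (\<delta> k) * coord v k" for k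
      using v0[of k] by (auto simp: \<gamma>_def \<delta>_def algebra_simps)
    then show "coord (A z v) n = coord ((b *\<^sub>R hop ones ones v - scaleC z v) + b *\<^sub>R hop \<gamma> \<delta> v) n"
      by (simp add: A_def coord_M coord_hop bd bdd_ones scaleR_conv_of_real algebra_simps)
  qed
  moreover have "norm (b *\<^sub>R hop \<gamma> \<delta> v) \<le> e / 2"
  proof -
    have "norm (b *\<^sub>R hop \<gamma> \<delta> v) \<le> \<bar>b\<bar> * (2 * d)"
      using norm_hop_le[of \<gamma> d \<delta> v, OF \<gamma>] \<open>norm v = 1\<close> by (simp add: mult_left_mono)
    also have "\<dots> \<le> e / 2"
      using e unfolding d_def by (simp add: field_simps)
    finally show ?thesis .
  qed
  ultimately have "norm (A z v) < e"
    using part1 norm_triangle_ineq[of "b *\<^sub>R hop ones ones v - scaleC z v" "b *\<^sub>R hop \<gamma> \<delta> v"] by simp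
  with \<open>norm v = 1\<close> supp m N(1) show ?thesis
    by (intro exI[of _ v] exI[of _ "m + int N"]) force
qed

end

context limit_shift
begin

text \<open>Quasimodes with disjoint supports and summable errors.\<close>

lemma quasimode_sequence:
  assumes z: "z \<in> imag_segment (2 * \<bar>b\<bar>)"
  obtains v :: "nat \<Rightarrow> int ell2" and m :: "nat \<Rightarrow> int" where
    "m 0 = m0" "strict_mono m" "\<And>j. norm (v j) = 1" "\<And>j. norm (A z (v j)) \<le> (1/2) ^ j"
    "\<And>j n. coord (v j) n \<noteq> 0 \<Longrightarrow> m j < n \<and> n \<le> m (Suc j)"
proof -
  define P where "P j k l v \<longleftrightarrow> norm v = 1 \<and> k < l \<and>
      (\<forall>n. coord v n \<noteq> 0 \<longrightarrow> k < n \<and> n \<le> l) \<and> norm (A z v) < (1/2) ^ j" for j :: nat and k l v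
  have ex: "\<exists>v l. P j k l v" for j k
    using quasimode[OF z, of "(1/2) ^ j" k] by (auto simp: P_def)
  define V where "V j k = (SOME v. \<exists>l. P j k l v)" for j k
  define L where "L j k = (SOME l. P j k l (V j k))" for j k
  have VL: "P j k (L j k) (V j k)" for j k
    unfolding L_def by (rule someI_ex) (unfold V_def, rule someI_ex, rule ex)
  define m where "m = rec_nat m0 L"
  have m: "m 0 = m0" "m (Suc j) = L j (m j)" for j by (simp_all add: m_def)
  define v where "v j = V j (m j)" for j
  have P: "P j (m j) (m (Suc j)) (v j)" for j unfolding m v_def by (rule VL)
  show ?thesis
  proof (rule that[of m v])
    show "m 0 = m0" by (rule m)
    show "strict_mono m" using P by (auto simp: strict_mono_Suc_iff P_def)
    show "norm (v j) = 1" for j using P[of j] by (simp add: P_def)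
    show "norm (A z (v j)) \<le> (1/2) ^ j" for j using P[of j] by (simp add: P_def)
    show "m j < n \<and> n \<le> m (Suc j)" if "coord (v j) n \<noteq> 0" for j n
      using P[of j] that by (auto simp: P_def)
  qed
qed

text \<open>If the range were closed, it would contain \<open>f i = \<Sum>\<^sub>j A (v j)\<close>, the sum over \<open>j \<equiv> i\<close> modulo 3,
  for \<open>i < 3\<close>.  A preimage \<open>w i\<close> differs from the formal sum \<open>u i\<close> of these \<open>v j\<close> by a solution of a
  three-term recurrence.  Far to the right the solutions form a space of dimension at most two, so
  a nontrivial combination of the \<open>u i\<close> agrees there with a square summable sequence.\<close>

lemma on_segment_range_not_closed:
  assumes z: "z \<in> imag_segment (2 * \<bar>b\<bar>)"
  shows "\<not> closed (range (A z))"
proof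
  assume closed: "closed (range (A z))"
  interpret A: bounded_linear "A z" by (rule bounded_linear_A)
  obtain n0 where n0: "\<And>n. n > n0 \<Longrightarrow> \<bar>\<beta> n - 1\<bar> \<le> 1/2"
    using far_right[of "1/2" 0] by (metis half_gt_zero_iff zero_less_one)
  obtain v m where m: "m 0 = n0" "strict_mono m" and v: "\<And>j. norm (v j) = 1"
    and Av: "\<And>j. norm (A z (v j)) \<le> (1/2) ^ j"
    and supp: "\<And>j n. coord (v j) n \<noteq> 0 \<Longrightarrow> m j < n \<and> n \<le> m (Suc j)"
    using quasimode_sequence[OF z, of n0] by metis
  have disj: "coord (v j) n = 0" if "m k < n" "n \<le> m (Suc k)" "j \<noteq> k" for j k n
  proof (rule ccontr)
    assume "coord (v j) n \<noteq> 0"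
    then have "m j < n" "n \<le> m (Suc j)" using supp by auto
    then have "m j < m (Suc k)" "m k < m (Suc j)" using that by linarith+
    then have "j < Suc k" "k < Suc j" using m(2) by (simp_all add: strict_mono_less)
    then show False using that(3) by linarith
  qed
  define sel :: "nat \<Rightarrow> nat \<Rightarrow> complex" where "sel i j = (if j mod 3 = i then 1 else 0)" for i j
  define u where "u i n = (\<Sum>j. sel i j * coord (v j) n)" for i n
  have fin: "finite {j. coord (v j) n \<noteq> 0}" for n
  proof (cases "\<exists>k. coord (v k) n \<noteq> 0")
    case True
    then obtain k where k: "coord (v k) n \<noteq> 0" by blast
    have "{j. coord (v j) n \<noteq> 0} \<subseteq> {k}" using disj[of k n] supp[OF k] by auto
    then show ?thesis by (rule finite_subset) simp
  qed simp
  have u: "(\<lambda>j. sel i j * coord (v j) n) sums u i n" for i n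
    unfolding u_def
    by (intro summable_sums summable_finite[OF fin[of n]]) auto
  have ueq: "u i n = sel i k * coord (v k) n" if "m k < n" "n \<le> m (Suc k)" for i k n
  proof -
    have "(\<lambda>j. sel i j * coord (v j) n) sums (\<Sum>j\<in>{k}. sel i j * coord (v j) n)"
      by (rule sums_finite) (use disj[OF that] in auto)
    then show ?thesis using sums_unique2[OF u] by simp
  qed
  define B where "B f n = of_real b * (of_real (\<alpha> (n - 1)) * f (n - 1) - of_real (\<beta> (n + 1)) * f (n + 1)) - z * f n"
    for f :: "int \<Rightarrow> complex" and n
  have coordA: "coord (A z w) n = B (coord w) n" for w n by (simp add: A_def coord_M B_def)
  have "\<exists>w. \<forall>n. B (coord w) n = B (u i) n" for i
  proof -
    define g where "g j = A z (scaleC (sel i j) (v j))" for j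
    have coordg: "coord (g j) n = sel i j * coord (A z (v j)) n" for j n
      by (simp add: g_def coordA B_def algebra_simps)
    then have geq: "g j = scaleC (sel i j) (A z (v j))" for j
      by (intro ell2_eqI) simp
    have "norm (g j) \<le> (1/2) ^ j" for j
      using Av[of j] by (auto simp: geq sel_def)
    then have sg: "summable g"
      by (intro summable_comparison_test[OF _ summable_geometric[of "1/2 :: real"]]) auto
    have "(\<Sum>j<N. g j) = A z (\<Sum>j<N. scaleC (sel i j) (v j))" for N
      by (simp add: g_def A.sum)
    then have "(\<Sum>j<N. g j) \<in> range (A z)" for N by blast
    moreover have "(\<lambda>N. \<Sum>j<N. g j) \<longlonglongrightarrow> suminf g" using sg by (rule summable_LIMSEQ)
    ultimately have "suminf g \<in> range (A z)"
      using closed_sequentially[OF closed, of "\<lambda>N. \<Sum>j<N. g j"] by blast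
    then obtain w where w: "suminf g = A z w" by blast
    have "B (coord w) n = B (u i) n" for n
    proof -
      have "(\<lambda>j. coord (g j) n) sums coord (A z w) n"
        unfolding w[symmetric] by (rule bounded_linear.sums[OF bounded_linear_coord summable_sums[OF sg]])
      moreover have "(\<lambda>j. coord (g j) n) sums B (u i) n"
      proof -
        have "(\<lambda>j. of_real b * (of_real (\<alpha> (n - 1)) * (sel i j * coord (v j) (n - 1))
            - of_real (\<beta> (n + 1)) * (sel i j * coord (v j) (n + 1))) - z * (sel i j * coord (v j) n)) sums B (u i) n"
          unfolding B_def by (intro sums_diff sums_mult u)
        then show ?thesis by (simp add: coordg coordA B_def algebra_simps)
      qed
      ultimately show ?thesis using sums_unique2 by (simp add: coordA)
    qed
    then show ?thesis by blast
  qed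
  then obtain w where w: "\<And>i n. B (coord (w i)) n = B (u i) n" by metis
  define h where "h i n = u i n - coord (w i) n" for i n
  obtain a :: "nat \<Rightarrow> complex" where a: "\<exists>i<3. a i \<noteq> 0"
    "(\<Sum>i<3. a i * h i (n0 + 1)) = 0" "(\<Sum>i<3. a i * h i (n0 + 2)) = 0"
    using exists_orthogonal_triple[of "\<lambda>i. h i (n0 + 1)" "\<lambda>i. h i (n0 + 2)"] by blast
  define H where "H n = (\<Sum>i<3. a i * h i n)" for n
  have BH: "B H n = 0" for n
  proof -
    have "B (h i) n = 0" for i using w[of i n] by (simp add: h_def B_def algebra_simps)
    moreover have "B H n = (\<Sum>i<3. a i * B (h i) n)"
      by (simp add: H_def B_def sum_distrib_left sum_subtractf[symmetric] algebra_simps)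
    ultimately show ?thesis by simp
  qed
  have "H (n0 + 1 + int k) = 0 \<and> H (n0 + 2 + int k) = 0" for k
  proof (induction k)
    case 0
    then show ?case using a by (simp add: H_def)
  next
    case (Suc k)
    define n where "n = n0 + 2 + int k"
    have zero: "H n = 0" "H (n - 1) = 0" using Suc by (simp_all add: n_def algebra_simps)
    have "\<beta> (n + 1) \<noteq> 0" using n0[of "n + 1"] by (auto simp: n_def)
    moreover have "of_real b * (of_real (\<beta> (n + 1)) * H (n + 1)) = 0"
      using BH[of n] zero by (simp add: B_def)
    ultimately have "H (n + 1) = 0" using b by simp
    then show ?case using zero(1) by (simp add: n_def algebra_simps)
  qed
  then have H0: "H n = 0" if "n > n0" for n
    using that by (metis add.commute add.left_commute add_diff_cancel_left' zless_iff_Suc_zadd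
        int_Suc of_nat_Suc add.assoc)
  define W where "W = (\<Sum>i<3. scaleC (a i) (w i))"
  have W: "coord W n = (\<Sum>i<3. a i * u i n)" if "n > n0" for n
    using H0[OF that] by (simp add: H_def h_def W_def right_diff_distrib sum_subtractf)
  obtain i0 where i0: "i0 < 3" "a i0 \<noteq> 0" using a(1) by blast
  obtain F where F: "finite F"
    "\<And>G. finite G \<Longrightarrow> G \<inter> F = {} \<Longrightarrow> (\<Sum>n\<in>G. (cmod (coord W n))\<^sup>2) < (cmod (a i0))\<^sup>2"
    using coord_tail_small[of "(cmod (a i0))\<^sup>2" W] i0(2) by auto
  have grow: "n0 + int j \<le> m j" for j
  proof (induction j)
    case (Suc j)
    then show ?case using strict_monoD[OF m(2), of j "Suc j"] by simp
  qed (simp add: m)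
  define q where "q = nat (Max (insert n0 F) - n0)"
  define j where "j = 3 * q + i0"
  have mj: "n0 \<le> m j" "\<And>n. n \<in> F \<Longrightarrow> n \<le> m j"
  proof -
    have "Max (insert n0 F) \<le> n0 + int j" by (simp add: j_def q_def)
    then have "Max (insert n0 F) \<le> m j" using grow[of j] by linarith
    then show "n0 \<le> m j" "\<And>n. n \<in> F \<Longrightarrow> n \<le> m j" using F(1) by auto
  qed
  define G where "G = {m j<..m (Suc j)}"
  have "(\<Sum>n\<in>G. (cmod (coord W n))\<^sup>2) = (\<Sum>n\<in>G. (cmod (a i0))\<^sup>2 * (cmod (coord (v j) n))\<^sup>2)"
  proof (rule sum.cong)
    fix n assume "n \<in> G"
    then have n: "m j < n" "n \<le> m (Suc j)" by (auto simp: G_def)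
    have jmod: "j mod 3 = i0" using i0(1) by (simp add: j_def)
    have "coord W n = (\<Sum>i<3. a i * u i n)" using mj(1) n by (intro W) simp
    also have "\<dots> = (\<Sum>i<3. if i = i0 then a i0 * coord (v j) n else 0)"
      by (intro sum.cong refl) (auto simp: ueq[OF n] sel_def jmod)
    finally have "coord W n = a i0 * coord (v j) n" using i0(1) by simp
    then show "(cmod (coord W n))\<^sup>2 = (cmod (a i0))\<^sup>2 * (cmod (coord (v j) n))\<^sup>2"
      by (simp add: norm_mult power_mult_distrib)
  qed simp
  also have "\<dots> = (cmod (a i0))\<^sup>2 * (norm (v j))\<^sup>2"
    unfolding sum_distrib_left[symmetric]
    by (subst norm_finite_support[of G]) (use supp in \<open>auto simp: G_def\<close>)
  finally have "(\<Sum>n\<in>G. (cmod (coord W n))\<^sup>2) = (cmod (a i0))\<^sup>2" by (simp add: v)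
  moreover have "finite G" "G \<inter> F = {}" using mj(2) by (auto simp: G_def dest!: mj(2))
  ultimately show False using F(2)[of G] by simp
qed

end

section \<open>Eigenvectors and density of the range\<close>

lemma coord_tendsto_0: "(coord v \<longlongrightarrow> 0) cofinite"
proof (rule tendstoI)
  fix e :: real assume "e > 0"
  then obtain F where F: "finite F"
    "\<And>G. finite G \<Longrightarrow> G \<inter> F = {} \<Longrightarrow> (\<Sum>i\<in>G. (cmod (coord v i))\<^sup>2) < e\<^sup>2"
    using coord_tail_small[of "e\<^sup>2" v] by auto
  have "dist (coord v i) 0 < e" if "i \<notin> F" for i
    using F(2)[of "{i}"] that \<open>e > 0\<close> by (simp add: power_less_imp_less_base)
  then have "{i. \<not> dist (coord v i) 0 < e} \<subseteq> F" by blast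
  then show "\<forall>\<^sub>F i in cofinite. dist (coord v i) 0 < e"
    unfolding eventually_cofinite using F(1) by (rule finite_subset)
qed

lemma tendsto_cofinite_shift:
  fixes f :: "int \<Rightarrow> 'b :: topological_space"
  assumes "(f \<longlongrightarrow> l) cofinite"
  shows "((\<lambda>n. f (n + j)) \<longlongrightarrow> l) cofinite"
proof -
  have "filterlim (\<lambda>n :: int. n + j) cofinite cofinite"
    unfolding filterlim_iff eventually_cofinite
  proof (intro allI impI)
    fix P assume "finite {x :: int. \<not> P x}"
    moreover have "{x. \<not> P (x + j)} = (\<lambda>x. x - j) ` {x. \<not> P x}"
    proof (intro equalityI subsetI)
      fix x assume "x \<in> {x. \<not> P (x + j)}"
      then show "x \<in> (\<lambda>x. x - j) ` {x. \<not> P x}" by (intro image_eqI[of _ _ "x + j"]) auto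
    qed auto
    ultimately show "finite {x. \<not> P (x + j)}" by simp
  qed
  then show ?thesis by (rule filterlim_compose[OF assms])
qed

lemma antitone_vanishing_imp_zero:
  fixes f :: "int \<Rightarrow> real"
  assumes anti: "\<And>n. f (n + 1) \<le> f n" and lim: "(f \<longlongrightarrow> 0) cofinite"
  shows "f n = 0"
proof -
  have le: "f (k + int j) \<le> f k" for k j
  proof (induction j)
    case (Suc j)
    then show ?case using anti[of "k + int j"] by (simp add: algebra_simps)
  qed simp
  have small: "finite {m. e \<le> \<bar>f m\<bar>}" if "e > 0" for e
    using tendstoD[OF lim that] by (simp add: eventually_cofinite not_less)
  show ?thesis
  proof (rule ccontr)
    assume "f n \<noteq> 0"
    then consider "f n > 0" | "f n < 0" by linarith
    then show False
    proof cases
      case 1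
      have "m \<in> {m. f n \<le> \<bar>f m\<bar>}" if "m \<le> n" for m
        using le[of m "nat (n - m)"] that by simp
      then have "{..n} \<subseteq> {m. f n \<le> \<bar>f m\<bar>}" by auto
      then show False using small[OF 1] infinite_Iic by (meson finite_subset)
    next
      case 2
      have "m \<in> {m. - f n \<le> \<bar>f m\<bar>}" if "n \<le> m" for m
        using le[of n "nat (m - n)"] that by simp
      then have "{n..} \<subseteq> {m. - f n \<le> \<bar>f m\<bar>}" by auto
      then show False using small[of "- f n"] 2 infinite_Ici by (meson finite_subset neg_0_less_iff_less)
    qed
  qed
qed

lemma convex_vanishing_imp_zero:
  fixes f :: "int \<Rightarrow> real"
  assumes conv: "\<And>n. 2 * f n \<le> f (n + 1) + f (n - 1)" and lim: "(f \<longlongrightarrow> 0) cofinite"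
  shows "f n = 0"
proof -
  have "((\<lambda>n. f n - f (n + 1)) \<longlongrightarrow> 0 - 0) cofinite"
    by (intro tendsto_diff lim tendsto_cofinite_shift)
  then have "f n - f (n + 1) = 0" for n
    using conv[of "n + 1" for n] by (intro antitone_vanishing_imp_zero) (auto simp: algebra_simps)
  then show ?thesis by (intro antitone_vanishing_imp_zero lim) (auto simp: eq_iff)
qed

text \<open>A discrete Gronwall argument: a null sequence whose increments are controlled by a summable
  multiple of its size is eventually zero.  For if it attains a positive maximum over a late tail,
  it can lose at most half of this value afterwards.\<close>

lemma summable_increments_vanish:
  fixes e r :: "nat \<Rightarrow> real"
  assumes e: "\<And>k. 0 \<le> e k" and lim: "e \<longlonglongrightarrow> 0" and r: "\<And>k. 0 \<le> r k" "summable r"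
    and step: "\<And>k. k \<ge> K \<Longrightarrow> \<bar>e (Suc k) - e k\<bar> \<le> r k * (e (Suc k) + e k)"
  shows "\<exists>N. \<forall>k\<ge>N. e k = 0"
proof -
  obtain N where N: "\<And>m n. m \<ge> N \<Longrightarrow> norm (sum r {m..<n}) < 1/4"
    using r(2)[unfolded summable_Cauchy, rule_format, of "1/4"] by auto
  have "e k0 = 0" if k0: "k0 \<ge> max N K" for k0
  proof (rule ccontr)
    assume "e k0 \<noteq> 0"
    then have pos: "e k0 > 0" using e[of k0] by linarith
    obtain N' where N': "\<And>k. k \<ge> N' \<Longrightarrow> norm (e k - 0) < e k0"
      using LIMSEQ_D[OF lim pos] by blast
    have "k \<le> N'" if "e k0 \<le> e k" for k using N'[of k] that by (cases "k \<le> N'") auto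
    then have "{k. k0 \<le> k \<and> e k0 \<le> e k} \<subseteq> {..N'}" by auto
    then have fin: "finite {k. k0 \<le> k \<and> e k0 \<le> e k}" by (rule finite_subset) simp
    define S where "S = {k. k0 \<le> k \<and> e k0 \<le> e k}"
    have S: "finite S" "k0 \<in> S" using fin by (auto simp: S_def)
    have "Max (e ` S) \<in> e ` S" by (rule Max_in) (use S in auto)
    then obtain ks where ks: "ks \<in> S" "e ks = Max (e ` S)" by auto
    have max: "e k \<le> e ks" if "k0 \<le> k" for k
    proof (cases "e k0 \<le> e k")
      case True
      then show ?thesis using that S(1) unfolding ks(2) by (intro Max_ge) (auto simp: S_def)
    next
      case False
      then show ?thesis using ks(1) by (simp add: S_def)
    qed
    note ks = ks(1)[unfolded S_def mem_Collect_eq, THEN conjunct1]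
      ks(1)[unfolded S_def mem_Collect_eq, THEN conjunct2] max
    have fall: "e ks - e (ks + j) \<le> 2 * e ks * sum r {ks..<ks + j}" for j
    proof (induction j)
      case (Suc j)
      have "e (ks + j) - e (ks + Suc j) \<le> r (ks + j) * (e (Suc (ks + j)) + e (ks + j))"
        using step[of "ks + j"] ks(1) k0 by auto
      also have "\<dots> \<le> r (ks + j) * (2 * e ks)"
        using ks(3)[of "Suc (ks + j)"] ks(3)[of "ks + j"] ks(1) r(1)
        by (intro mult_left_mono) auto
      finally have s: "e (ks + j) - e (ks + Suc j) \<le> 2 * e ks * r (ks + j)" by (simp add: mult.commute)
      have "sum r {ks..<ks + Suc j} = sum r {ks..<ks + j} + r (ks + j)" by simp
      then have "2 * e ks * sum r {ks..<ks + Suc j}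
          = 2 * e ks * sum r {ks..<ks + j} + 2 * e ks * r (ks + j)"
        by (simp only: distrib_left)
      then show ?case using Suc s by linarith
    qed simp
    have half: "e ks / 2 \<le> e (ks + j)" for j
    proof -
      have "norm (sum r {ks..<ks + j}) < 1/4" by (rule N) (use ks(1) k0 in simp)
      then have "sum r {ks..<ks + j} \<le> 1/4" unfolding real_norm_def by linarith
      then have "2 * e ks * sum r {ks..<ks + j} \<le> 2 * e ks * (1/4)"
        by (rule mult_left_mono) (simp add: e)
      then show ?thesis using fall[of j] by linarith
    qed
    have "e ks / 2 > 0" using ks(2) pos by linarith
    then obtain N2 where "\<And>k. k \<ge> N2 \<Longrightarrow> norm (e k - 0) < e ks / 2"
      using LIMSEQ_D[OF lim] by blast
    from this[of "ks + N2"] half[of N2] show False using e[of "ks + N2"] by simp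
  qed
  then show ?thesis by blast
qed

text \<open>The symmetric form of the eigenvalue equation.  For \<open>\<bar>\<lambda>\<bar> \<ge> 2\<close> the moduli of a solution form a
  convex sequence; for \<open>\<bar>\<lambda>\<bar> < 2\<close> the quadratic form conserved by the unperturbed recurrence
  \<open>\<rho> = 1\<close> changes by a summable relative amount.\<close>

lemma symmetric_recurrence_zero:
  fixes \<rho> :: "int \<Rightarrow> real" and y :: "int \<Rightarrow> complex" and lam :: real
  assumes \<rho>: "\<And>n. 0 < \<rho> n" "\<And>n. \<rho> n \<le> 1" "summable (\<lambda>k. 1 - \<rho> (int k))"
    and y: "(y \<longlongrightarrow> 0) cofinite"
    and rec: "\<And>n. y (n + 1) + y (n - 1) = of_real (lam / \<rho> n) * y n"
  shows "y n = 0"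
proof (cases "\<bar>lam\<bar> \<ge> 2")
  case True
  have "2 * cmod (y n) \<le> cmod (y (n + 1)) + cmod (y (n - 1))" for n
  proof -
    have "2 * \<rho> n \<le> \<bar>lam\<bar>" using True \<rho>(2)[of n] by linarith
    then have "2 \<le> \<bar>lam / \<rho> n\<bar>" using \<rho>(1)[of n] by (simp add: abs_divide pos_le_divide_eq)
    then have "2 * cmod (y n) \<le> \<bar>lam / \<rho> n\<bar> * cmod (y n)" by (rule mult_right_mono) simp
    also have "\<dots> = cmod (y (n + 1) + y (n - 1))"
      unfolding rec norm_mult norm_of_real ..
    also have "\<dots> \<le> cmod (y (n + 1)) + cmod (y (n - 1))" by (rule norm_triangle_ineq)
    finally show ?thesis .
  qed
  then have "cmod (y n) = 0"
    by (rule convex_vanishing_imp_zero) (use y tendsto_norm_zero in blast)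
  then show ?thesis by simp
next
  case False
  define c where "c = 1 - \<bar>lam\<bar> / 2"
  have c: "c > 0" using False by (simp add: c_def)
  define E where "E n = (cmod (y n))\<^sup>2 + (cmod (y (n + 1)))\<^sup>2 - lam * inner (y n) (y (n + 1))" for n
  have lower: "c * ((cmod (y n))\<^sup>2 + (cmod (y (n + 1)))\<^sup>2) \<le> E n" for n
  proof -
    have "\<bar>lam * inner (y n) (y (n + 1))\<bar> \<le> \<bar>lam\<bar> * (cmod (y n) * cmod (y (n + 1)))"
      unfolding abs_mult by (intro mult_left_mono Cauchy_Schwarz_ineq2) simp
    also have "\<dots> \<le> \<bar>lam\<bar> * (((cmod (y n))\<^sup>2 + (cmod (y (n + 1)))\<^sup>2) / 2)"
      using sum_squares_bound[of "cmod (y n)" "cmod (y (n + 1))"] by (intro mult_left_mono) auto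
    finally show ?thesis unfolding E_def c_def by (simp add: algebra_simps abs_le_iff)
  qed
  have E0: "0 \<le> E n" for n
    by (rule order_trans[OF _ lower]) (use c in simp)
  define q where "q n = 1 / \<rho> n - 1" for n
  have q0: "0 \<le> q n" for n using \<rho>(1,2)[of n] by (simp add: q_def)
  have step: "\<bar>E (n + 1) - E n\<bar> \<le> q (n + 1) / c * (E (n + 1) + E n)" for n
  proof -
    define f where "f = of_real lam * y (n + 1)"
    have yn: "y (n + 2) + y n - f = of_real (lam * q (n + 1)) * y (n + 1)"
      using rec[of "n + 1"] by (simp add: f_def q_def algebra_simps)
    have "E (n + 1) - E n = inner (y (n + 2) - y n) (y (n + 2) + y n - f)"
      by (simp add: E_def f_def power2_norm_eq_inner inner_diff_left inner_diff_right inner_add_right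
          inner_commute inner_mult_right algebra_simps)
    also have "\<bar>\<dots>\<bar> \<le> cmod (y (n + 2) - y n) * cmod (y (n + 2) + y n - f)"
      by (rule Cauchy_Schwarz_ineq2)
    also have "\<dots> = \<bar>lam\<bar> * (q (n + 1) * (cmod (y (n + 2) - y n) * cmod (y (n + 1))))"
      unfolding yn norm_mult norm_of_real abs_mult using q0 by simp
    also have "\<dots> \<le> 2 * (q (n + 1) * ((cmod (y (n + 2)) + cmod (y n)) * cmod (y (n + 1))))"
      using False q0 by (intro mult_mono mult_left_mono mult_right_mono norm_triangle_ineq4)
        (auto intro!: mult_nonneg_nonneg)
    also have "\<dots> = q (n + 1) * (2 * cmod (y (n + 2)) * cmod (y (n + 1)) + 2 * cmod (y n) * cmod (y (n + 1)))"
      by (simp add: algebra_simps)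
    also have "\<dots> \<le> q (n + 1) * (((cmod (y (n + 1)))\<^sup>2 + (cmod (y (n + 2)))\<^sup>2)
        + ((cmod (y n))\<^sup>2 + (cmod (y (n + 1)))\<^sup>2))"
      using sum_squares_bound[of "cmod (y (n + 2))" "cmod (y (n + 1))"]
        sum_squares_bound[of "cmod (y n)" "cmod (y (n + 1))"] q0
      by (intro mult_left_mono) auto
    also have "\<dots> \<le> q (n + 1) * (E (n + 1) / c + E n / c)"
      using lower[of n] lower[of "n + 1"] c q0
      by (intro mult_left_mono add_mono) (auto simp: pos_le_divide_eq mult.commute algebra_simps)
    finally show ?thesis by (simp add: add_divide_distrib[symmetric])
  qed
  have ylim: "(\<lambda>k. y (int k + j)) \<longlonglongrightarrow> 0" for j
  proof -
    have "filterlim int cofinite cofinite"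
      unfolding filterlim_iff eventually_cofinite
      by (auto intro: finite_imageD[where f = int] inj_onI elim: rev_finite_subset)
    then show ?thesis
      using filterlim_compose[OF tendsto_cofinite_shift[OF y]] by (simp add: cofinite_eq_sequentially)
  qed
  have Elim: "(\<lambda>k. E (int k)) \<longlonglongrightarrow> 0"
  proof -
    have "(\<lambda>k. E (int k)) \<longlonglongrightarrow> (cmod 0)\<^sup>2 + (cmod 0)\<^sup>2 - lam * inner 0 (0 :: complex)"
      unfolding E_def using ylim[of 0] ylim[of 1] by (intro tendsto_intros) auto
    then show ?thesis by simp
  qed
  define r where "r k = 2 / c * (1 - \<rho> (int (Suc k)))" for k
  have r: "summable r" "\<And>k. 0 \<le> r k"
  proof -
    show "summable r"
      unfolding r_def using \<rho>(3) by (intro summable_mult) (subst summable_Suc_iff)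
    show "0 \<le> r k" for k unfolding r_def using \<rho>(2) c by simp
  qed
  have "(\<lambda>k. 1 - \<rho> (int (Suc k))) \<longlonglongrightarrow> 0"
    using summable_LIMSEQ_zero[OF \<rho>(3)] by (rule LIMSEQ_Suc)
  then obtain K where K: "\<And>k. k \<ge> K \<Longrightarrow> norm (1 - \<rho> (int (Suc k)) - 0) < 1/2"
    using LIMSEQ_D[of _ 0 "1/2"] half_gt_zero_iff zero_less_one by metis
  have "\<bar>E (int (Suc k)) - E (int k)\<bar> \<le> r k * (E (int (Suc k)) + E (int k))" if "k \<ge> K" for k
  proof -
    have half: "1/2 \<le> \<rho> (int (Suc k))" using K[OF that] unfolding diff_0_right real_norm_def by linarith
    have "q (int (Suc k)) \<le> 2 * (1 - \<rho> (int (Suc k)))"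
    proof -
      have "q (int (Suc k)) = (1 - \<rho> (int (Suc k))) / \<rho> (int (Suc k))"
        using \<rho>(1)[of "int (Suc k)"] by (simp add: q_def diff_divide_distrib)
      also have "\<dots> \<le> (1 - \<rho> (int (Suc k))) / (1/2)"
        using half \<rho>(2) by (intro divide_left_mono) auto
      finally show ?thesis by simp
    qed
    then have "q (int (Suc k)) / c \<le> r k" using c by (simp add: r_def divide_right_mono)
    then have "q (int (Suc k)) / c * (E (int (Suc k)) + E (int k)) \<le> r k * (E (int (Suc k)) + E (int k))"
      using E0 by (intro mult_right_mono add_nonneg_nonneg)
    then show ?thesis using step[of "int k"] by (simp add: add.commute)
  qed
  then obtain N where N: "\<And>k. k \<ge> N \<Longrightarrow> E (int k) = 0"
    using summable_increments_vanish[of "\<lambda>k. E (int k)" r K] E0 Elim r by blast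
  have right: "y (int k) = 0" if "k \<ge> N" for k
  proof -
    have "c * ((cmod (y (int k)))\<^sup>2 + (cmod (y (int k + 1)))\<^sup>2) \<le> 0"
      using lower[of "int k"] N[OF that] by simp
    then show ?thesis using c by (simp add: mult_le_0_iff sum_power2_le_zero_iff)
  qed
  have "y (int N - int j) = 0 \<and> y (int N + 1 - int j) = 0" for j
  proof (induction j)
    case 0
    then show ?case using right[of N] right[of "Suc N"] by (simp add: add.commute)
  next
    case (Suc j)
    then show ?case using rec[of "int N - int j"] by (simp add: algebra_simps)
  qed
  then have left: "y m = 0" if "m \<le> int N" for m
    using that by (metis diff_diff_eq2 add_diff_cancel_left' zle_iff_zadd)
  show ?thesis using left[of n] right[of "nat n"] by (cases "n \<le> int N") auto
qed

text \<open>Pairing the eigenvalue equation with \<open>\<rho> v\<close> shows, by telescoping, that \<open>z\<close> is imaginary; the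
  substitution \<open>\<rho>\<^sub>n v\<^sub>n = i\<^sup>n y\<^sub>n\<close> then gives the symmetric recurrence.\<close>

lemma eigenvector_zero:
  fixes \<rho> :: "int \<Rightarrow> real" and v :: "int \<Rightarrow> complex" and b :: real
  assumes b: "b \<noteq> 0"
    and \<rho>: "\<And>n. 0 < \<rho> n" "\<And>n. \<rho> n \<le> 1" "summable (\<lambda>k. 1 - \<rho> (int k))"
    and v: "(v \<longlongrightarrow> 0) cofinite"
    and eq: "\<And>n. of_real b * (of_real (\<rho> (n - 1)) * v (n - 1) - of_real (\<rho> (n + 1)) * v (n + 1)) = z * v n"
  shows "v n = 0"
proof -
  define w where "w n = of_real (\<rho> n) * v n" for n
  have w: "(w \<longlongrightarrow> 0) cofinite"
  proof (rule Lim_null_comparison)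
    have "norm (w n) \<le> norm (v n)" for n
      using mult_right_mono[of "\<rho> n" 1 "cmod (v n)"] \<rho>(1,2)[of n] by (simp add: w_def norm_mult)
    then show "\<forall>\<^sub>F n in cofinite. norm (w n) \<le> norm (v n)" by simp
    show "((\<lambda>n. norm (v n)) \<longlongrightarrow> 0) cofinite" using v by (rule tendsto_norm_zero)
  qed
  have eq': "of_real b * (w (n - 1) - w (n + 1)) = z * v n" for n using eq by (simp add: w_def)
  show ?thesis
  proof (cases "Re z = 0")
    case False
    define t where "t n = b / Re z * inner (w (n - 1)) (w n)" for n
    have t: "t n - t (n + 1) = \<rho> n * (cmod (v n))\<^sup>2" for n
    proof -
      have "inner (z * v n) (v n) = Re z * (cmod (v n))\<^sup>2"
        unfolding inner_complex_def cmod_power2 by (simp add: power2_eq_square algebra_simps)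
      then have "\<rho> n * (Re z * (cmod (v n))\<^sup>2) = inner (z * v n) (w n)"
        by (simp add: w_def inner_mult_right)
      also have "\<dots> = b * (inner (w (n - 1)) (w n) - inner (w (n + 1)) (w n))"
        unfolding eq'[symmetric] by (simp add: inner_mult_left inner_diff_left)
      finally show ?thesis
        using False by (simp add: t_def inner_commute[of "w n"] field_simps)
    qed
    have "t n = 0" for n
    proof (rule antitone_vanishing_imp_zero)
      fix n
      have "0 \<le> \<rho> n * (cmod (v n))\<^sup>2" using \<rho>(1)[of n] by simp
      then show "t (n + 1) \<le> t n" using t[of n] by linarith
    next
      have "((\<lambda>n. b / Re z * inner (w (n + (- 1))) (w n)) \<longlongrightarrow> b / Re z * inner 0 (0 :: complex)) cofinite"
        by (intro tendsto_intros w tendsto_cofinite_shift[OF w])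
      then show "(t \<longlongrightarrow> 0) cofinite" by (simp add: t_def[abs_def])
    qed
    then have "\<rho> n * (cmod (v n))\<^sup>2 = 0" using t[of n] by simp
    then show ?thesis using \<rho>(1)[of n] by simp
  next
    case True
    define y where "y n = w n * (- \<i>) powi n" for n
    define lam where "lam = - Im z / b"
    have z: "\<i> * z = of_real (b * lam)" using True b by (simp add: lam_def complex_eq_iff)
    have "y n = 0"
    proof (rule symmetric_recurrence_zero[OF \<rho>])
      have "norm (y n) = norm (w n)" for n by (simp add: y_def norm_mult norm_power_int)
      then show "(y \<longlongrightarrow> 0) cofinite"
        using w by (subst tendsto_norm_zero_iff[symmetric], simp add: tendsto_norm_zero_iff)
      fix n
      have "(- \<i>) powi (n + 1) = - (\<i> * (- \<i>) powi n)" "(- \<i>) powi (n - 1) = \<i> * (- \<i>) powi n"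
        by (simp_all add: power_int_add power_int_diff)
      then have "y (n + 1) + y (n - 1) = \<i> * (- \<i>) powi n * (w (n - 1) - w (n + 1))"
        by (simp add: y_def algebra_simps)
      then have "of_real b * (y (n + 1) + y (n - 1))
          = \<i> * (- \<i>) powi n * (of_real b * (w (n - 1) - w (n + 1)))" by (simp only: mult_ac)
      also have "\<dots> = (\<i> * z) * (v n * (- \<i>) powi n)" unfolding eq' by (simp add: algebra_simps)
      also have "v n = w n / of_real (\<rho> n)" using \<rho>(1)[of n] by (simp add: w_def)
      finally have "of_real b * (y (n + 1) + y (n - 1)) = of_real b * (of_real (lam / \<rho> n) * y n)"
        unfolding z by (simp add: y_def algebra_simps)
      then show "y (n + 1) + y (n - 1) = of_real (lam / \<rho> n) * y n"
        using b by (simp only: mult_cancel_left of_real_eq_0_iff) blast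
    qed
    then have "w n = 0" by (simp add: y_def)
    then show ?thesis using \<rho>(1)[of n] by (simp add: w_def)
  qed
qed

lemma subspace_closure:
  fixes S :: "'a :: real_normed_vector set"
  assumes "subspace S"
  shows "subspace (closure S)"
  unfolding subspace_def
proof (intro conjI ballI allI)
  show "0 \<in> closure S" using assms closure_subset subspace_0 by blast
next
  fix x y assume "x \<in> closure S" "y \<in> closure S"
  then obtain f g where "\<And>n. f n \<in> S" "f \<longlonglongrightarrow> x" "\<And>n. g n \<in> S" "g \<longlonglongrightarrow> y"
    unfolding closure_sequential by blast
  then have "\<And>n. f n + g n \<in> S" "(\<lambda>n. f n + g n) \<longlonglongrightarrow> x + y"
    using assms by (auto intro: subspace_add tendsto_add)
  then show "x + y \<in> closure S"
    unfolding closure_sequential by (intro exI[of _ "\<lambda>n. f n + g n"]) simp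
next
  fix c :: real and x assume "x \<in> closure S"
  then obtain f where "\<And>n. f n \<in> S" "f \<longlonglongrightarrow> x" unfolding closure_sequential by blast
  then have "\<And>n. c *\<^sub>R f n \<in> S" "(\<lambda>n. c *\<^sub>R f n) \<longlonglongrightarrow> c *\<^sub>R x"
    using assms by (auto intro: subspace_scale tendsto_scaleR)
  then show "c *\<^sub>R x \<in> closure S"
    unfolding closure_sequential by (intro exI[of _ "\<lambda>n. c *\<^sub>R f n"]) simp
qed

text \<open>For \<open>\<alpha> = \<beta>\<close> and imaginary \<open>z\<close>, a vector \<open>g\<close> orthogonal to the range satisfies
  \<open>z g = b \<alpha> (S - S\<^sup>-\<^sup>1) g\<close>.  If \<open>z \<noteq> 0\<close>, then \<open>(S - S\<^sup>-\<^sup>1) g\<close> is an eigenvector for \<open>z\<close>; if \<open>z = 0\<close>,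
  injectivity excludes zeros of \<open>\<alpha>\<close>, so that \<open>g\<close> has period 2 and vanishes.\<close>

lemma (in limit_shift) dense_range:
  assumes \<beta>: "\<beta> = \<alpha>" and z: "Re z = 0" and inj: "\<And>v. A z v = 0 \<Longrightarrow> v = 0"
  shows "closure (range (A z)) = UNIV"
proof (rule ccontr)
  assume ne: "closure (range (A z)) \<noteq> UNIV"
  interpret A: bounded_linear "A z" by (rule bounded_linear_A)
  have "subspace (closure (range (A z)))"
    by (intro subspace_closure linear_subspace_image A.linear_axioms subspace_UNIV)
  then obtain g where g: "g \<noteq> 0" "\<And>y. y \<in> closure (range (A z)) \<Longrightarrow> inner y g = 0"
    using exists_orthogonal_to_closed_subspace[of "closure (range (A z))"] ne by auto
  have orth: "inner (A z v) g = 0" for v by (rule g(2), rule subsetD[OF closure_subset]) simp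
  define G where "G = coord g"
  have coordA: "coord (A z v) n = of_real b * (of_real (\<alpha> (n - 1)) * coord v (n - 1)
      - of_real (\<alpha> (n + 1)) * coord v (n + 1)) - z * coord v n" for v n
    by (simp add: A_def coord_M fun_cong[OF \<beta>])
  have key: "z * G n = of_real b * of_real (\<alpha> n) * (G (n - 1) - G (n + 1))" for n
  proof -
    define X where "X = of_real (b * \<alpha> n) * (G (n + 1) - G (n - 1)) - cnj z * G n"
    have "A z (unit n c) = unit (n + 1) (of_real (b * \<alpha> n) * c) - unit (n - 1) (of_real (b * \<alpha> n) * c) - unit n (z * c)" for c
      by (rule ell2_eqI) (auto simp: coordA)
    then have "inner (A z (unit n c)) g = inner (of_real (b * \<alpha> n) * c) (G (n + 1))
        - inner (of_real (b * \<alpha> n) * c) (G (n - 1)) - inner (z * c) (G n)" for c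
      by (simp add: inner_diff_left inner_unit G_def)
    also have "\<dots> c = inner c X" for c
    proof -
      have "inner (of_real r * c) u = inner c (of_real r * u)" for r u
        by (simp only: inner_mult_left inner_mult_right)
      moreover have "inner (z * c) u = inner c (cnj z * u)" for u
        by (simp add: inner_complex_def algebra_simps)
      ultimately show ?thesis by (simp only: X_def right_diff_distrib inner_diff_right)
    qed
    finally have "inner X X = 0" using orth by metis
    then have "X = 0" by simp
    moreover have "cnj z = - z" using z by (simp add: complex_eq_iff)
    ultimately show ?thesis by (simp add: X_def algebra_simps)
  qed
  show False
  proof (cases "z = 0")
    case True
    have "\<alpha> n \<noteq> 0" for n
    proof
      assume "\<alpha> n = 0"
      then have "A z (unit n 1) = 0"
        by (intro ell2_eqI, unfold coordA) (auto simp: True)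
      then have "coord (unit n 1) n = 0" using inj by (metis zero_ell2.rep_eq)
      then show False by simp
    qed
    then have per: "G (n + 1) = G (n - 1)" for n using key[of n] True b by simp
    have per': "G (n + 2 * int k) = G n" for n k
    proof (induction k)
      case (Suc k)
      then show ?case using per[of "n + 2 * int k + 1"] by (simp add: algebra_simps)
    qed simp
    have "G n = 0" for n
    proof (rule ccontr)
      assume "G n \<noteq> 0"
      then have "finite {m. \<not> dist (G m) 0 < cmod (G n)}"
        using tendstoD[OF coord_tendsto_0[of g], of "cmod (G n)"] by (simp add: eventually_cofinite G_def)
      moreover have "range (\<lambda>k. n + 2 * int k) \<subseteq> {m. \<not> dist (G m) 0 < cmod (G n)}"
        using per'[of n] by auto
      ultimately have "finite (range (\<lambda>k. n + 2 * int k))" by (rule rev_finite_subset)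
      moreover have "inj (\<lambda>k. n + 2 * int k)" by (auto simp: inj_def)
      ultimately show False using finite_imageD infinite_UNIV_nat by blast
    qed
    then show False using g(1) by (auto simp: G_def intro: ell2_eqI)
  next
    case False
    define w where "w = scaleC (of_real b / z) (shift 1 g - shift (- 1) g)"
    have w: "coord w n = of_real b / z * (G (n - 1) - G (n + 1))" for n
      by (simp add: w_def G_def)
    have aw: "of_real (\<alpha> n) * coord w n = G n" for n
      using key[of n] False by (simp add: w field_simps)
    have "A z w = 0"
    proof (rule ell2_eqI)
      fix n
      have "coord (A z w) n = of_real b * (G (n - 1) - G (n + 1)) - z * coord w n"
        by (simp add: coordA aw)
      then show "coord (A z w) n = coord 0 n" using False by (simp add: w)
    qed
    then have "w = 0" by (rule inj)
    then have "G n = 0" for n using aw[of n] by simp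
    then show False using g(1) by (auto simp: G_def intro: ell2_eqI)
  qed
qed

context limit_shift
begin

lemma A_eq_0_iff: "A z v = 0 \<longleftrightarrow> (\<forall>n. of_real b * (of_real (\<alpha> (n - 1)) * coord v (n - 1)
    - of_real (\<beta> (n + 1)) * coord v (n + 1)) = z * coord v n)"
proof -
  have "A z v = 0 \<longleftrightarrow> (\<forall>n. coord (A z v) n = 0)"
    by (metis ell2_eqI zero_ell2.rep_eq)
  then show ?thesis by (simp add: A_def coord_M)
qed

text \<open>The conjugate of an eigenvector for \<open>z\<close> is one for \<open>cnj z\<close>, since the coefficients are real;
  alternating its signs reverses the sign of the eigenvalue.\<close>

lemma eigenvalue_symmetric:
  assumes "A z v = 0" "v \<noteq> 0"
  shows "\<exists>u. u \<noteq> 0 \<and> A (cnj z) u = 0" "\<exists>u. u \<noteq> 0 \<and> A (- cnj z) u = 0"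
proof -
  define f where "f n = cnj (coord v n)" for n
  define sg :: "int \<Rightarrow> complex" where "sg n = (- 1) powi n" for n
  have sg: "sg (n - 1) = - sg n" "sg (n + 1) = - sg n" "cmod (sg n) = 1" "sg n \<noteq> 0" for n
    by (auto simp: sg_def power_int_add power_int_diff norm_power_int)
  have s: "(\<lambda>n. (cmod (f n))\<^sup>2) summable_on UNIV" "(\<lambda>n. (cmod (sg n * f n))\<^sup>2) summable_on UNIV"
    using coord_summable[of v] by (simp_all add: f_def norm_mult sg)
  have eq: "of_real b * (of_real (\<alpha> (n - 1)) * f (n - 1) - of_real (\<beta> (n + 1)) * f (n + 1)) = cnj z * f n" for n
    using assms(1)[unfolded A_eq_0_iff, rule_format, of n, THEN arg_cong[where f = cnj]]
    by (simp add: f_def)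
  obtain n where n: "coord v n \<noteq> 0" using assms(2) by (metis ell2_eqI zero_ell2.rep_eq)
  have "Abs_ell2 f \<noteq> 0"
    using n coord_Abs_ell2[OF s(1)] by (metis complex_cnj_zero_iff f_def zero_ell2.rep_eq)
  moreover have "A (cnj z) (Abs_ell2 f) = 0"
    unfolding A_eq_0_iff coord_Abs_ell2[OF s(1)] using eq by blast
  ultimately show "\<exists>u. u \<noteq> 0 \<and> A (cnj z) u = 0" by blast
  have "Abs_ell2 (\<lambda>n. sg n * f n) \<noteq> 0"
  proof
    assume "Abs_ell2 (\<lambda>n. sg n * f n) = 0"
    then have "sg n * f n = 0" using fun_cong[OF coord_Abs_ell2[OF s(2)], of n] by simp
    then show False using n sg(4)[of n] by (simp add: f_def)
  qed
  moreover have "A (- cnj z) (Abs_ell2 (\<lambda>n. sg n * f n)) = 0"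
    unfolding A_eq_0_iff coord_Abs_ell2[OF s(2)]
  proof
    fix n
    have "of_real b * (of_real (\<alpha> (n - 1)) * (sg (n - 1) * f (n - 1)) - of_real (\<beta> (n + 1)) * (sg (n + 1) * f (n + 1)))
      = - sg n * (of_real b * (of_real (\<alpha> (n - 1)) * f (n - 1) - of_real (\<beta> (n + 1)) * f (n + 1)))"
      unfolding sg by (simp add: algebra_simps)
    also have "\<dots> = - cnj z * (sg n * f n)" unfolding eq by simp
    finally show "of_real b * (of_real (\<alpha> (n - 1)) * (sg (n - 1) * f (n - 1)) - of_real (\<beta> (n + 1)) * (sg (n + 1) * f (n + 1)))
      = - cnj z * (sg n * f n)" .
  qed
  ultimately show "\<exists>u. u \<noteq> 0 \<and> A (- cnj z) u = 0" by blast
qed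

end

section \<open>Transfer along an isometry\<close>

lemma Metric_space_pullback:
  fixes U :: "'a \<Rightarrow> 'b :: metric_space"
  assumes "inj_on U X" "\<And>x y. x \<in> X \<Longrightarrow> y \<in> X \<Longrightarrow> d x y = dist (U x) (U y)"
    "\<And>x y. 0 \<le> d x y" "\<And>x y. d x y = d y x"
  shows "Metric_space X d"
proof
  show "d x z \<le> d x y + d y z" if "x \<in> X" "y \<in> X" "z \<in> X" for x y z
    using that assms(2) dist_triangle by metis
  show "d x y = 0 \<longleftrightarrow> x = y" if "x \<in> X" "y \<in> X" for x y
    using that assms(1,2) by (auto simp: inj_on_eq_iff)
qed (use assms in auto)

text \<open>An operator \<open>T\<close> on a carrier \<open>X\<close> that corresponds, under a linear isometry \<open>J\<close> from the
  Hilbert space of square summable families onto \<open>X\<close>, to the operator \<open>M\<close>.\<close>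

locale ell2_model =
  fixes X :: "('k \<Rightarrow> complex) set" and N :: "('k \<Rightarrow> complex) \<Rightarrow> real"
    and T :: "('k \<Rightarrow> complex) \<Rightarrow> 'k \<Rightarrow> complex"
    and J :: "'i ell2 \<Rightarrow> 'k \<Rightarrow> complex" and M :: "'i ell2 \<Rightarrow> 'i ell2"
  assumes bij: "bij_betw J UNIV X"
    and diff: "\<And>u v. J (u - v) = J u - J v" and scale: "\<And>c v. J (scaleC c v) = cscale c (J v)"
    and norm: "\<And>v. N (J v) = norm v" and N_nonneg: "\<And>u. 0 \<le> N u" and N_sym: "\<And>u v. N (u - v) = N (v - u)"
    and T: "\<And>v. T (J v) = J (M v)"
begin

definition A :: "complex \<Rightarrow> 'i ell2 \<Rightarrow> 'i ell2" where "A z v = M v - scaleC z v"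

lemma shifted_J: "shifted T z (J v) = J (A z v)"
  by (simp add: shifted_def T A_def diff scale)

lemma J_inj: "J u = J v \<longleftrightarrow> u = v"
  using bij by (metis UNIV_I bij_betw_def inj_on_eq_iff)

lemma X_eq: "X = range J" using bij by (simp add: bij_betw_def)

lemma J_0: "J 0 = 0" using diff[of 0 0] by simp

lemma J_add: "J (u + v) = J u + J v"
  using diff[of "u + v" v] by (simp add: algebra_simps)

lemma image_shifted: "shifted T z ` X = J ` range (A z)"
  unfolding X_eq image_image shifted_J ..

sublocale X: Metric_space X "\<lambda>u v. N (u - v)"
proof (rule Metric_space_pullback[of "inv J"])
  show "inj_on (inv J) X" by (auto simp: X_eq intro: inj_on_inv_into)
  fix x y assume "x \<in> X" "y \<in> X"
  then obtain u v where "x = J u" "y = J v" by (auto simp: X_eq)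
  moreover have "inv J (J w) = w" for w by (rule inv_f_f) (simp add: inj_def J_inj)
  ultimately show "N (x - y) = dist (inv J x) (inv J y)"
    by (simp add: diff[symmetric] norm dist_norm)
qed (auto simp: N_nonneg N_sym)

lemma closedin_J: "closedin (norm_topology X N) (J ` S) \<longleftrightarrow> closed S"
proof -
  have lim: "limitin X.mtopology (\<lambda>n. J (f n)) (J l) sequentially \<longleftrightarrow> f \<longlonglongrightarrow> l" for f l
    unfolding X.limitin_metric_dist_null
    by (simp add: X_eq diff[symmetric] norm tendsto_norm_zero_iff LIM_zero_iff)
  have "closedin (norm_topology X N) (J ` S) \<longleftrightarrow>
      (\<forall>\<sigma> l. range \<sigma> \<subseteq> J ` S \<and> limitin X.mtopology \<sigma> l sequentially \<longrightarrow> l \<in> J ` S)"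
    unfolding norm_topology_def X.metric_closedin_iff_sequentially_closed by (auto simp: X_eq)
  also have "\<dots> \<longleftrightarrow> closed S"
  proof
    assume L: "\<forall>\<sigma> l. range \<sigma> \<subseteq> J ` S \<and> limitin X.mtopology \<sigma> l sequentially \<longrightarrow> l \<in> J ` S"
    show "closed S"
      unfolding closed_sequential_limits
    proof (intro allI impI, elim conjE)
      fix f l assume f: "\<forall>n. f n \<in> S" "f \<longlonglongrightarrow> l"
      have "J l \<in> J ` S"
        by (rule L[rule_format, of "\<lambda>n. J (f n)"]) (use f lim in auto)
      then show "l \<in> S" by (auto simp: J_inj)
    qed
  next
    assume S: "closed S"
    show "\<forall>\<sigma> l. range \<sigma> \<subseteq> J ` S \<and> limitin X.mtopology \<sigma> l sequentially \<longrightarrow> l \<in> J ` S"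
    proof (intro allI impI, elim conjE)
      fix \<sigma> l assume \<sigma>: "range \<sigma> \<subseteq> J ` S" "limitin X.mtopology \<sigma> l sequentially"
      have "\<forall>n. \<exists>x. x \<in> S \<and> \<sigma> n = J x" using \<sigma>(1) by auto
      then obtain f where f: "\<And>n. f n \<in> S" "\<And>n. \<sigma> n = J (f n)" by metis
      have "l \<in> X" using X.limitin_mspace[OF \<sigma>(2)] .
      then obtain x where x: "l = J x" by (auto simp: X_eq)
      have "\<sigma> = (\<lambda>n. J (f n))" using f(2) by auto
      then have "f \<longlonglongrightarrow> x" using \<sigma>(2) by (simp add: lim x)
      then have "x \<in> S" using S f(1) by (meson closed_sequentially)
      then show "l \<in> J ` S" by (simp add: x)
    qed
  qed
  finally show ?thesis .
qed

lemma continuous_spectrum_iff: "z \<in> continuous_spectrum X N T \<longleftrightarrow> \<not> closed (range (A z))"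
  by (simp add: continuous_spectrum_def image_shifted closedin_J)

lemma point_spectrum_iff: "z \<in> point_spectrum X T \<longleftrightarrow> (\<exists>v. v \<noteq> 0 \<and> A z v = 0)"
proof -
  have "T (J v) = cscale z (J v) \<longleftrightarrow> A z v = 0" for v
    unfolding T scale[symmetric] J_inj by (simp add: A_def)
  moreover have "J v \<noteq> 0 \<longleftrightarrow> v \<noteq> 0" for v using J_inj[of v 0] by (simp add: J_0)
  ultimately show ?thesis by (auto simp: point_spectrum_def X_eq)
qed

lemma resolvent_setI:
  assumes "bij (A z)" "\<exists>C. \<forall>v. norm v \<le> C * norm (A z v)"
  shows "z \<in> resolvent_set X N T"
proof -
  have "bij_betw (shifted T z) X X"
    unfolding bij_betw_def
  proof
    show "inj_on (shifted T z) X"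
      using assms(1) by (auto simp: inj_on_def X_eq shifted_J J_inj bij_def)
    show "shifted T z ` X = X"
      using assms(1) unfolding image_shifted by (simp add: bij_def X_eq)
  qed
  moreover obtain C where "\<And>v. norm v \<le> C * norm (A z v)" using assms(2) by blast
  then have "\<forall>u\<in>X. N u \<le> C * N (shifted T z u)" by (auto simp: X_eq shifted_J norm)
  ultimately show ?thesis by (auto simp: resolvent_set_def)
qed

lemma resolvent_set_closed_range:
  assumes "z \<in> resolvent_set X N T"
  shows "closed (range (A z))"
proof -
  have "J ` range (A z) = J ` UNIV"
    using assms unfolding resolvent_set_def bij_betw_def image_shifted by (simp add: X_eq)
  then have "range (A z) = UNIV" by (metis J_inj injI inj_image_eq_iff)
  then show ?thesis by simp
qed

lemma J_span: "v \<in> span B \<Longrightarrow> J v \<in> cseq.span (J ` B)"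
proof (induction rule: span_induct_alt)
  case (step c x y)
  have "c *\<^sub>R x = scaleC (of_real c) x" by (rule ell2_eqI) (simp add: scaleR_conv_of_real)
  then have "J (c *\<^sub>R x + y) = cscale (of_real c) (J x) + J y" by (simp add: J_add scale)
  moreover have "cscale (of_real c) (J x) + J y \<in> cseq.span (J ` B)"
    using step by (intro cseq.span_add cseq.span_scale) (auto intro: cseq.span_base)
  ultimately show ?case by (simp only:)
qed (simp only: J_0 cseq.span_zero)

lemma fredholmI:
  assumes "closed (range (A z))" "\<exists>B. finite B \<and> {v. A z v = 0} \<subseteq> span B"
    "\<exists>B. finite B \<and> (\<forall>u. \<exists>v. u - A z v \<in> span B)"
  shows "fredholm X N (shifted T z)"
  unfolding fredholm_def
proof (intro conjI)
  obtain B where B: "finite B" "{v. A z v = 0} \<subseteq> span B" using assms(2) by blast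
  have "{u \<in> X. shifted T z u = 0} \<subseteq> cseq.span (J ` B)"
  proof
    fix u assume "u \<in> {u \<in> X. shifted T z u = 0}"
    then obtain v where v: "u = J v" "J (A z v) = J 0" by (auto simp: X_eq shifted_J J_0)
    then have "v \<in> span B" using B(2) by (auto simp: J_inj)
    then show "u \<in> cseq.span (J ` B)" unfolding v(1) by (rule J_span)
  qed
  then show "\<exists>B. finite B \<and> {u \<in> X. shifted T z u = 0} \<subseteq> cseq.span B" using B(1) by blast
  show "closedin (norm_topology X N) (shifted T z ` X)"
    unfolding image_shifted closedin_J by (rule assms(1))
  obtain C where C: "finite C" "\<And>u. \<exists>v. u - A z v \<in> span C" using assms(3) by blast
  have "\<exists>v\<in>X. u - shifted T z v \<in> cseq.span (J ` C)" if "u \<in> X" for u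
  proof -
    obtain x where x: "u = J x" using \<open>u \<in> X\<close> by (auto simp: X_eq)
    obtain v where "x - A z v \<in> span C" using C(2) by blast
    then have "J (x - A z v) \<in> cseq.span (J ` C)" by (rule J_span)
    then show ?thesis by (intro bexI[of _ "J v"]) (auto simp: x shifted_J diff X_eq)
  qed
  then show "\<exists>C. finite C \<and> (\<forall>u\<in>X. \<exists>v\<in>X. u - shifted T z v \<in> cseq.span C)" using C(1) by blast
qed

lemma fredholm_closed_range: "fredholm X N (shifted T z) \<Longrightarrow> closed (range (A z))"
  by (simp add: fredholm_def image_shifted closedin_J)

lemma closure_of_range_eq:
  assumes "closure (range (A z)) = UNIV"
  shows "norm_topology X N closure_of (shifted T z ` X) = X"
proof -
  let ?C = "norm_topology X N closure_of (shifted T z ` X)"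
  have top: "topspace (norm_topology X N) = X" by (simp add: norm_topology_def)
  have sub: "?C \<subseteq> X" using closure_of_subset_topspace[of "norm_topology X N"] by (simp add: top)
  then obtain S where S: "?C = J ` S" unfolding X_eq by (meson subset_imageE)
  have "closed S" unfolding closedin_J[symmetric] S[symmetric] by (rule closedin_closure_of)
  have "shifted T z ` X \<subseteq> ?C"
    by (rule closure_of_subset, unfold top image_shifted) (auto simp: X_eq)
  then have "shifted T z ` X \<subseteq> J ` S" by (simp only: S)
  then have "range (A z) \<subseteq> S"
    unfolding image_shifted by (simp add: inj_image_subset_iff inj_def J_inj)
  then have "closure (range (A z)) \<subseteq> S" using \<open>closed S\<close> by (rule closure_minimal)
  then have "S = UNIV" using assms by auto
  then show ?thesis using S by (simp add: X_eq)
qed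

end

section \<open>Lattice geometry of a class\<close>

text \<open>Lattice points as complex numbers, so that \<open>knorm\<close> becomes the modulus.\<close>

definition kc :: "int \<times> int \<Rightarrow> complex" where
  "kc k = Complex (of_int (fst k)) (of_int (snd k))"

lemma knorm_kc: "knorm k = cmod (kc k)"
  by (simp add: knorm_def kc_def cmod_def)

lemma knorm_uminus: "knorm (- k) = knorm k"
  by (simp add: knorm_def)

lemma knorm_ge_1: "k \<noteq> 0 \<Longrightarrow> 1 \<le> knorm k"
proof -
  assume "k \<noteq> 0"
  then have "fst k \<noteq> 0 \<or> snd k \<noteq> 0" by (metis prod.collapse zero_prod_def)
  then have "1 \<le> (fst k)\<^sup>2 + (snd k)\<^sup>2"
    by (metis add_cancel_right_left add_nonneg_nonneg int_one_le_iff_zero_less sum_power2_gt_zero_iff)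
  then have "(1 :: real) \<le> of_int ((fst k)\<^sup>2 + (snd k)\<^sup>2)" by linarith
  then show ?thesis by (simp add: knorm_def)
qed

lemma euler_A_eq:
  assumes "p \<noteq> 0"
  shows "euler_A p k = - (1 / (2 * (knorm p)\<^sup>2)) * kdet p k * (1 - (knorm p)\<^sup>2 / (knorm k)\<^sup>2)"
    and "euler_A (- p) k = 1 / (2 * (knorm p)\<^sup>2) * kdet p k * (1 - (knorm p)\<^sup>2 / (knorm k)\<^sup>2)"
proof -
  have "knorm p \<noteq> 0" using knorm_ge_1[OF assms] by auto
  then have e: "1 / (knorm k)\<^sup>2 - 1 / (knorm p)\<^sup>2
      = - (1 / (knorm p)\<^sup>2) * (1 - (knorm p)\<^sup>2 / (knorm k)\<^sup>2)"
    by (simp add: right_diff_distrib)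
  have "kdet (- p) k = - kdet p k" by (simp add: kdet_def)
  then show "euler_A p k = - (1 / (2 * (knorm p)\<^sup>2)) * kdet p k * (1 - (knorm p)\<^sup>2 / (knorm k)\<^sup>2)"
    "euler_A (- p) k = 1 / (2 * (knorm p)\<^sup>2) * kdet p k * (1 - (knorm p)\<^sup>2 / (knorm k)\<^sup>2)"
    unfolding euler_A_def knorm_uminus e by simp_all
qed

text \<open>The points of the line through \<open>kh\<close> in direction \<open>p\<close>.\<close>

definition line :: "int \<times> int \<Rightarrow> int \<times> int \<Rightarrow> int \<Rightarrow> int \<times> int" where
  "line p kh n = kh + (n * fst p, n * snd p)"

lemma line_add: "line p kh n + p = line p kh (n + 1)" "line p kh n - p = line p kh (n - 1)"
  by (auto simp: line_def prod_eq_iff algebra_simps)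

lemma kc_line: "kc (line p kh n) = kc kh + of_int n * kc p"
  by (simp add: line_def kc_def complex_eq_iff)

lemma kdet_line: "kdet p (line p kh n) = kdet p kh"
  by (simp add: line_def kdet_def algebra_simps)

lemma inj_line: "p \<noteq> 0 \<Longrightarrow> inj (line p kh)"
  by (auto simp: inj_def line_def prod_eq_iff)

lemma mode_class_eq: "mode_class p kh = range (line p kh) - {0}"
  by (auto simp: mode_class_def line_def)

lemma infinite_mode_class: "p \<noteq> 0 \<Longrightarrow> infinite (mode_class p kh)"
  unfolding mode_class_eq using inj_line[of p kh]
  by (metis infinite_remove infinite_UNIV_int finite_imageD)

lemma knorm_line_ge: "\<bar>of_int n\<bar> * knorm p - knorm kh \<le> knorm (line p kh n)"
proof -
  have "norm (of_int n * kc p) \<le> norm (kc kh + of_int n * kc p) + norm (kc kh)"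
    by (metis add_diff_cancel_left' norm_triangle_ineq4)
  then show ?thesis by (simp add: knorm_kc kc_line norm_mult)
qed

lemma knorm_line_step: "\<bar>knorm (line p kh (n + 1)) - knorm (line p kh n)\<bar> \<le> knorm p"
proof -
  have "kc (line p kh (n + 1)) - kc (line p kh n) = kc p" by (simp add: kc_line algebra_simps)
  then show ?thesis unfolding knorm_kc by (metis norm_triangle_ineq3)
qed

lemma inverse_knorm_line_tendsto:
  assumes "p \<noteq> 0"
  shows "((\<lambda>n. 1 / knorm (line p kh n)) \<longlongrightarrow> 0) cofinite"
proof (rule tendstoI)
  fix e :: real assume e: "e > 0"
  define R where "R = 1 / e + knorm kh"
  have bound: "\<bar>of_int n\<bar> \<le> R" if "\<not> dist (1 / knorm (line p kh n)) 0 < e" for n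
  proof -
    have k0: "0 \<le> knorm (line p kh n)" by (simp add: knorm_def)
    then have le: "e \<le> 1 / knorm (line p kh n)" using that by simp
    then have "knorm (line p kh n) \<noteq> 0" using e by auto
    then have "knorm (line p kh n) \<le> 1 / e" using le e k0 by (simp add: field_simps)
    moreover have "\<bar>of_int n\<bar> * 1 \<le> \<bar>of_int n\<bar> * knorm p"
      by (rule mult_left_mono[OF knorm_ge_1[OF assms]]) simp
    ultimately show ?thesis using knorm_line_ge[of n p kh] by (simp add: R_def)
  qed
  have "{n. \<not> dist (1 / knorm (line p kh n)) 0 < e} \<subseteq> {- \<lceil>R\<rceil>..\<lceil>R\<rceil>}"
  proof
    fix n assume "n \<in> {n. \<not> dist (1 / knorm (line p kh n)) 0 < e}"
    then have "\<bar>of_int n\<bar> \<le> R" by (intro bound) simp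
    then show "n \<in> {- \<lceil>R\<rceil>..\<lceil>R\<rceil>}" unfolding atLeastAtMost_iff by linarith
  qed
  then show "\<forall>\<^sub>F n in cofinite. dist (1 / knorm (line p kh n)) 0 < e"
    unfolding eventually_cofinite by (rule finite_subset) simp
qed

lemma summable_inverse_knorm_line:
  assumes "p \<noteq> 0"
  shows "summable (\<lambda>n. C / (knorm (line p kh (int n)))\<^sup>2)"
proof -
  obtain N :: nat where N: "2 * knorm kh + 1 < N" using reals_Archimedean2 by blast
  have bound: "norm (1 / (knorm (line p kh (int n)))\<^sup>2) \<le> 4 * inverse (real n ^ 2)" if "n \<ge> N" for n
  proof -
    have n: "2 * knorm kh + 1 < n" using N that by linarith
    have k: "0 \<le> knorm kh" by (simp add: knorm_def)
    have "real n * 1 \<le> real n * knorm p" by (rule mult_left_mono[OF knorm_ge_1[OF assms]]) simp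
    moreover have "real n * knorm p - knorm kh \<le> knorm (line p kh (int n))"
      using knorm_line_ge[of "int n" p kh] by simp
    ultimately have "real n / 2 \<le> knorm (line p kh (int n))" using n k by linarith
    then have "(real n / 2)\<^sup>2 \<le> (knorm (line p kh (int n)))\<^sup>2" by (intro power_mono) auto
    moreover have "0 < (real n / 2)\<^sup>2" using n k by simp
    ultimately have "1 / (knorm (line p kh (int n)))\<^sup>2 \<le> 1 / (real n / 2)\<^sup>2"
      by (intro divide_left_mono mult_pos_pos) auto
    also have "1 / (real n / 2)\<^sup>2 = 4 * inverse (real n ^ 2)" by (simp add: power_divide inverse_eq_divide)
    finally show ?thesis by simp
  qed
  have "summable (\<lambda>n. 1 / (knorm (line p kh (int n)))\<^sup>2)"
    by (rule summable_comparison_test'[OF _ bound])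
      (intro summable_mult inverse_power_summable, simp)
  from summable_mult[OF this, of C] show ?thesis by simp
qed

section \<open>The Sobolev space of a class\<close>

lemma sobolev_cscale:
  "u \<in> sobolev p kh s \<Longrightarrow> cscale c u \<in> sobolev p kh s"
  "sobolev_norm p kh s (cscale c u) = cmod c * sobolev_norm p kh s u"
proof -
  have e: "knorm k ^ (2 * s) * (cmod (cscale c u k))\<^sup>2 = (cmod c)\<^sup>2 * (knorm k ^ (2 * s) * (cmod (u k))\<^sup>2)" for k
    by (simp add: cscale_def norm_mult power_mult_distrib)
  show "u \<in> sobolev p kh s \<Longrightarrow> cscale c u \<in> sobolev p kh s"
    unfolding sobolev_def mem_Collect_eq e
    by (auto simp: cscale_def intro: summable_on_cmult_right)
  show "sobolev_norm p kh s (cscale c u) = cmod c * sobolev_norm p kh s u"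
    unfolding sobolev_norm_def e by (simp add: infsum_cmult_right' real_sqrt_mult)
qed

lemma sobolev_unit:
  assumes "k \<in> mode_class p kh"
  shows "(\<lambda>l. if l = k then 1 else 0) \<in> sobolev p kh s"
proof -
  have "(\<lambda>l. knorm l ^ (2 * s) * (cmod (if l = k then 1 else 0))\<^sup>2) summable_on mode_class p kh"
    by (rule finite_nonzero_values_imp_summable_on) (auto intro: finite_subset[of _ "{k}"])
  then show ?thesis using assms by (auto simp: sobolev_def)
qed

lemma sobolev_norm_nonneg: "0 \<le> sobolev_norm p kh s u"
  unfolding sobolev_norm_def by (intro real_sqrt_ge_zero infsum_nonneg) (simp add: knorm_def)

lemma sobolev_norm_sym: "sobolev_norm p kh s (u - v) = sobolev_norm p kh s (v - u)"
  by (simp add: sobolev_norm_def norm_minus_commute)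

lemma Metric_space_sobolev:
  "Metric_space (sobolev p kh s) (\<lambda>u v. sobolev_norm p kh s (u - v))"
proof -
  define f where "f u k = of_real (knorm k ^ s) * u k" for u :: "int \<times> int \<Rightarrow> complex" and k
  have k0: "0 \<le> knorm k" for k by (simp add: knorm_def)
  have f2: "(cmod (f u k))\<^sup>2 = knorm k ^ (2 * s) * (cmod (u k))\<^sup>2" for u k
    by (simp add: f_def norm_mult norm_power power_mult_distrib power_mult[symmetric] k0 mult.commute)
  have off: "u k = 0" if "u \<in> sobolev p kh s" "k \<notin> mode_class p kh" for u k
    using that unfolding sobolev_def by blast
  have s: "(\<lambda>k. (cmod (f u k))\<^sup>2) summable_on UNIV" if u: "u \<in> sobolev p kh s" for u
  proof -
    have "(\<lambda>k. (cmod (f u k))\<^sup>2) summable_on mode_class p kh"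
      using u unfolding f2 by (simp add: sobolev_def)
    moreover have "(cmod (f u k))\<^sup>2 = 0" if "k \<notin> mode_class p kh" for k
      using off[OF u that] by (simp add: f_def)
    ultimately show ?thesis
      using summable_on_cong_neutral[of "mode_class p kh" UNIV "\<lambda>k. (cmod (f u k))\<^sup>2"
          "\<lambda>k. (cmod (f u k))\<^sup>2"] by simp
  qed
  show ?thesis
  proof (rule Metric_space_pullback[of "\<lambda>u. Abs_ell2 (f u)"])
    show "inj_on (\<lambda>u. Abs_ell2 (f u)) (sobolev p kh s)"
    proof (rule inj_onI)
      fix u v assume uv: "u \<in> sobolev p kh s" "v \<in> sobolev p kh s" and "Abs_ell2 (f u) = Abs_ell2 (f v)"
      then have fuv: "f u = f v" using coord_Abs_ell2[OF s] by metis
      show "u = v"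
      proof
        fix k show "u k = v k"
        proof (cases "k \<in> mode_class p kh")
          case True
          then have "k \<noteq> 0" by (auto simp: mode_class_eq)
          then have "knorm k \<noteq> 0" using knorm_ge_1[of k] by auto
          then show ?thesis using fun_cong[OF fuv, of k] by (simp add: f_def)
        qed (simp add: off[OF uv(1)] off[OF uv(2)])
      qed
    qed
    show "sobolev_norm p kh s (u - v) = dist (Abs_ell2 (f u)) (Abs_ell2 (f v))"
      if uv: "u \<in> sobolev p kh s" "v \<in> sobolev p kh s" for u v
    proof -
      have "coord (Abs_ell2 (f u) - Abs_ell2 (f v)) k = f (u - v) k" for k
        by (simp add: coord_Abs_ell2[OF s[OF uv(1)]] coord_Abs_ell2[OF s[OF uv(2)]])
          (simp add: f_def algebra_simps)
      then have "(norm (Abs_ell2 (f u) - Abs_ell2 (f v)))\<^sup>2 = (\<Sum>\<^sub>\<infinity>k. (cmod (f (u - v) k))\<^sup>2)"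
        by (simp only: norm_ell2_square)
      also have "\<dots> = (\<Sum>\<^sub>\<infinity>k\<in>mode_class p kh. (cmod (f (u - v) k))\<^sup>2)"
        by (rule infsum_cong_neutral) (auto simp: f_def off[OF uv(1)] off[OF uv(2)])
      finally show ?thesis
        by (simp add: sobolev_norm_def f2 dist_norm real_sqrt_unique)
    qed
  qed (auto simp: sobolev_norm_nonneg intro: sobolev_norm_sym)
qed

section \<open>The degenerate case\<close>

text \<open>If \<open>b = 0\<close>, the operator vanishes: 0 is an eigenvalue of infinite multiplicity and the
  only point of the spectrum.\<close>

lemma euler_L_eq_0:
  assumes "p \<noteq> 0" "euler_b p \<Gamma> kh = 0"
  shows "euler_L p \<Gamma> kh w = 0"
proof
  fix k
  have "knorm p \<noteq> 0" using knorm_ge_1[OF assms(1)] by auto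
  then consider "\<Gamma> = 0" | "kdet p kh = 0" using assms(2) by (auto simp: euler_b_def)
  then show "euler_L p \<Gamma> kh w k = 0 k"
  proof cases
    case 1
    then show ?thesis by (simp add: euler_L_def)
  next
    case 2
    show ?thesis
    proof (cases "k \<in> mode_class p kh")
      case True
      then obtain n where n: "k = line p kh n" by (auto simp: mode_class_eq)
      show ?thesis
        unfolding euler_L_def n line_add euler_A_eq[OF assms(1)] kdet_line 2 by simp
    qed (simp add: euler_L_def)
  qed
qed

lemma zero_operator_spectra:
  fixes p kh :: "int \<times> int" and s :: nat and T
  assumes p: "p \<noteq> 0" and T: "\<And>w. T w = 0"
  defines "X \<equiv> sobolev p kh s" and "N \<equiv> sobolev_norm p kh s"
  shows "spectrum X N T = {0}" "point_spectrum X T = {0}" "essential_spectrum X N T = {0}"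
    "nondense_residual_spectrum X N T = {}"
proof -
  interpret X: Metric_space X "\<lambda>u v. N (u - v)"
    unfolding X_def N_def by (rule Metric_space_sobolev)
  have top: "topspace (norm_topology X N) = X" by (simp add: norm_topology_def)
  have sh: "shifted T z u = cscale (- z) u" for z u
    by (auto simp: shifted_def T cscale_def)
  have sc: "cscale c u \<in> X" if "u \<in> X" for c u
    using that unfolding X_def by (rule sobolev_cscale)
  have cc: "cscale c (cscale d u) = cscale (c * d) u" "cscale 1 u = u" for c d u
    by (auto simp: cscale_def)
  have onto: "shifted T z ` X = X" if "z \<noteq> 0" for z
  proof (intro equalityI subsetI)
    show "x \<in> X" if "x \<in> shifted T z ` X" for x
      using that sc[of _ "- z"] by (auto simp only: sh)
    show "x \<in> shifted T z ` X" if "x \<in> X" for x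
    proof
      show "x = shifted T z (cscale (- (1 / z)) x)"
        unfolding sh cc(1) using \<open>z \<noteq> 0\<close> by simp
      show "cscale (- (1 / z)) x \<in> X" by (rule sc[OF that])
    qed
  qed
  have inj: "u = v" if "z \<noteq> 0" "shifted T z u = shifted T z v" for z u v
    using that by (auto simp: sh cscale_def fun_eq_iff)
  obtain k where k: "k \<in> mode_class p kh" using infinite_mode_class[OF p, of kh]
    by (metis finite.emptyI all_not_in_conv)
  define e :: "int \<times> int \<Rightarrow> int \<times> int \<Rightarrow> complex" where "e k l = (if l = k then 1 else 0)" for k l
  have e: "e k \<in> X" "e k \<noteq> 0" if "k \<in> mode_class p kh" for k
  proof -
    show "e k \<in> X" using sobolev_unit[OF that] unfolding X_def e_def[abs_def] .
    have "e k k \<noteq> 0" by (simp add: e_def)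
    then show "e k \<noteq> 0" by (metis zero_fun_def)
  qed
  have res: "z \<in> resolvent_set X N T" if z: "z \<noteq> 0" for z
  proof -
    have "N u \<le> 1 / cmod z * N (shifted T z u)" for u
      unfolding sh N_def sobolev_cscale(2) using z by simp
    then have "\<exists>C. \<forall>u\<in>X. N u \<le> C * N (shifted T z u)" by blast
    moreover have "bij_betw (shifted T z) X X"
      unfolding bij_betw_def using onto[OF z] inj[OF z] by (auto intro!: inj_onI)
    ultimately show ?thesis by (simp add: resolvent_set_def)
  qed
  have ker: "shifted T 0 u = 0" for u by (auto simp: sh cscale_def)
  have "0 \<notin> resolvent_set X N T"
  proof
    assume "0 \<in> resolvent_set X N T"
    then have "shifted T 0 ` X = X" by (simp add: resolvent_set_def bij_betw_def)
    then have "e k \<in> shifted T 0 ` X" using e(1)[OF k] by simp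
    then show False using e(2)[OF k] unfolding ker by blast
  qed
  then show "spectrum X N T = {0}" using res by (auto simp: spectrum_def)
  have "0 \<in> point_spectrum X T"
    unfolding point_spectrum_def T mem_Collect_eq
    by (rule bexI[of _ "e k"]) (use e[OF k] in \<open>auto simp: cscale_def\<close>)
  moreover have "z = 0" if zp: "z \<in> point_spectrum X T" for z
  proof (rule ccontr)
    assume z: "z \<noteq> 0"
    obtain u :: "int \<times> int \<Rightarrow> complex" where u: "u \<noteq> 0" "0 = cscale z u"
      using zp unfolding point_spectrum_def T by blast
    have "u l = 0" for l
      using fun_cong[OF u(2), of l] z by (simp add: cscale_def)
    then show False using u(1) by (simp add: fun_eq_iff)
  qed
  ultimately show ps: "point_spectrum X T = {0}" by blast
  have "closedin (norm_topology X N) X" using closedin_topspace[of "norm_topology X N"] by (simp add: top)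
  then have "fredholm X N (shifted T z)" if z: "z \<noteq> 0" for z
    unfolding fredholm_def onto[OF z]
  proof (intro conjI exI[of _ "{}"])
    show "{u \<in> X. shifted T z u = 0} \<subseteq> cseq.span {}"
      using inj[OF z, of _ 0] by (auto simp: sh cscale_def fun_eq_iff)
    show "\<forall>u\<in>X. \<exists>v\<in>X. u - shifted T z v \<in> cseq.span {}"
    proof
      fix u assume "u \<in> X"
      then obtain v where "v \<in> X" "u = shifted T z v" using onto[OF z] by blast
      then show "\<exists>v\<in>X. u - shifted T z v \<in> cseq.span {}" by (intro bexI[of _ v]) auto
    qed
  qed auto
  moreover have "\<not> fredholm X N (shifted T 0)"
  proof
    assume "fredholm X N (shifted T 0)"
    then obtain B where B: "finite B" "X \<subseteq> cseq.span B" by (auto simp: fredholm_def ker)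
    have inje: "inj_on e (mode_class p kh)" by (auto simp: inj_on_def e_def fun_eq_iff)
    have "cseq.independent (e ` mode_class p kh)"
      unfolding cseq.independent_explicit_module
    proof (intro allI impI)
      fix S c v
      assume S: "finite S" "S \<subseteq> e ` mode_class p kh" "(\<Sum>v\<in>S. cscale (c v) v) = 0" "v \<in> S"
      then obtain l where l: "l \<in> mode_class p kh" "v = e l" by blast
      have "(\<Sum>v\<in>S. cscale (c v) v) l = (\<Sum>w\<in>S. c w * w l)"
        using S(1) by (induction S) (auto simp: cscale_def)
      also have "\<dots> = (\<Sum>w\<in>S. if w = v then c v else 0)"
      proof (rule sum.cong)
        fix w assume "w \<in> S"
        then obtain m where "w = e m" using S(2) by blast
        then show "c w * w l = (if w = v then c v else 0)"
          by (cases "m = l") (auto simp: l(2), auto simp: e_def fun_eq_iff)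
      qed simp
      finally have "(\<Sum>v\<in>S. cscale (c v) v) l = c v" using S(1,4) by simp
      then show "c v = 0" using S(3) by simp
    qed
    moreover have "e ` mode_class p kh \<subseteq> cseq.span B" using e(1) B(2) by blast
    ultimately have "finite (e ` mode_class p kh)"
      using cseq.independent_span_bound[OF B(1)] by blast
    then show False using finite_imageD[OF _ inje] infinite_mode_class[OF p] by blast
  qed
  ultimately show "essential_spectrum X N T = {0}" by (auto simp: essential_spectrum_def)
  have "norm_topology X N closure_of (shifted T z ` X) = X" if "z \<noteq> 0" for z
    unfolding onto[OF that] using closure_of_topspace[of "norm_topology X N"] by (simp add: top)
  then show "nondense_residual_spectrum X N T = {}"
    by (auto simp: nondense_residual_spectrum_def ps)
qed

section \<open>The nondegenerate case\<close>

text \<open>Here \<open>\<rho> n\<close> is the factor by which the coefficient at \<open>k\<^sub>n = kh + n p\<close> differs from its limit,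
  \<open>W n\<close> is the Sobolev weight, and \<open>\<alpha>\<close>, \<open>\<beta>\<close> are the coefficients after removal of the weight.
  The sequence \<open>v\<close> corresponds to the family with value \<open>e\<^sup>n v\<^sub>n / \<bar>k\<^sub>n\<bar>\<^sup>s\<close> at the point
  \<open>k\<^sub>n\<close>, where \<open>e = \<Gamma> / \<bar>\<Gamma>\<bar>\<close>: the weight makes this an isometry onto the Sobolev space,
  and the phase makes the coefficients of the operator real.\<close>

locale nondegenerate_class =
  fixes p kh :: "int \<times> int" and \<Gamma> :: complex and s :: nat
  assumes p: "p \<noteq> 0" and nondeg: "euler_b p \<Gamma> kh \<noteq> 0"
begin

abbreviation "b \<equiv> euler_b p \<Gamma> kh"
abbreviation "K \<equiv> line p kh"

definition \<rho> :: "int \<Rightarrow> real" where "\<rho> n = 1 - (knorm p)\<^sup>2 / (knorm (K n))\<^sup>2"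

definition W :: "int \<Rightarrow> real" where "W n = knorm (K n) ^ s"

definition \<alpha> :: "int \<Rightarrow> real" where "\<alpha> n = \<rho> n * (W (n + 1) / W n)"

definition \<beta> :: "int \<Rightarrow> real" where "\<beta> n = \<rho> n * (W (n - 1) / W n)"

definition phase :: "int \<Rightarrow> complex" where "phase n = (\<Gamma> / of_real (cmod \<Gamma>)) powi n"

definition J :: "int ell2 \<Rightarrow> int \<times> int \<Rightarrow> complex" where
  "J v k = (if k \<in> range K then phase (inv K k) * coord v (inv K k) / of_real (W (inv K k)) else 0)"

lemma \<Gamma>: "\<Gamma> \<noteq> 0" using nondeg by (auto simp: euler_b_def)

lemma inj_K: "inj K" using p by (rule inj_line)

lemma K_nonzero: "K n \<noteq> 0"
proof
  assume "K n = 0"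
  then have "kdet p kh = 0" using kdet_line[of p kh n] by (simp add: kdet_def)
  then show False using nondeg by (simp add: euler_b_def)
qed

lemma knorm_K: "1 \<le> knorm (K n)" by (rule knorm_ge_1[OF K_nonzero])

lemma W: "1 \<le> W n" unfolding W_def by (rule one_le_power[OF knorm_K])

lemma W_pos: "0 < W n" "W n \<noteq> 0" using W[of n] by linarith+

lemma mode_class_K: "mode_class p kh = range K"
  using K_nonzero by (auto simp: mode_class_eq)

lemma bij_K: "bij_betw K UNIV (mode_class p kh)"
  unfolding mode_class_K by (rule bij_betw_imageI[OF inj_K]) simp

lemma phase: "cmod (phase n) = 1" "phase n \<noteq> 0"
  using \<Gamma> by (auto simp: phase_def norm_power_int norm_divide)

lemma phase_step:
  "\<Gamma> * phase (n - 1) = of_real (cmod \<Gamma>) * phase n" "cnj \<Gamma> * phase (n + 1) = of_real (cmod \<Gamma>) * phase n"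
proof -
  have c: "of_real (cmod \<Gamma>) \<noteq> (0 :: complex)" "\<Gamma> / of_real (cmod \<Gamma>) \<noteq> 0" using \<Gamma> by auto
  show "\<Gamma> * phase (n - 1) = of_real (cmod \<Gamma>) * phase n"
    using c \<Gamma> by (simp add: phase_def power_int_diff field_simps)
  have "cnj \<Gamma> * \<Gamma> = of_real (cmod \<Gamma>) * of_real (cmod \<Gamma>)"
    by (simp add: complex_norm_square[symmetric] power2_eq_square[symmetric] mult.commute)
  then have "cnj \<Gamma> * (\<Gamma> / of_real (cmod \<Gamma>)) = of_real (cmod \<Gamma>)" using c(1) by simp
  moreover have "phase (n + 1) = (\<Gamma> / of_real (cmod \<Gamma>)) * phase n"
    unfolding phase_def using c(2) by (simp add: power_int_add)
  ultimately show "cnj \<Gamma> * phase (n + 1) = of_real (cmod \<Gamma>) * phase n"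
    by (metis mult.assoc)
qed

lemma J_K: "J v (K n) = phase n * coord v n / of_real (W n)"
  by (simp add: J_def inv_f_f[OF inj_K])

lemma J_off: "k \<notin> mode_class p kh \<Longrightarrow> J v k = 0"
  by (simp add: J_def mode_class_K)

lemma weighted_square: "knorm (K n) ^ (2 * s) * (cmod (J v (K n)))\<^sup>2 = (cmod (coord v n))\<^sup>2"
proof -
  have "knorm (K n) ^ (2 * s) = (W n)\<^sup>2" by (simp add: W_def power_mult[symmetric] mult.commute)
  then show ?thesis
    using W_pos[of n] by (simp add: J_K norm_mult norm_divide phase power_divide)
qed

lemma \<rho>_limit: "(\<rho> \<longlongrightarrow> 1) cofinite"
proof -
  have "((\<lambda>n. 1 - (knorm p)\<^sup>2 * (1 / knorm (K n))\<^sup>2) \<longlongrightarrow> 1 - (knorm p)\<^sup>2 * 0\<^sup>2) cofinite"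
    by (intro tendsto_intros inverse_knorm_line_tendsto p)
  then show ?thesis by (simp add: \<rho>_def[abs_def] power_divide)
qed

lemma ratio_limit: "((\<lambda>n. knorm (K (n + 1)) / knorm (K n)) \<longlongrightarrow> 1) cofinite"
  "((\<lambda>n. knorm (K (n - 1)) / knorm (K n)) \<longlongrightarrow> 1) cofinite"
proof -
  have gen: "((\<lambda>n. f n / knorm (K n)) \<longlongrightarrow> 1) cofinite" if f: "\<And>n. \<bar>f n - knorm (K n)\<bar> \<le> knorm p" for f
  proof -
    have "((\<lambda>n. f n / knorm (K n) - 1) \<longlongrightarrow> 0) cofinite"
    proof (rule Lim_null_comparison)
      have "norm (f n / knorm (K n) - 1) \<le> knorm p * (1 / knorm (K n))" for n
      proof -
        have k: "knorm (K n) > 0" using knorm_K[of n] by linarith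
        then have "f n / knorm (K n) - 1 = (f n - knorm (K n)) / knorm (K n)"
          by (simp add: diff_divide_distrib)
        then show ?thesis using k f[of n] by (simp add: abs_divide divide_right_mono)
      qed
      then show "\<forall>\<^sub>F n in cofinite. norm (f n / knorm (K n) - 1) \<le> knorm p * (1 / knorm (K n))" by simp
      show "((\<lambda>n. knorm p * (1 / knorm (K n))) \<longlongrightarrow> 0) cofinite"
        by (rule tendsto_mult_right_zero[OF inverse_knorm_line_tendsto[OF p]])
    qed
    then show ?thesis by (simp add: LIM_zero_iff)
  qed
  show "((\<lambda>n. knorm (K (n + 1)) / knorm (K n)) \<longlongrightarrow> 1) cofinite"
    by (rule gen) (rule knorm_line_step)
  show "((\<lambda>n. knorm (K (n - 1)) / knorm (K n)) \<longlongrightarrow> 1) cofinite"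
  proof (rule gen)
    show "\<bar>knorm (K (n - 1)) - knorm (K n)\<bar> \<le> knorm p" for n
      using knorm_line_step[of p kh "n - 1"] by (simp add: abs_minus_commute)
  qed
qed

sublocale L: limit_shift b \<alpha> \<beta>
proof
  show "b \<noteq> 0" by (rule nondeg)
  have "((\<lambda>n. \<rho> n * (knorm (K (n + 1)) / knorm (K n)) ^ s) \<longlongrightarrow> 1 * 1 ^ s) cofinite"
    by (intro tendsto_intros \<rho>_limit ratio_limit)
  then show "(\<alpha> \<longlongrightarrow> 1) cofinite" by (simp add: \<alpha>_def[abs_def] W_def power_divide)
  have "((\<lambda>n. \<rho> n * (knorm (K (n - 1)) / knorm (K n)) ^ s) \<longlongrightarrow> 1 * 1 ^ s) cofinite"
    by (intro tendsto_intros \<rho>_limit ratio_limit)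
  then show "(\<beta> \<longlongrightarrow> 1) cofinite" by (simp add: \<beta>_def[abs_def] W_def power_divide)
qed

lemma euler_L_J: "euler_L p \<Gamma> kh (J v) = J (L.M v)"
proof
  fix k
  show "euler_L p \<Gamma> kh (J v) k = J (L.M v) k"
  proof (cases "k \<in> mode_class p kh")
    case True
    then obtain n where n: "k = K n" by (auto simp: mode_class_K)
    have coeff: "of_real (euler_A p (K m)) * of_real (cmod \<Gamma>) = (of_real (b * \<rho> m) :: complex)"
      "of_real (euler_A (- p) (K m)) * of_real (cmod \<Gamma>) = (- of_real (b * \<rho> m) :: complex)" for m
      unfolding euler_A_eq[OF p] kdet_line of_real_mult[symmetric] of_real_minus[symmetric]
      by (simp_all add: euler_b_def \<rho>_def)
    have "euler_L p \<Gamma> kh (J v) k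
        = of_real (euler_A p (K (n - 1))) * \<Gamma> * J v (K (n - 1))
          + of_real (euler_A (- p) (K (n + 1))) * cnj \<Gamma> * J v (K (n + 1))"
      using True by (simp add: euler_L_def n line_add K_nonzero)
    also have "of_real (euler_A p (K (n - 1))) * \<Gamma> * J v (K (n - 1))
        = of_real (euler_A p (K (n - 1))) * (\<Gamma> * phase (n - 1)) * coord v (n - 1) / of_real (W (n - 1))"
      by (simp add: J_K)
    also have "\<dots> = of_real (b * \<rho> (n - 1)) * phase n * coord v (n - 1) / of_real (W (n - 1))"
      unfolding phase_step by (simp add: mult.assoc[symmetric] coeff)
    also have "of_real (euler_A (- p) (K (n + 1))) * cnj \<Gamma> * J v (K (n + 1))
        = of_real (euler_A (- p) (K (n + 1))) * (cnj \<Gamma> * phase (n + 1)) * coord v (n + 1) / of_real (W (n + 1))"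
      by (simp add: J_K)
    also have "\<dots> = - of_real (b * \<rho> (n + 1)) * phase n * coord v (n + 1) / of_real (W (n + 1))"
      unfolding phase_step by (simp add: mult.assoc[symmetric] coeff)
    also have "of_real (b * \<rho> (n - 1)) * phase n * coord v (n - 1) / of_real (W (n - 1))
        + - of_real (b * \<rho> (n + 1)) * phase n * coord v (n + 1) / of_real (W (n + 1))
        = phase n * coord (L.M v) n / of_real (W n)"
      using W_pos[of n] by (simp add: L.coord_M \<alpha>_def \<beta>_def field_simps)
    finally show ?thesis by (simp add: n J_K)
  next
    case False
    then show ?thesis by (simp add: euler_L_def J_off)
  qed
qed

lemma sobolev_J: "w \<in> sobolev p kh s \<longleftrightarrow> (\<exists>v. w = J v)"
proof
  assume "\<exists>v. w = J v"
  then obtain v where w: "w = J v" by blast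
  have "(\<lambda>k. knorm k ^ (2 * s) * (cmod (w k))\<^sup>2) summable_on mode_class p kh"
    using summable_on_reindex_bij_betw[OF bij_K, of "\<lambda>k. knorm k ^ (2 * s) * (cmod (w k))\<^sup>2"]
    by (simp add: w weighted_square coord_summable)
  then show "w \<in> sobolev p kh s" by (simp add: sobolev_def w J_off)
next
  assume w: "w \<in> sobolev p kh s"
  define f where "f n = of_real (W n) * w (K n) / phase n" for n
  have f2: "(cmod (f n))\<^sup>2 = knorm (K n) ^ (2 * s) * (cmod (w (K n)))\<^sup>2" for n
  proof -
    have "(W n)\<^sup>2 = knorm (K n) ^ (2 * s)" by (simp add: W_def power_mult[symmetric] mult.commute)
    then show ?thesis by (simp add: f_def norm_mult norm_divide phase power_mult_distrib)
  qed
  have "(\<lambda>k. knorm k ^ (2 * s) * (cmod (w k))\<^sup>2) summable_on mode_class p kh"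
    using w by (simp add: sobolev_def)
  then have sf: "(\<lambda>n. (cmod (f n))\<^sup>2) summable_on UNIV"
    unfolding f2 using summable_on_reindex_bij_betw[OF bij_K, of "\<lambda>k. knorm k ^ (2 * s) * (cmod (w k))\<^sup>2"]
    by simp
  have "w k = J (Abs_ell2 f) k" for k
  proof (cases "k \<in> mode_class p kh")
    case True
    then obtain n where n: "k = K n" by (auto simp: mode_class_K)
    show ?thesis
      using W_pos[of n] phase(2)[of n] by (simp add: n J_K coord_Abs_ell2[OF sf] f_def)
  next
    case False
    then have "w k = 0" using w unfolding sobolev_def by blast
    then show ?thesis by (simp add: J_off[OF False])
  qed
  then show "\<exists>v. w = J v" by blast
qed

sublocale E: ell2_model "sobolev p kh s" "sobolev_norm p kh s" "euler_L p \<Gamma> kh" J L.M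
proof
  show "bij_betw J UNIV (sobolev p kh s)"
  proof (rule bij_betw_imageI)
    show "inj J"
    proof (rule injI)
      fix u v assume "J u = J v"
      then have "J u (K n) = J v (K n)" for n by simp
      then show "u = v"
        using W_pos(2) phase(2) by (intro ell2_eqI) (simp add: J_K)
    qed
    show "range J = sobolev p kh s" using sobolev_J by blast
  qed
  show "J (u - v) = J u - J v" for u v
    by (rule ext) (simp add: J_def algebra_simps diff_divide_distrib)
  show "J (scaleC c v) = cscale c (J v)" for c v
    by (rule ext) (simp add: J_def cscale_def)
  show "sobolev_norm p kh s (J v) = norm v" for v
  proof -
    have "(\<Sum>\<^sub>\<infinity>k\<in>mode_class p kh. knorm k ^ (2 * s) * (cmod (J v k))\<^sup>2) = (norm v)\<^sup>2"
      using infsum_reindex_bij_betw[OF bij_K, of "\<lambda>k. knorm k ^ (2 * s) * (cmod (J v k))\<^sup>2"]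
      by (simp add: weighted_square norm_ell2_square)
    then show ?thesis by (simp add: sobolev_norm_def)
  qed
qed (auto simp: sobolev_norm_nonneg euler_L_J intro: sobolev_norm_sym)

lemma E_A: "E.A z = L.A z"
  by (rule ext) (simp add: E.A_def L.A_def)

lemma continuous_spectrum:
  "continuous_spectrum (sobolev p kh s) (sobolev_norm p kh s) (euler_L p \<Gamma> kh) = imag_segment (2 * \<bar>b\<bar>)"
  using L.off_segment(1) L.on_segment_range_not_closed
  unfolding set_eq_iff E.continuous_spectrum_iff E_A by blast

lemma essential_spectrum:
  "essential_spectrum (sobolev p kh s) (sobolev_norm p kh s) (euler_L p \<Gamma> kh) = imag_segment (2 * \<bar>b\<bar>)"
proof -
  have "fredholm (sobolev p kh s) (sobolev_norm p kh s) (shifted (euler_L p \<Gamma> kh) z)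
      \<longleftrightarrow> z \<notin> imag_segment (2 * \<bar>b\<bar>)" for z
    using E.fredholmI[of z] L.off_segment[of z] E.fredholm_closed_range[of z]
      L.on_segment_range_not_closed[of z] unfolding E_A by blast
  then show ?thesis by (simp add: essential_spectrum_def)
qed

lemma resolvent_of_no_eigenvalue:
  assumes "z \<notin> imag_segment (2 * \<bar>b\<bar>)" "z \<notin> point_spectrum (sobolev p kh s) (euler_L p \<Gamma> kh)"
  shows "bij (E.A z)" "z \<in> resolvent_set (sobolev p kh s) (sobolev_norm p kh s) (euler_L p \<Gamma> kh)"
proof -
  interpret B: bounded_linear "L.A z" by (rule L.bounded_linear_A)
  have "inj (L.A z)"
    using assms(2) B.inj_iff_eq_0 by (auto simp: E.point_spectrum_iff E_A linear_injective_0[OF B.linear_axioms])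
  from L.off_segment(4)[OF assms(1) this, folded E_A]
  show "bij (E.A z)" "z \<in> resolvent_set (sobolev p kh s) (sobolev_norm p kh s) (euler_L p \<Gamma> kh)"
    using E.resolvent_setI by blast+
qed

lemma residual_spectrum:
  "residual_spectrum (sobolev p kh s) (sobolev_norm p kh s) (euler_L p \<Gamma> kh) = {}"
  using resolvent_of_no_eigenvalue(2)
  by (auto simp: residual_spectrum_def spectrum_def continuous_spectrum)

lemma nondense_residual_spectrum:
  assumes "s = 0"
  shows "nondense_residual_spectrum (sobolev p kh s) (sobolev_norm p kh s) (euler_L p \<Gamma> kh) = {}"
proof -
  have "\<beta> = \<alpha>" unfolding fun_eq_iff \<alpha>_def \<beta>_def W_def using assms by simp
  have "closure (range (E.A z)) = UNIV"
    if z: "z \<notin> point_spectrum (sobolev p kh s) (euler_L p \<Gamma> kh)" for z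
  proof (cases "z \<in> imag_segment (2 * \<bar>b\<bar>)")
    case True
    then have "Re z = 0" by (simp add: imag_segment_iff)
    moreover have "v = 0" if "L.A z v = 0" for v
      using z that by (auto simp: E.point_spectrum_iff E_A)
    ultimately show ?thesis unfolding E_A by (rule L.dense_range[OF \<open>\<beta> = \<alpha>\<close>])
  next
    case False
    then show ?thesis using resolvent_of_no_eigenvalue(1)[OF _ z] by (simp add: bij_def)
  qed
  then show ?thesis
    using E.closure_of_range_eq by (auto simp: nondense_residual_spectrum_def)
qed

lemma point_spectrum_symmetric:
  assumes "z \<in> point_spectrum (sobolev p kh s) (euler_L p \<Gamma> kh)"
  shows "cnj z \<in> point_spectrum (sobolev p kh s) (euler_L p \<Gamma> kh)"
    "- cnj z \<in> point_spectrum (sobolev p kh s) (euler_L p \<Gamma> kh)"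
  using assms L.eigenvalue_symmetric unfolding E.point_spectrum_iff E_A by blast+

lemma no_eigenvalue_outside_disk:
  assumes "mode_class p kh \<inter> mode_disk p = {}"
  shows "point_spectrum (sobolev p kh s) (euler_L p \<Gamma> kh) = {}"
proof -
  have large: "knorm p < knorm (K n)" for n
  proof -
    have "K n \<in> mode_class p kh" by (simp add: mode_class_K)
    then have "K n \<notin> mode_disk p" using assms by blast
    then show ?thesis using K_nonzero[of n] by (simp add: mode_disk_def)
  qed
  have \<rho>: "0 < \<rho> n" "\<rho> n \<le> 1" for n
  proof -
    have "0 \<le> knorm p" by (simp add: knorm_def)
    then have "(knorm p)\<^sup>2 < (knorm (K n))\<^sup>2" using large by (intro power_strict_mono) auto
    then show "0 < \<rho> n" "\<rho> n \<le> 1" by (auto simp: \<rho>_def divide_less_eq)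
  qed
  have sum: "summable (\<lambda>k. 1 - \<rho> (int k))"
    using summable_inverse_knorm_line[OF p] by (simp add: \<rho>_def)
  have "v = 0" if "L.A z v = 0" for z v
  proof -
    define x where "x n = coord v n / of_real (W n)" for n
    have "x n = 0" for n
    proof (rule eigenvector_zero[OF nondeg \<rho> sum])
      show "(x \<longlongrightarrow> 0) cofinite"
      proof (rule Lim_null_comparison)
        have "norm (x n) \<le> norm (coord v n)" for n
        proof -
          have "cmod (coord v n) * 1 \<le> cmod (coord v n) * W n" by (rule mult_left_mono[OF W]) simp
          then show ?thesis using W_pos[of n] by (simp add: x_def norm_divide pos_divide_le_eq)
        qed
        then show "\<forall>\<^sub>F n in cofinite. norm (x n) \<le> norm (coord v n)" by simp
        show "((\<lambda>n. norm (coord v n)) \<longlongrightarrow> 0) cofinite"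
          using coord_tendsto_0 by (rule tendsto_norm_zero)
      qed
      fix n
      have eq: "of_real b * (of_real (\<alpha> (n - 1)) * coord v (n - 1) - of_real (\<beta> (n + 1)) * coord v (n + 1))
          = z * coord v n" using that unfolding L.A_eq_0_iff by blast
      have scaled: "of_real (\<alpha> (n - 1)) * coord v (n - 1) = of_real (W n) * (of_real (\<rho> (n - 1)) * x (n - 1))"
        "of_real (\<beta> (n + 1)) * coord v (n + 1) = of_real (W n) * (of_real (\<rho> (n + 1)) * x (n + 1))"
        "coord v n = of_real (W n) * x n"
        using W_pos(2) by (simp_all add: \<alpha>_def \<beta>_def x_def)
      have "of_real (W n) * (of_real b * (of_real (\<rho> (n - 1)) * x (n - 1) - of_real (\<rho> (n + 1)) * x (n + 1)))
          = of_real b * (of_real (W n) * (of_real (\<rho> (n - 1)) * x (n - 1))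
            - of_real (W n) * (of_real (\<rho> (n + 1)) * x (n + 1)))"
        by (simp add: algebra_simps)
      also have "\<dots> = of_real (W n) * (z * x n)"
        unfolding scaled(1,2)[symmetric] eq scaled(3) by (rule mult.left_commute)
      finally show "of_real b * (of_real (\<rho> (n - 1)) * x (n - 1) - of_real (\<rho> (n + 1)) * x (n + 1)) = z * x n"
        using W_pos(2)[of n] by (simp only: mult_cancel_left of_real_eq_0_iff) blast
    qed
    then show ?thesis using W_pos(2) by (intro ell2_eqI) (simp add: x_def)
  qed
  then show ?thesis by (auto simp: E.point_spectrum_iff E_A)
qed

lemma spectrum_outside_disk:
  assumes "mode_class p kh \<inter> mode_disk p = {}"
  shows "spectrum (sobolev p kh s) (sobolev_norm p kh s) (euler_L p \<Gamma> kh) = imag_segment (2 * \<bar>b\<bar>)"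
  using resolvent_of_no_eigenvalue(2) no_eigenvalue_outside_disk[OF assms]
    E.resolvent_set_closed_range L.on_segment_range_not_closed
  unfolding spectrum_def E_A by blast

end

section \<open>The spectrum of the linearized Euler operator\<close>

theorem theorem2p4:
  fixes p kh :: "int \<times> int" and \<Gamma> :: complex and s :: nat
  assumes "p \<noteq> 0" and "kh \<noteq> 0"
  shows "(mode_class p kh \<inter> mode_disk p = {} \<longrightarrow>
      spectrum (sobolev p kh s) (sobolev_norm p kh s) (euler_L p \<Gamma> kh)
        = imag_segment (2 * \<bar>euler_b p \<Gamma> kh\<bar>) \<and>
      (euler_b p \<Gamma> kh \<noteq> 0 \<longrightarrow>
        continuous_spectrum (sobolev p kh s) (sobolev_norm p kh s) (euler_L p \<Gamma> kh)
          = imag_segment (2 * \<bar>euler_b p \<Gamma> kh\<bar>)) \<and>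
      residual_spectrum (sobolev p kh s) (sobolev_norm p kh s) (euler_L p \<Gamma> kh) = {} \<and>
      (s = 0 \<longrightarrow>
        nondense_residual_spectrum (sobolev p kh s) (sobolev_norm p kh s) (euler_L p \<Gamma> kh) = {}) \<and>
      (euler_b p \<Gamma> kh \<noteq> 0 \<longrightarrow> point_spectrum (sobolev p kh s) (euler_L p \<Gamma> kh) = {})) \<and>
    (mode_class p kh \<inter> mode_disk p \<noteq> {} \<longrightarrow>
      essential_spectrum (sobolev p kh s) (sobolev_norm p kh s) (euler_L p \<Gamma> kh)
        = imag_segment (2 * \<bar>euler_b p \<Gamma> kh\<bar>) \<and>
      (euler_b p \<Gamma> kh \<noteq> 0 \<longrightarrow>
        continuous_spectrum (sobolev p kh s) (sobolev_norm p kh s) (euler_L p \<Gamma> kh)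
          = imag_segment (2 * \<bar>euler_b p \<Gamma> kh\<bar>)) \<and>
      residual_spectrum (sobolev p kh s) (sobolev_norm p kh s) (euler_L p \<Gamma> kh) = {} \<and>
      (s = 0 \<longrightarrow>
        nondense_residual_spectrum (sobolev p kh s) (sobolev_norm p kh s) (euler_L p \<Gamma> kh) = {}) \<and>
      (\<forall>z \<in> point_spectrum (sobolev p kh s) (euler_L p \<Gamma> kh).
        cnj z \<in> point_spectrum (sobolev p kh s) (euler_L p \<Gamma> kh) \<and>
        - cnj z \<in> point_spectrum (sobolev p kh s) (euler_L p \<Gamma> kh)))"
proof (cases "euler_b p \<Gamma> kh = 0")
  case True
  note z = zero_operator_spectra[OF assms(1) euler_L_eq_0[OF assms(1) True], of kh s]
  have "imag_segment (2 * \<bar>euler_b p \<Gamma> kh\<bar>) = {0}"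
    using True by (auto simp: imag_segment_iff complex_eq_iff)
  moreover have "residual_spectrum (sobolev p kh s) (sobolev_norm p kh s) (euler_L p \<Gamma> kh) = {}"
    by (simp add: residual_spectrum_def z(1,2))
  ultimately show ?thesis unfolding z using True by simp
next
  case False
  interpret nondegenerate_class p kh \<Gamma> s
    by unfold_locales (use assms(1) False in auto)
  show ?thesis
    using spectrum_outside_disk continuous_spectrum residual_spectrum nondense_residual_spectrum
      no_eigenvalue_outside_disk essential_spectrum point_spectrum_symmetric by blast
qed

end
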